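(* Let $k$ be a field and let $\Lambda=kQ/I$ be a quadratic monomial algebra. Then every finitely presented graded left $\Lambda$-module $M$ has a rational Poincaré series; that is, the power series $$P^{\Lambda}_M(t)=\sum_{n\ge0}\dim_k\bigl(\operatorname{Ext}^n_\Lambda(M,\Lambda_0)\bigr)\,t^n$$ is a rational function of $t$.
   Context: A quadratic monomial algebra is $\Lambda=kQ/I$ with $Q$ a finite quiver (vertex set $Q_0$) and $I$ an ideal generated by paths of length $2$; it is not assumed finite-dimensional. It is graded by path length, and $\Lambda_0=\Lambda/\Lambda_{\ge1}$ is the semisimple left module that is the direct sum of the simple modules $S_x$, $x\in Q_0$. Graded modules are $\mathbb Z$-graded left modules with finite-dimensional homogeneous components; $M\langle i\rangle_n=M_{n-i}$. A graded module $M$ is finitely presented if there is an exact sequence $P^1\to P^0\to M\to 0$ of graded modules with $P^0,P^1$ finite direct sums of modules $P_x\langle i\rangle$, where $P_x=\Lambda e_x$. $\operatorname{Ext}$ is the ungraded (total) Ext. *)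

theory Defs
  imports
    Graph_Theory.Arc_Walk
    "HOL-Library.Poly_Mapping"
    "HOL-Library.FSet"
    "HOL-Library.FuncSet"
    "HOL-Computational_Algebra.Polynomial_FPS"
    "HOL-Algebra.Module"
    "HOL-Algebra.QuotRing"
begin

section \<open>Left modules over a not necessarily commutative ring\<close>

text \<open>
  The locale \<^verbatim>\<open>module\<close> of HOL-Algebra requires a commutative base ring; only its record type is
  used here (whose fields \<^verbatim>\<open>mult\<close> and \<^verbatim>\<open>one\<close> carry no meaning for a module).
\<close>

locale left_module = R?: ring R + M?: abelian_group M
  for R (structure) and M (structure) +
  assumes lsmult_closed: "\<lbrakk>a \<in> carrier R; x \<in> carrier M\<rbrakk> \<Longrightarrow> a \<odot>\<^bsub>M\<^esub> x \<in> carrier M"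
    and lsmult_l_distr: "\<lbrakk>a \<in> carrier R; b \<in> carrier R; x \<in> carrier M\<rbrakk> \<Longrightarrow>
      (a \<oplus>\<^bsub>R\<^esub> b) \<odot>\<^bsub>M\<^esub> x = a \<odot>\<^bsub>M\<^esub> x \<oplus>\<^bsub>M\<^esub> b \<odot>\<^bsub>M\<^esub> x"
    and lsmult_r_distr: "\<lbrakk>a \<in> carrier R; x \<in> carrier M; y \<in> carrier M\<rbrakk> \<Longrightarrow>
      a \<odot>\<^bsub>M\<^esub> (x \<oplus>\<^bsub>M\<^esub> y) = a \<odot>\<^bsub>M\<^esub> x \<oplus>\<^bsub>M\<^esub> a \<odot>\<^bsub>M\<^esub> y"
    and lsmult_assoc: "\<lbrakk>a \<in> carrier R; b \<in> carrier R; x \<in> carrier M\<rbrakk> \<Longrightarrow>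
      (a \<otimes>\<^bsub>R\<^esub> b) \<odot>\<^bsub>M\<^esub> x = a \<odot>\<^bsub>M\<^esub> (b \<odot>\<^bsub>M\<^esub> x)"
    and lsmult_one: "x \<in> carrier M \<Longrightarrow> \<one>\<^bsub>R\<^esub> \<odot>\<^bsub>M\<^esub> x = x"

text \<open>
  Homomorphisms are extensional functions, so that distinct elements of \<^verbatim>\<open>lmod_hom\<close> are distinct
  maps on the carrier.
\<close>

definition lmod_hom ::
    "('r, 'x) ring_scheme \<Rightarrow> ('r, 'm, 'y) module_scheme \<Rightarrow> ('r, 'n, 'z) module_scheme \<Rightarrow> ('m \<Rightarrow> 'n) set" where
  "lmod_hom R M N = {f \<in> carrier M \<rightarrow>\<^sub>E carrier N.
     (\<forall>x\<in>carrier M. \<forall>y\<in>carrier M. f (x \<oplus>\<^bsub>M\<^esub> y) = f x \<oplus>\<^bsub>N\<^esub> f y) \<and>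
     (\<forall>a\<in>carrier R. \<forall>x\<in>carrier M. f (a \<odot>\<^bsub>M\<^esub> x) = a \<odot>\<^bsub>N\<^esub> f x)}"

definition quot_module :: "('r, 'm, 'y) module_scheme \<Rightarrow> 'm set \<Rightarrow> ('r, 'm set) module" where
  "quot_module M N =
    \<lparr>carrier = a_rcosets\<^bsub>M\<^esub> N, mult = undefined, one = undefined,
     zero = N, add = set_add M,
     smult = (\<lambda>a X. \<Union>x\<in>X. N +>\<^bsub>M\<^esub> (a \<odot>\<^bsub>M\<^esub> x))\<rparr>"

section \<open>Dimension over a field\<close>

text \<open>Here the scalars are all elements of a type \<^verbatim>\<open>'k\<close> of class field.\<close>

definition is_basis :: "('k, 'm, 'y) module_scheme \<Rightarrow> 'm list \<Rightarrow> bool" where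
  "is_basis V bs \<longleftrightarrow> set bs \<subseteq> carrier V \<and>
     (\<forall>v\<in>carrier V. \<exists>!c. c \<in> {..<length bs} \<rightarrow>\<^sub>E UNIV \<and>
        v = (\<Oplus>\<^bsub>V\<^esub>i\<in>{..<length bs}. c i \<odot>\<^bsub>V\<^esub> (bs ! i)))"

definition finite_dimensional :: "('k, 'm, 'y) module_scheme \<Rightarrow> bool" where
  "finite_dimensional V \<longleftrightarrow> (\<exists>bs. is_basis V bs)"

definition dimension :: "('k, 'm, 'y) module_scheme \<Rightarrow> nat" where
  "dimension V = (THE n. \<exists>bs. is_basis V bs \<and> length bs = n)"

section \<open>Ext over an algebra\<close>

text \<open>
  A \<^verbatim>\<open>'k\<close>-algebra is a ring \<^verbatim>\<open>R\<close> together with its structure map \<^verbatim>\<open>\<iota>\<close> from \<^verbatim>\<open>'k\<close> to the centre of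
  \<^verbatim>\<open>R\<close>. The Hom space is the \<^verbatim>\<open>'k\<close>-vector space underlying \<^verbatim>\<open>lmod_hom R M N\<close>.
\<close>

definition hom_space ::
    "('k \<Rightarrow> 'r) \<Rightarrow> ('r, 'x) ring_scheme \<Rightarrow> ('r, 'm, 'y) module_scheme \<Rightarrow> ('r, 'n, 'z) module_scheme
      \<Rightarrow> ('k, 'm \<Rightarrow> 'n) module" where
  "hom_space \<iota> R M N =
    \<lparr>carrier = lmod_hom R M N, mult = undefined, one = undefined,
     zero = (\<lambda>x\<in>carrier M. \<zero>\<^bsub>N\<^esub>),
     add = (\<lambda>f g. \<lambda>x\<in>carrier M. f x \<oplus>\<^bsub>N\<^esub> g x),
     smult = (\<lambda>c f. \<lambda>x\<in>carrier M. \<iota> c \<odot>\<^bsub>N\<^esub> f x)\<rparr>"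

definition free_module :: "('r, 'x) ring_scheme \<Rightarrow> 'b set \<Rightarrow> ('r, 'b \<Rightarrow> 'r) module" where
  "free_module R B =
    \<lparr>carrier = {f. (\<forall>b. f b \<in> carrier R) \<and> finite {b. f b \<noteq> \<zero>\<^bsub>R\<^esub>} \<and> (\<forall>b. b \<notin> B \<longrightarrow> f b = \<zero>\<^bsub>R\<^esub>)},
     mult = undefined, one = undefined,
     zero = (\<lambda>b. \<zero>\<^bsub>R\<^esub>),
     add = (\<lambda>f g b. f b \<oplus>\<^bsub>R\<^esub> g b),
     smult = (\<lambda>a f b. a \<otimes>\<^bsub>R\<^esub> f b)\<rparr>"

text \<open>
  Ext is computed from the standard free resolution
  \<^verbatim>\<open>\<dots> \<longrightarrow> F 2 \<longrightarrow> F 1 \<longrightarrow> F 0 \<longrightarrow> M \<longrightarrow> 0\<close>,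
  where \<^verbatim>\<open>F 0\<close> is free on the set underlying \<^verbatim>\<open>M\<close> and \<^verbatim>\<open>F (n + 1)\<close> is free on the set underlying the
  kernel of the preceding map. For all \<^verbatim>\<open>F n\<close> to live in one type, the basis elements are taken from
  the following datatype: \<^verbatim>\<open>Elem m\<close> is the basis element belonging to \<^verbatim>\<open>m\<close> in \<^verbatim>\<open>M\<close>, and \<^verbatim>\<open>Syz S\<close> is the
  one belonging to the finitely supported function \<^verbatim>\<open>z\<close> whose graph, restricted to the support, is \<^verbatim>\<open>S\<close>.
\<close>

datatype ('m, 'r) gen = Elem 'm | Syz "(('m, 'r) gen \<times> 'r) fset"

definition syz_gen :: "('r, 'x) ring_scheme \<Rightarrow> (('m, 'r) gen \<Rightarrow> 'r) \<Rightarrow> ('m, 'r) gen" where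
  "syz_gen R z = Syz (Abs_fset {(b, z b) | b. z b \<noteq> \<zero>\<^bsub>R\<^esub>})"

primrec elem_val :: "('m, 'r) gen \<Rightarrow> 'm" where
  "elem_val (Elem m) = m"
| "elem_val (Syz S) = undefined"

text \<open>\<^verbatim>\<open>syz_val R\<close> is the inverse of \<^verbatim>\<open>syz_gen R\<close> on finitely supported functions.\<close>

fun syz_val :: "('r, 'x) ring_scheme \<Rightarrow> ('m, 'r) gen \<Rightarrow> ('m, 'r) gen \<Rightarrow> 'r" where
  "syz_val R (Elem m) = (\<lambda>b. \<zero>\<^bsub>R\<^esub>)"
| "syz_val R (Syz S) = (\<lambda>b. if \<exists>r. (b, r) |\<in>| S then THE r. (b, r) |\<in>| S else \<zero>\<^bsub>R\<^esub>)"

definition res_aug ::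
    "('r, 'x) ring_scheme \<Rightarrow> ('r, 'm, 'y) module_scheme \<Rightarrow> (('m, 'r) gen \<Rightarrow> 'r) \<Rightarrow> 'm" where
  "res_aug R M f = (\<Oplus>\<^bsub>M\<^esub>s\<in>{s. f s \<noteq> \<zero>\<^bsub>R\<^esub>}. f s \<odot>\<^bsub>M\<^esub> elem_val s)"

text \<open>The same formula describes the differential \<^verbatim>\<open>F (n + 1) \<longrightarrow> F n\<close> for every \<^verbatim>\<open>n\<close>.\<close>

definition res_diff ::
    "('r, 'x) ring_scheme \<Rightarrow> (('m, 'r) gen \<Rightarrow> 'r) \<Rightarrow> ('m, 'r) gen \<Rightarrow> 'r" where
  "res_diff R f = (\<lambda>b. \<Oplus>\<^bsub>R\<^esub>s\<in>{s. f s \<noteq> \<zero>\<^bsub>R\<^esub>}. f s \<otimes>\<^bsub>R\<^esub> syz_val R s b)"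

fun res_basis ::
    "('r, 'x) ring_scheme \<Rightarrow> ('r, 'm, 'y) module_scheme \<Rightarrow> nat \<Rightarrow> ('m, 'r) gen set" where
  "res_basis R M 0 = Elem ` carrier M"
| "res_basis R M (Suc 0) =
     syz_gen R ` {z \<in> carrier (free_module R (res_basis R M 0)). res_aug R M z = \<zero>\<^bsub>M\<^esub>}"
| "res_basis R M (Suc (Suc n)) =
     syz_gen R ` {z \<in> carrier (free_module R (res_basis R M (Suc n))). res_diff R z = (\<lambda>b. \<zero>\<^bsub>R\<^esub>)}"

definition res_module ::
    "('r, 'x) ring_scheme \<Rightarrow> ('r, 'm, 'y) module_scheme \<Rightarrow> nat \<Rightarrow> ('r, ('m, 'r) gen \<Rightarrow> 'r) module" where
  "res_module R M n = free_module R (res_basis R M n)"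

definition ext_cocycles ::
    "('r, 'x) ring_scheme \<Rightarrow> ('r, 'm, 'y) module_scheme \<Rightarrow> ('r, 'n, 'z) module_scheme \<Rightarrow> nat
      \<Rightarrow> ((('m, 'r) gen \<Rightarrow> 'r) \<Rightarrow> 'n) set" where
  "ext_cocycles R M N n = {f \<in> lmod_hom R (res_module R M n) N.
     \<forall>x\<in>carrier (res_module R M (Suc n)). f (res_diff R x) = \<zero>\<^bsub>N\<^esub>}"

fun ext_coboundaries ::
    "('r, 'x) ring_scheme \<Rightarrow> ('r, 'm, 'y) module_scheme \<Rightarrow> ('r, 'n, 'z) module_scheme \<Rightarrow> nat
      \<Rightarrow> ((('m, 'r) gen \<Rightarrow> 'r) \<Rightarrow> 'n) set" where
  "ext_coboundaries R M N 0 = {\<lambda>x\<in>carrier (res_module R M 0). \<zero>\<^bsub>N\<^esub>}"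
| "ext_coboundaries R M N (Suc n) =
     (\<lambda>g. \<lambda>x\<in>carrier (res_module R M (Suc n)). g (res_diff R x)) ` lmod_hom R (res_module R M n) N"

definition Ext ::
    "('k \<Rightarrow> 'r) \<Rightarrow> ('r, 'x) ring_scheme \<Rightarrow> nat \<Rightarrow> ('r, 'm, 'y) module_scheme \<Rightarrow> ('r, 'n, 'z) module_scheme
      \<Rightarrow> ('k, ((('m, 'r) gen \<Rightarrow> 'r) \<Rightarrow> 'n) set) module" where
  "Ext \<iota> R n M N =
     quot_module ((hom_space \<iota> R (res_module R M n) N)\<lparr>carrier := ext_cocycles R M N n\<rparr>)
       (ext_coboundaries R M N n)"

section \<open>Quadratic monomial algebras\<close>

text \<open>
  A quiver is a \<^verbatim>\<open>fin_digraph\<close> (loops and parallel arrows are allowed). A path is a pair of its source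
  and the list of its arrows in the order in which they are traversed; \<^verbatim>\<open>(v, [])\<close> is the trivial path.
\<close>

type_synonym ('v, 'a) qpath = "'v \<times> 'a list"

definition paths :: "('v, 'a) pre_digraph \<Rightarrow> ('v, 'a) qpath set" where
  "paths Q = {(u, p). \<exists>v. pre_digraph.awalk Q u p v}"

definition path_target :: "('v, 'a) pre_digraph \<Rightarrow> ('v, 'a) qpath \<Rightarrow> 'v" where
  "path_target Q p = pre_digraph.awlast Q (fst p) (snd p)"

abbreviation path_length :: "('v, 'a) qpath \<Rightarrow> nat" where
  "path_length p \<equiv> length (snd p)"

text \<open>
  Paths are composed from right to left: the product \<^verbatim>\<open>p q\<close> is \<^verbatim>\<open>q\<close> followed by \<^verbatim>\<open>p\<close>, and is zero
  unless \<^verbatim>\<open>q\<close> ends where \<^verbatim>\<open>p\<close> starts.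
\<close>

definition path_mult ::
    "('v, 'a) pre_digraph \<Rightarrow> (('v, 'a) qpath \<Rightarrow>\<^sub>0 'k::field) \<Rightarrow> (('v, 'a) qpath \<Rightarrow>\<^sub>0 'k) \<Rightarrow> (('v, 'a) qpath \<Rightarrow>\<^sub>0 'k)" where
  "path_mult Q x y = (\<Sum>p\<in>Poly_Mapping.keys x. \<Sum>q\<in>Poly_Mapping.keys y.
     if path_target Q q = fst p
     then Poly_Mapping.single (fst q, snd q @ snd p) (Poly_Mapping.lookup x p * Poly_Mapping.lookup y q)
     else 0)"

definition path_scalar :: "('v, 'a) pre_digraph \<Rightarrow> 'k::field \<Rightarrow> (('v, 'a) qpath \<Rightarrow>\<^sub>0 'k)" where
  "path_scalar Q c = (\<Sum>v\<in>verts Q. Poly_Mapping.single (v, []) c)"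

definition path_algebra :: "('v, 'a) pre_digraph \<Rightarrow> (('v, 'a) qpath \<Rightarrow>\<^sub>0 'k::field) ring" where
  "path_algebra Q =
    \<lparr>carrier = {x. Poly_Mapping.keys x \<subseteq> paths Q}, mult = path_mult Q, one = path_scalar Q 1,
     zero = 0, add = (+)\<rparr>"

definition quadratic_monomial_ideal ::
    "('v, 'a) pre_digraph \<Rightarrow> (('v, 'a) qpath \<Rightarrow>\<^sub>0 'k::field) set \<Rightarrow> bool" where
  "quadratic_monomial_ideal Q I \<longleftrightarrow> (\<exists>\<rho> \<subseteq> {p \<in> paths Q. path_length p = 2}.
     I = Idl\<^bsub>path_algebra Q\<^esub> ((\<lambda>p. Poly_Mapping.single p 1) ` \<rho>))"

type_synonym ('v, 'a, 'k) quot_elem = "(('v, 'a) qpath \<Rightarrow>\<^sub>0 'k) set"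

abbreviation quiver_algebra ::
    "('v, 'a) pre_digraph \<Rightarrow> (('v, 'a) qpath \<Rightarrow>\<^sub>0 'k::field) set \<Rightarrow> ('v, 'a, 'k) quot_elem ring" where
  "quiver_algebra Q I \<equiv> path_algebra Q Quot I"

definition scalar ::
    "('v, 'a) pre_digraph \<Rightarrow> (('v, 'a) qpath \<Rightarrow>\<^sub>0 'k::field) set \<Rightarrow> 'k \<Rightarrow> ('v, 'a, 'k) quot_elem" where
  "scalar Q I c = I +>\<^bsub>path_algebra Q\<^esub> path_scalar Q c"

definition idem ::
    "('v, 'a) pre_digraph \<Rightarrow> (('v, 'a) qpath \<Rightarrow>\<^sub>0 'k::field) set \<Rightarrow> 'v \<Rightarrow> ('v, 'a, 'k) quot_elem" where
  "idem Q I v = I +>\<^bsub>path_algebra Q\<^esub> Poly_Mapping.single (v, []) 1"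

text \<open>The grading by path length, indexed by all integers; it is zero in negative degrees.\<close>

definition alg_component ::
    "('v, 'a) pre_digraph \<Rightarrow> (('v, 'a) qpath \<Rightarrow>\<^sub>0 'k::field) set \<Rightarrow> int \<Rightarrow> ('v, 'a, 'k) quot_elem set" where
  "alg_component Q I i = (\<lambda>x. I +>\<^bsub>path_algebra Q\<^esub> x) `
     {x \<in> carrier (path_algebra Q). \<forall>p\<in>Poly_Mapping.keys x. int (path_length p) = i}"

definition alg_positive ::
    "('v, 'a) pre_digraph \<Rightarrow> (('v, 'a) qpath \<Rightarrow>\<^sub>0 'k::field) set \<Rightarrow> ('v, 'a, 'k) quot_elem set" where
  "alg_positive Q I = (\<lambda>x. I +>\<^bsub>path_algebra Q\<^esub> x) `
     {x \<in> carrier (path_algebra Q). \<forall>p\<in>Poly_Mapping.keys x. path_length p \<ge> 1}"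

definition regular_module :: "('r, 'x) ring_scheme \<Rightarrow> ('r, 'r) module" where
  "regular_module R =
    \<lparr>carrier = carrier R, mult = undefined, one = undefined,
     zero = \<zero>\<^bsub>R\<^esub>, add = add R, smult = monoid.mult R\<rparr>"

text \<open>The left module \<^verbatim>\<open>\<Lambda>\<^sub>0 = \<Lambda> / \<Lambda>\<^sub>\<ge>\<^sub>1\<close>.\<close>

definition top_module ::
    "('v, 'a) pre_digraph \<Rightarrow> (('v, 'a) qpath \<Rightarrow>\<^sub>0 'k::field) set
      \<Rightarrow> (('v, 'a, 'k) quot_elem, ('v, 'a, 'k) quot_elem set) module" where
  "top_module Q I = quot_module (regular_module (quiver_algebra Q I)) (alg_positive Q I)"

section \<open>Graded modules\<close>

record ('r, 'm) graded_module = "('r, 'm) module" +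
  component :: "int \<Rightarrow> 'm set"

definition underlying_space ::
    "('k \<Rightarrow> 'r) \<Rightarrow> ('r, 'm, 'y) module_scheme \<Rightarrow> 'm set \<Rightarrow> ('k, 'm) module" where
  "underlying_space \<iota> M S =
    \<lparr>carrier = S, mult = undefined, one = undefined,
     zero = \<zero>\<^bsub>M\<^esub>, add = add M, smult = (\<lambda>c x. \<iota> c \<odot>\<^bsub>M\<^esub> x)\<rparr>"

locale graded_left_module = left_module "quiver_algebra Q I" M
  for Q :: "('v, 'a) pre_digraph" and I :: "(('v, 'a) qpath \<Rightarrow>\<^sub>0 'k::field) set"
    and M :: "(('v, 'a, 'k) quot_elem, 'm) graded_module" +
  assumes component_subgroup: "additive_subgroup (component M n) M"
    and direct_sum: "x \<in> carrier M \<Longrightarrow>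
      \<exists>!f. (\<forall>n. f n \<in> component M n) \<and> finite {n. f n \<noteq> \<zero>\<^bsub>M\<^esub>} \<and>
        x = (\<Oplus>\<^bsub>M\<^esub>n\<in>{n. f n \<noteq> \<zero>\<^bsub>M\<^esub>}. f n)"
    and component_smult: "\<lbrakk>a \<in> alg_component Q I i; x \<in> component M n\<rbrakk> \<Longrightarrow>
      a \<odot>\<^bsub>M\<^esub> x \<in> component M (i + n)"
    and component_finite_dimensional:
      "finite_dimensional (underlying_space (scalar Q I) M (component M n))"

definition graded_hom ::
    "('r, 'x) ring_scheme \<Rightarrow> ('r, 'm) graded_module \<Rightarrow> ('r, 'n) graded_module \<Rightarrow> ('m \<Rightarrow> 'n) set" where
  "graded_hom R M N = {f \<in> lmod_hom R M N. \<forall>n. f ` component M n \<subseteq> component N n}"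

definition shift :: "int \<Rightarrow> ('r, 'm) graded_module \<Rightarrow> ('r, 'm) graded_module" where
  "shift i M = M\<lparr>component := (\<lambda>n. component M (n - i))\<rparr>"

text \<open>\<^verbatim>\<open>P\<^sub>x = \<Lambda> e\<^sub>x\<close>, whose degree \<^verbatim>\<open>n\<close> part is \<^verbatim>\<open>\<Lambda>\<^sub>n e\<^sub>x\<close>.\<close>

definition vertex_proj ::
    "('v, 'a) pre_digraph \<Rightarrow> (('v, 'a) qpath \<Rightarrow>\<^sub>0 'k::field) set \<Rightarrow> 'v
      \<Rightarrow> (('v, 'a, 'k) quot_elem, ('v, 'a, 'k) quot_elem) graded_module" where
  "vertex_proj Q I v =
    \<lparr>carrier = (\<lambda>a. a \<otimes>\<^bsub>quiver_algebra Q I\<^esub> idem Q I v) ` carrier (quiver_algebra Q I),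
     mult = undefined, one = undefined,
     zero = \<zero>\<^bsub>quiver_algebra Q I\<^esub>, add = add (quiver_algebra Q I),
     smult = monoid.mult (quiver_algebra Q I),
     component = (\<lambda>n. (\<lambda>a. a \<otimes>\<^bsub>quiver_algebra Q I\<^esub> idem Q I v) ` alg_component Q I n)\<rparr>"

definition graded_sum :: "('r, 'm) graded_module list \<Rightarrow> ('r, nat \<Rightarrow> 'm) graded_module" where
  "graded_sum Ms =
    \<lparr>carrier = (\<Pi>\<^sub>E j\<in>{..<length Ms}. carrier (Ms ! j)), mult = undefined, one = undefined,
     zero = (\<lambda>j\<in>{..<length Ms}. \<zero>\<^bsub>Ms ! j\<^esub>),
     add = (\<lambda>f g. \<lambda>j\<in>{..<length Ms}. f j \<oplus>\<^bsub>Ms ! j\<^esub> g j),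
     smult = (\<lambda>a f. \<lambda>j\<in>{..<length Ms}. a \<odot>\<^bsub>Ms ! j\<^esub> f j),
     component = (\<lambda>n. \<Pi>\<^sub>E j\<in>{..<length Ms}. component (Ms ! j) n)\<rparr>"

definition proj_sum ::
    "('v, 'a) pre_digraph \<Rightarrow> (('v, 'a) qpath \<Rightarrow>\<^sub>0 'k::field) set \<Rightarrow> ('v \<times> int) list
      \<Rightarrow> (('v, 'a, 'k) quot_elem, nat \<Rightarrow> ('v, 'a, 'k) quot_elem) graded_module" where
  "proj_sum Q I xs = graded_sum (map (\<lambda>(v, i). shift i (vertex_proj Q I v)) xs)"

definition finitely_presented ::
    "('v, 'a) pre_digraph \<Rightarrow> (('v, 'a) qpath \<Rightarrow>\<^sub>0 'k::field) set
      \<Rightarrow> (('v, 'a, 'k) quot_elem, 'm) graded_module \<Rightarrow> bool" where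
  "finitely_presented Q I M \<longleftrightarrow>
    (\<exists>xs ys. fst ` set xs \<subseteq> verts Q \<and> fst ` set ys \<subseteq> verts Q \<and>
      (\<exists>f \<in> graded_hom (quiver_algebra Q I) (proj_sum Q I xs) M.
       \<exists>g \<in> graded_hom (quiver_algebra Q I) (proj_sum Q I ys) (proj_sum Q I xs).
         f ` carrier (proj_sum Q I xs) = carrier M \<and>
         g ` carrier (proj_sum Q I ys) = {x \<in> carrier (proj_sum Q I xs). f x = \<zero>\<^bsub>M\<^esub>}))"

section \<open>Poincare series\<close>

definition poincare_series ::
    "('v, 'a) pre_digraph \<Rightarrow> (('v, 'a) qpath \<Rightarrow>\<^sub>0 'k::field) set
      \<Rightarrow> (('v, 'a, 'k) quot_elem, 'm) graded_module \<Rightarrow> rat fps" where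
  "poincare_series Q I M =
     Abs_fps (\<lambda>n. of_nat (dimension (Ext (scalar Q I) (quiver_algebra Q I) n M (top_module Q I))))"

definition rational_fps :: "'a::field fps \<Rightarrow> bool" where
  "rational_fps F \<longleftrightarrow> (\<exists>p q. q \<noteq> 0 \<and> fps_of_poly q * F = fps_of_poly p)"

end

theory Submission
  imports Defs "HOL-Library.Function_Algebras"
begin

text \<open>
  Let \<open>J = \<Lambda>\<^sub>\<ge>\<^sub>1\<close>, and for an arrow \<open>a\<close> let \<open>a\<^sup>\<bottom>\<close> be the set of arrows \<open>b\<close> that end where \<open>a\<close> starts and
  satisfy \<open>a b = 0\<close> in \<open>\<Lambda>\<close>. For a set \<open>B\<close> of arrows and a submodule \<open>W\<close> of a free module \<open>F\<close> write
  \<open>B W = \<Sum>\<^sub>b b W\<close> (\<^verbatim>\<open>arrow_span\<close>) and \<open>U\<^sub>B(W) = (W \<inter> B F) / B W\<close>. If \<open>B\<close> consists of all arrows, then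
  \<open>B W = J W\<close> and \<open>U\<^sub>B(W)\<close> is \<open>Tor\<^sub>1(\<Lambda>\<^sub>0, F / W)\<close>. The theorem holds because the dimensions of these
  spaces, along a free resolution, obey a linear recurrence whose coefficients are read off from \<open>\<rho>\<close>.

  Two properties of free modules are behind this (\<^verbatim>\<open>arrow_free\<close>): the sum \<open>J F = \<Sum>\<^sub>a a F\<close> is direct, and an
  element of \<open>e\<^sub>s\<^sub>(\<^sub>a\<^sub>)F\<close> that is killed by \<open>a\<close> lies in \<open>a\<^sup>\<bottom> F\<close>. Both are visible on the basis of \<open>\<Lambda>\<close> that
  consists of the paths without a factor in \<open>\<rho>\<close>, since left multiplication by \<open>a\<close> sends a basis path to
  zero or to a basis path, and which of the two happens depends only on the end and the last arrow of the
  path (\<^verbatim>\<open>monomial_ring_quiver_algebra\<close>).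

  Let \<open>p\<close> map \<open>F\<close> onto \<open>X\<close> with kernel \<open>K\<close>. Writing the elements of \<open>K \<inter> B F\<close> as \<open>\<Sum>\<^sub>b b f\<^sub>b\<close> and applying
  \<open>p\<close> to the \<open>f\<^sub>b\<close> identifies \<open>U\<^sub>B(K)\<close> with the relations \<open>\<Sum>\<^sub>b b x\<^sub>b = 0\<close> in \<open>X\<close> modulo those with
  \<open>x\<^sub>b \<in> b\<^sup>\<bottom> X\<close> for all \<open>b\<close> (\<^verbatim>\<open>syzygy_relations\<close>). If \<open>X\<close> is itself contained in a free module, then each
  term of such a relation vanishes separately, so that \<open>U\<^sub>B(K) = \<Oplus>\<^sub>b U\<^sub>C(X)\<close> with \<open>C = b\<^sup>\<bottom>\<close>
  (\<^verbatim>\<open>relations_in_arrow_free\<close>). Applied to consecutive syzygies, this gives the recurrence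
  \<open>u\<^sub>n\<^sub>+\<^sub>1(B) = \<Sum>\<^sub>b u\<^sub>n(b\<^sup>\<bottom>)\<close> for the dimensions.

  The initial values are finite: by \<^verbatim>\<open>syzygy_relations\<close> the space \<open>U\<^sub>B\<close> of the first syzygy depends only
  on \<open>M\<close>, so it can be computed from a presentation by a free module of finite rank whose kernel \<open>K\<close> is
  finitely generated. There directness of \<open>J F\<close> gives \<open>J K \<inter> B F = B K\<close> (\<^verbatim>\<open>arrow_span_inter\<close>), hence
  \<open>U\<^sub>B(K)\<close> embeds into the finite-dimensional space \<open>K / J K\<close>.

  It remains to pass to Ext. A homomorphism from \<open>X\<close> to \<open>\<Lambda>\<^sub>0\<close> is the same as a linear functional on \<open>X\<close> that
  vanishes on \<open>J X\<close> (\<^verbatim>\<open>hom_of\<close>), and functionals extend from subspaces. Therefore \<open>Ext\<^sup>n\<^sup>+\<^sup>1(M, \<Lambda>\<^sub>0)\<close> is the dual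
  of \<open>U\<^sub>B(W)\<close>, where \<open>W\<close> is the syzygy in the \<open>n\<close>-th term of the standard resolution and \<open>B\<close> is the set
  of all arrows (\<^verbatim>\<open>cohomology_dimension\<close>, \<^verbatim>\<open>coboundary_iff\<close>). A sequence with such a recurrence satisfies a
  scalar one, and its generating function is rational (\<^verbatim>\<open>rational_fps_of_transfer\<close>).
\<close>

section \<open>Quotients of vector spaces by coordinate maps\<close>

text \<open>
  Vector spaces are given by a carrier, so that syzygies, spaces of homomorphisms and quotients, which
  are sets inside one type, can all be treated alike.
\<close>

locale kspace = abelian_group V for V :: "('k::field, 'm, 'y) module_scheme" (structure) +
  assumes ksm_closed [simp, intro]: "x \<in> carrier V \<Longrightarrow> c \<odot> x \<in> carrier V"
    and ksm_r_distr: "\<lbrakk>x \<in> carrier V; y \<in> carrier V\<rbrakk> \<Longrightarrow> c \<odot> (x \<oplus> y) = c \<odot> x \<oplus> c \<odot> y"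
    and ksm_l_distr: "x \<in> carrier V \<Longrightarrow> (c + d) \<odot> x = c \<odot> x \<oplus> d \<odot> x"
    and ksm_assoc: "x \<in> carrier V \<Longrightarrow> (c * d) \<odot> x = c \<odot> (d \<odot> x)"
    and ksm_one [simp]: "x \<in> carrier V \<Longrightarrow> 1 \<odot> x = x"
begin

lemma ksm_zero [simp]: "x \<in> carrier V \<Longrightarrow> 0 \<odot> x = \<zero>"
proof -
  assume x: "x \<in> carrier V"
  have "0 \<odot> x \<oplus> 0 \<odot> x = 0 \<odot> x \<oplus> \<zero>"
    using ksm_l_distr[OF x, of 0 0] x by simp
  then show ?thesis using x by (metis add.l_cancel_one' r_zero ksm_closed)
qed

lemma ksm_minus: "x \<in> carrier V \<Longrightarrow> (-1) \<odot> x = \<ominus> x"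
proof -
  assume x: "x \<in> carrier V"
  have "x \<oplus> (-1) \<odot> x = \<zero>" using ksm_l_distr[OF x, of 1 "-1"] x by simp
  then show ?thesis using x by (metis add.inv_comm ksm_closed minus_equality)
qed

lemma ksm_zero_right [simp]: "c \<odot> \<zero> = \<zero>"
  using ksm_assoc[OF zero_closed, of c 0] by simp

lemma ksm_minus_zero: "x \<in> carrier V \<Longrightarrow> x \<ominus> \<zero> = x"
  using ksm_minus[OF zero_closed] by (simp add: a_minus_def)

end

definition ksub :: "('k::field, 'm, 'y) module_scheme \<Rightarrow> 'm set \<Rightarrow> bool" where
  "ksub V U \<longleftrightarrow> U \<subseteq> carrier V \<and> \<zero>\<^bsub>V\<^esub> \<in> U \<and> (\<forall>x\<in>U. \<forall>y\<in>U. x \<oplus>\<^bsub>V\<^esub> y \<in> U) \<and> (\<forall>c. \<forall>x\<in>U. c \<odot>\<^bsub>V\<^esub> x \<in> U)"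

lemma ksubD:
  assumes "ksub V U"
  shows "x \<in> U \<Longrightarrow> x \<in> carrier V" "\<zero>\<^bsub>V\<^esub> \<in> U" "x \<in> U \<Longrightarrow> y \<in> U \<Longrightarrow> x \<oplus>\<^bsub>V\<^esub> y \<in> U"
    "x \<in> U \<Longrightarrow> c \<odot>\<^bsub>V\<^esub> x \<in> U"
  using assms by (auto simp: ksub_def)

lemma (in kspace) minus_eq_zeroD:
  assumes "x \<in> carrier V" "y \<in> carrier V" "x \<ominus> y = \<zero>" shows "x = y"
  using assms by (metis a_minus_def add.inv_closed minus_equality minus_minus)

lemma (in kspace) ksub_carrier: "ksub V (carrier V)"
  by (auto simp: ksub_def)

lemma (in kspace) ksub_minus:
  assumes "ksub V U" "x \<in> U" "y \<in> U" shows "x \<ominus> y \<in> U"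
  using ksubD[OF assms(1)] assms(2,3) ksm_minus[of y] unfolding a_minus_def by metis

definition klinear :: "('k::field, 'm, 'y) module_scheme \<Rightarrow> 'm set \<Rightarrow> ('m \<Rightarrow> 'k) \<Rightarrow> bool" where
  "klinear V U \<phi> \<longleftrightarrow> (\<forall>x\<in>U. \<forall>y\<in>U. \<phi> (x \<oplus>\<^bsub>V\<^esub> y) = \<phi> x + \<phi> y) \<and> (\<forall>c. \<forall>x\<in>U. \<phi> (c \<odot>\<^bsub>V\<^esub> x) = c * \<phi> x)"

lemma klinearD:
  assumes "klinear V U \<phi>"
  shows "x \<in> U \<Longrightarrow> y \<in> U \<Longrightarrow> \<phi> (x \<oplus>\<^bsub>V\<^esub> y) = \<phi> x + \<phi> y" "x \<in> U \<Longrightarrow> \<phi> (c \<odot>\<^bsub>V\<^esub> x) = c * \<phi> x"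
  using assms by (auto simp: klinear_def)

lemma (in kspace) klinear_zero:
  assumes "klinear V U \<phi>" "ksub V U" shows "\<phi> \<zero> = 0"
  using klinearD(2)[OF assms(1), of \<zero> 0] ksubD[OF assms(2)] by simp

lemma (in kspace) klinear_minus:
  assumes "klinear V U \<phi>" "ksub V U" "x \<in> U" "y \<in> U" shows "\<phi> (x \<ominus> y) = \<phi> x - \<phi> y"
proof -
  have "\<phi> (x \<ominus> y) = \<phi> (x \<oplus> (-1) \<odot> y)" using assms ksubD by (metis a_minus_def ksm_minus)
  then show ?thesis using klinearD[OF assms(1)] ksubD[OF assms(2)] assms(3,4) by simp
qed

lemma (in kspace) klinear_finsum:
  assumes "klinear V U \<phi>" "ksub V U" "finite S" "\<And>i. i \<in> S \<Longrightarrow> f i \<in> U"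
  shows "(\<Oplus>i\<in>S. f i) \<in> U \<and> \<phi> (\<Oplus>i\<in>S. f i) = (\<Sum>i\<in>S. \<phi> (f i))"
  using assms(3,4)
proof (induction S rule: finite_induct)
  case empty
  then show ?case using klinear_zero[OF assms(1,2)] ksubD[OF assms(2)] by simp
next
  case (insert a S)
  have c: "f \<in> S \<rightarrow> carrier V" "f a \<in> carrier V"
    using insert ksubD(1)[OF assms(2)] by auto
  show ?case using insert c klinearD[OF assms(1)] ksubD[OF assms(2)]
    by (simp add: finsum_insert)
qed

text \<open>
  \<open>\<Phi>\<close> induces an isomorphism from \<open>U / W\<close> onto the space of functions on \<open>S\<close>. Working with such maps
  instead of bases makes dimension counts possible without linear combinations in \<open>V\<close>.
\<close>

definition coords :: "('k::field, 'm, 'y) module_scheme \<Rightarrow> 'm set \<Rightarrow> 'm set \<Rightarrow> 'i set \<Rightarrow> ('m \<Rightarrow> 'i \<Rightarrow> 'k) \<Rightarrow> bool" where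
  "coords V U W S \<Phi> \<longleftrightarrow> W \<subseteq> U \<and> (\<forall>i\<in>S. klinear V U (\<lambda>u. \<Phi> u i)) \<and>
     (\<forall>u\<in>U. u \<in> W \<longleftrightarrow> (\<forall>i\<in>S. \<Phi> u i = 0)) \<and> (\<forall>g. \<exists>u\<in>U. \<forall>i\<in>S. \<Phi> u i = g i)"

lemma coordsD:
  assumes "coords V U W S \<Phi>"
  shows "W \<subseteq> U" "i \<in> S \<Longrightarrow> klinear V U (\<lambda>u. \<Phi> u i)"
    "u \<in> U \<Longrightarrow> u \<in> W \<longleftrightarrow> (\<forall>i\<in>S. \<Phi> u i = 0)" "\<exists>u\<in>U. \<forall>i\<in>S. \<Phi> u i = g i"
  using assms by (auto simp: coords_def)

definition qdim :: "('k::field, 'm, 'y) module_scheme \<Rightarrow> 'm set \<Rightarrow> 'm set \<Rightarrow> nat \<Rightarrow> bool" where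
  "qdim V U W d \<longleftrightarrow> (\<exists>\<Phi>. coords V U W {..<d} \<Phi>)"

lemma coords_imp_qdim:
  assumes "coords V U W S \<Phi>" "finite S"
  shows "qdim V U W (card S)"
proof -
  obtain h where h: "bij_betw h {..<card S} S"
    using bij_betw_from_nat_into_finite[OF assms(2)] by blast
  have hS: "h i \<in> S" if "i < card S" for i using h that by (auto simp: bij_betw_def)
  have ex: "\<exists>i<card S. h i = s" if "s \<in> S" for s using h that unfolding bij_betw_def by force
  have "coords V U W {..<card S} (\<lambda>u i. \<Phi> u (h i))"
    unfolding coords_def
  proof (intro conjI ballI allI)
    show "W \<subseteq> U" using assms(1) by (rule coordsD)
    show "klinear V U (\<lambda>u. \<Phi> u (h i))" if "i \<in> {..<card S}" for i
      using coordsD(2)[OF assms(1)] hS that by simp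
    show "u \<in> W \<longleftrightarrow> (\<forall>i\<in>{..<card S}. \<Phi> u (h i) = 0)" if "u \<in> U" for u
      using coordsD(3)[OF assms(1) that] hS ex by (metis lessThan_iff)
    fix g :: "nat \<Rightarrow> 'b"
    obtain u where "u \<in> U" "\<forall>i\<in>S. \<Phi> u i = g (the_inv_into {..<card S} h i)"
      using coordsD(4)[OF assms(1), of "\<lambda>s. g (the_inv_into {..<card S} h s)"] by blast
    then show "\<exists>u\<in>U. \<forall>i\<in>{..<card S}. \<Phi> u (h i) = g i"
      using hS h by (intro bexI[of _ u]) (auto simp: bij_betw_def the_inv_into_f_f)
  qed
  then show ?thesis unfolding qdim_def by blast
qed

text \<open>
  An isomorphism \<open>U / W \<rightarrow> U' / W'\<close> may be given by any linear correspondence \<open>R\<close> that is total on both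
  sides and respects \<open>W\<close> and \<open>W'\<close>: two elements related to the same one differ by an element related
  to zero. The isomorphisms needed below involve choices of preimages, and stating them as correspondences
  replaces the verification that they are well defined.
\<close>

lemma qdim_transfer:
  fixes V :: "('k::field, 'm, 'y) module_scheme" and V' :: "('k, 'n, 'z) module_scheme"
  assumes "kspace V" "kspace V'" and U: "ksub V U" and U': "ksub V' U'"
    and left: "\<And>u. u \<in> U \<Longrightarrow> \<exists>u'\<in>U'. R u u'"
    and right: "\<And>u'. u' \<in> U' \<Longrightarrow> \<exists>u\<in>U. R u u'"
    and add: "\<And>u u' v v'. \<lbrakk>u \<in> U; u' \<in> U'; v \<in> U; v' \<in> U'; R u u'; R v v'\<rbrakk> \<Longrightarrow> R (u \<oplus>\<^bsub>V\<^esub> v) (u' \<oplus>\<^bsub>V'\<^esub> v')"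
    and smult: "\<And>c u u'. \<lbrakk>u \<in> U; u' \<in> U'; R u u'\<rbrakk> \<Longrightarrow> R (c \<odot>\<^bsub>V\<^esub> u) (c \<odot>\<^bsub>V'\<^esub> u')"
    and iff: "\<And>u u'. \<lbrakk>u \<in> U; u' \<in> U'; R u u'\<rbrakk> \<Longrightarrow> u \<in> W \<longleftrightarrow> u' \<in> W'"
    and W': "W' \<subseteq> U'" and d: "qdim V U W d"
  shows "qdim V' U' W' d"
proof -
  interpret V: kspace V by fact
  interpret V': kspace V' by fact
  note uD = ksubD[OF U] and u'D = ksubD[OF U']
  obtain \<Phi> where \<Phi>: "coords V U W {..<d} \<Phi>" using d by (auto simp: qdim_def)
  note lin = klinearD[OF coordsD(2)[OF \<Phi>]]
  have W0: "\<zero>\<^bsub>V\<^esub> \<in> W"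
    using coordsD(3)[OF \<Phi> uD(2)] V.klinear_zero[OF coordsD(2)[OF \<Phi>] U] by blast
  obtain z where z: "z \<in> U'" "R \<zero>\<^bsub>V\<^esub> z" using left[OF uD(2)] by blast
  have "R (0 \<odot>\<^bsub>V\<^esub> \<zero>\<^bsub>V\<^esub>) (0 \<odot>\<^bsub>V'\<^esub> z)" using smult z uD by blast
  then have R0: "R \<zero>\<^bsub>V\<^esub> \<zero>\<^bsub>V'\<^esub>" using z u'D by simp
  have W'0: "\<zero>\<^bsub>V'\<^esub> \<in> W'" using iff[OF uD(2) u'D(2) R0] W0 by blast
  (* Any related element gives the same coordinates; this is the well-definedness shown next. *)
  define \<Psi> where "\<Psi> u' = \<Phi> (SOME u. u \<in> U \<and> R u u')" for u'
  have \<Psi>: "\<Psi> u' i = \<Phi> u i" if "u \<in> U" "u' \<in> U'" "R u u'" "i < d" for u u' i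
  proof -
    let ?v = "SOME u. u \<in> U \<and> R u u'"
    have v: "?v \<in> U" "R ?v u'" using someI[of "\<lambda>u. u \<in> U \<and> R u u'" u] that by auto
    have m: "(-1) \<odot>\<^bsub>V\<^esub> u \<in> U" "(-1) \<odot>\<^bsub>V'\<^esub> u' \<in> U'" using that uD u'D by auto
    have "R (?v \<oplus>\<^bsub>V\<^esub> (-1) \<odot>\<^bsub>V\<^esub> u) (u' \<oplus>\<^bsub>V'\<^esub> (-1) \<odot>\<^bsub>V'\<^esub> u')"
      using add[OF v(1) that(2) m v(2)] smult[OF that(1-3)] by blast
    moreover have "u' \<oplus>\<^bsub>V'\<^esub> (-1) \<odot>\<^bsub>V'\<^esub> u' = \<zero>\<^bsub>V'\<^esub>"
      using V'.ksm_minus[of u'] u'D that by (simp add: V'.r_neg)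
    ultimately have "?v \<oplus>\<^bsub>V\<^esub> (-1) \<odot>\<^bsub>V\<^esub> u \<in> W"
      using iff W'0 u'D(2) uD(3)[OF v(1) m(1)] by metis
    then have "\<Phi> (?v \<oplus>\<^bsub>V\<^esub> (-1) \<odot>\<^bsub>V\<^esub> u) i = 0"
      using coordsD(1,3)[OF \<Phi>] that(4) by blast
    then show ?thesis using lin[of i] v m that by (simp add: \<Psi>_def)
  qed
  have "coords V' U' W' {..<d} \<Psi>"
    unfolding coords_def klinear_def
  proof (intro conjI ballI allI)
    fix i assume i: "i \<in> {..<d}"
    fix x' y' c assume x': "x' \<in> U'" 
    then obtain x where x: "x \<in> U" "R x x'" using right by blast
    show "\<Psi> (c \<odot>\<^bsub>V'\<^esub> x') i = c * \<Psi> x' i"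
      using \<Psi>[of "c \<odot>\<^bsub>V\<^esub> x" "c \<odot>\<^bsub>V'\<^esub> x'" i] \<Psi>[of x x' i] lin(2)[of i x c] smult x x' i uD u'D by auto
    assume y': "y' \<in> U'"
    then obtain y where y: "y \<in> U" "R y y'" using right by blast
    show "\<Psi> (x' \<oplus>\<^bsub>V'\<^esub> y') i = \<Psi> x' i + \<Psi> y' i"
      using \<Psi>[of "x \<oplus>\<^bsub>V\<^esub> y" "x' \<oplus>\<^bsub>V'\<^esub> y'" i] \<Psi>[of x x' i] \<Psi>[of y y' i] lin(1)[of i x y] add[OF x(1) x' y(1) y' x(2) y(2)] x x' y y' i uD u'D by auto
  next
    fix u' assume u': "u' \<in> U'"
    then obtain u where u: "u \<in> U" "R u u'" using right by blast
    show "u' \<in> W' \<longleftrightarrow> (\<forall>i\<in>{..<d}. \<Psi> u' i = 0)"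
      using iff[OF u(1) u' u(2)] coordsD(3)[OF \<Phi> u(1)] \<Psi>[OF u(1) u' u(2)] by auto
  next
    fix g
    obtain u where u: "u \<in> U" "\<forall>i\<in>{..<d}. \<Phi> u i = g i" using coordsD(4)[OF \<Phi>] by blast
    then obtain u' where "u' \<in> U'" "R u u'" using left by blast
    then show "\<exists>u\<in>U'. \<forall>i\<in>{..<d}. \<Psi> u i = g i" using \<Psi> u by (intro bexI[of _ u']) auto
  qed (use W' in auto)
  then show ?thesis unfolding qdim_def by blast
qed

lemma qdim_transfer_iff:
  fixes V :: "('k::field, 'm, 'y) module_scheme" and V' :: "('k, 'n, 'z) module_scheme"
  assumes V: "kspace V" "kspace V'" and U: "ksub V U" and U': "ksub V' U'"
    and left: "\<And>u. u \<in> U \<Longrightarrow> \<exists>u'\<in>U'. R u u'"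
    and right: "\<And>u'. u' \<in> U' \<Longrightarrow> \<exists>u\<in>U. R u u'"
    and add: "\<And>u u' v v'. \<lbrakk>u \<in> U; u' \<in> U'; v \<in> U; v' \<in> U'; R u u'; R v v'\<rbrakk> \<Longrightarrow> R (u \<oplus>\<^bsub>V\<^esub> v) (u' \<oplus>\<^bsub>V'\<^esub> v')"
    and smult: "\<And>c u u'. \<lbrakk>u \<in> U; u' \<in> U'; R u u'\<rbrakk> \<Longrightarrow> R (c \<odot>\<^bsub>V\<^esub> u) (c \<odot>\<^bsub>V'\<^esub> u')"
    and iff: "\<And>u u'. \<lbrakk>u \<in> U; u' \<in> U'; R u u'\<rbrakk> \<Longrightarrow> u \<in> W \<longleftrightarrow> u' \<in> W'"
    and W: "W \<subseteq> U" "W' \<subseteq> U'"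
  shows "qdim V U W d \<longleftrightarrow> qdim V' U' W' d"
proof
  assume "qdim V U W d"
  then show "qdim V' U' W' d"
    using qdim_transfer[OF V U U' left right add smult iff W(2)] by blast
next
  assume d: "qdim V' U' W' d"
  show "qdim V U W d"
    by (rule qdim_transfer[OF V(2,1) U' U, where R = "\<lambda>u' u. R u u'", OF right left add smult _ W(1) d])
      (use iff in auto)
qed

subsection \<open>Coordinate spaces\<close>

abbreviation (input) fscale :: "'k::field \<Rightarrow> ('i \<Rightarrow> 'k) \<Rightarrow> 'i \<Rightarrow> 'k" where
  "fscale c f \<equiv> (\<lambda>i. c * f i)"

definition coord_space :: "('k::field, 'i \<Rightarrow> 'k) module" where
  "coord_space = \<lparr>carrier = UNIV, mult = undefined, one = undefined, zero = 0, add = (+), smult = fscale\<rparr>"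

lemma coord_space_simps [simp]:
  "carrier coord_space = UNIV" "zero coord_space = 0" "add coord_space = (+)" "smult coord_space = fscale"
  by (auto simp: coord_space_def)

lemma kspace_coord_space: "kspace (coord_space :: ('k::field, 'i \<Rightarrow> 'k) module)"
  by unfold_locales (auto simp: Units_def algebra_simps fun_eq_iff intro: exI[of _ "- _"])

lemma vector_space_fscale: "vector_space (fscale :: 'k::field \<Rightarrow> ('i \<Rightarrow> 'k) \<Rightarrow> _)"
  by unfold_locales (auto simp: algebra_simps)

definition unit_vector :: "'i \<Rightarrow> 'i \<Rightarrow> 'k::field" where
  "unit_vector i = (\<lambda>j. if j = i then 1 else 0)"

lemma sum_function_apply: "(\<Sum>i\<in>S. f i) j = (\<Sum>i\<in>S. f i j)" for f :: "'a \<Rightarrow> 'b \<Rightarrow> 'c::comm_monoid_add"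
  by (induction S rule: infinite_finite_induct) auto

lemma supported_in_span:
  fixes g :: "'i \<Rightarrow> 'k::field"
  assumes "finite S" "\<And>i. i \<notin> S \<Longrightarrow> g i = 0"
  shows "g \<in> module.span fscale (unit_vector ` S)"
proof -
  interpret vector_space "fscale :: 'k \<Rightarrow> ('i \<Rightarrow> 'k) \<Rightarrow> _" by (rule vector_space_fscale)
  have "g j = (\<Sum>i\<in>S. g i * unit_vector i j)" for j
  proof -
    have "(\<Sum>i\<in>S. g i * unit_vector i j) = (\<Sum>i\<in>S. if j = i then g i else 0)"
      by (rule sum.cong[OF refl]) (simp add: unit_vector_def)
    then show ?thesis using assms(1) assms(2)[of j] by (cases "j \<in> S") simp_all
  qed
  then have "g = (\<Sum>i\<in>S. fscale (g i) (unit_vector i))"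
    unfolding fun_eq_iff sum_function_apply by blast
  also have "\<dots> \<in> span (unit_vector ` S)"
    by (intro span_sum span_scale span_base) auto
  finally show ?thesis .
qed

text \<open>
  Coordinates on \<open>G / G0\<close> are the coefficients at those vectors of a basis of \<open>G\<close> that do not belong to
  the basis of \<open>G0\<close> from which it was extended.
\<close>

lemma qdim_coord_subquotient:
  fixes G G0 :: "(nat \<Rightarrow> 'k::field) set"
  assumes "ksub coord_space G" "ksub coord_space G0" "G0 \<subseteq> G" "\<And>g i. g \<in> G \<Longrightarrow> i \<ge> d \<Longrightarrow> g i = 0"
  shows "\<exists>n. qdim coord_space G G0 n"
proof -
  interpret vector_space "fscale :: 'k \<Rightarrow> (nat \<Rightarrow> 'k) \<Rightarrow> _" by (rule vector_space_fscale)
  have sG: "subspace G" and sG0: "subspace G0"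
    using assms(1,2) by (auto simp: ksub_def subspace_def plus_fun_def zero_fun_def)
  obtain B0 where B0: "B0 \<subseteq> G0" "independent B0" "G0 \<subseteq> span B0"
    using maximal_independent_subset[of G0] by blast
  obtain B where B: "B0 \<subseteq> B" "B \<subseteq> G" "independent B" "G \<subseteq> span B"
    using maximal_independent_subset_extend[of B0 G] B0 assms(3) by blast
  have eqG: "span B = G" and eqG0: "span B0 = G0"
    using B B0 sG sG0 span_minimal by blast+
  have "B \<subseteq> span (unit_vector ` {..<d})"
    by (intro subsetI supported_in_span) (auto dest!: subsetD[OF B(2)] simp: not_less intro: assms(4))
  then have fB: "finite B" using independent_span_bound B(3) by blast
  have "coords coord_space G G0 (B - B0) (representation B)"
    unfolding coords_def klinear_def
  proof (intro conjI ballI allI)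
    show "representation B (x \<oplus>\<^bsub>coord_space\<^esub> y) i = representation B x i + representation B y i"
      if "x \<in> G" "y \<in> G" for x y i
      using representation_add[OF B(3) subsetD[OF B(4) that(2)] subsetD[OF B(4) that(1)]] by simp
    show "representation B (c \<odot>\<^bsub>coord_space\<^esub> x) i = c * representation B x i" if "x \<in> G" for c x i
      using representation_scale[OF B(3), of x c] that B(4) by auto
    show "u \<in> G0 \<longleftrightarrow> (\<forall>i\<in>B - B0. representation B u i = 0)" if u: "u \<in> G" for u
    proof
      assume "u \<in> G0"
      then show "\<forall>i\<in>B - B0. representation B u i = 0"
        using representation_extend[OF B(3) _ B(1), of u] B0(3) representation_ne_zero by force
    next
      assume a: "\<forall>i\<in>B - B0. representation B u i = 0"
      have "u = (\<Sum>b\<in>B. fscale (representation B u b) b)"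
        using sum_representation_eq[OF B(3) _ fB subset_refl, of u] u B(4) by auto
      also have "\<dots> = (\<Sum>b\<in>B0. fscale (representation B u b) b)"
        using a B(1) fB by (intro sum.mono_neutral_right) (auto simp: fun_eq_iff)
      also have "\<dots> \<in> span B0" by (intro span_sum span_scale span_base)
      finally show "u \<in> G0" using eqG0 by simp
    qed
    show "\<exists>u\<in>G. \<forall>i\<in>B - B0. representation B u i = g i" for g
    proof -
      let ?u = "\<Sum>b\<in>B. fscale (g b) b"
      have m: "fscale (g b) b \<in> span B" if "b \<in> B" for b using that by (simp add: span_base span_scale)
      have "representation B ?u i = (\<Sum>b\<in>B. representation B (fscale (g b) b) i)" for i
        using m by (subst representation_sum[OF B(3)]) auto
      also have "\<dots> i = (\<Sum>b\<in>B. g b * (if i = b then 1 else 0))" for i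
        using B(3) by (intro sum.cong) (auto simp: representation_scale span_base representation_basis)
      finally have "representation B ?u i = g i" if "i \<in> B" for i
        using that fB by (simp add: if_distrib sum.delta' cong: if_cong)
      moreover have "?u \<in> G" unfolding eqG[symmetric] using m by (intro span_sum) auto
      ultimately show ?thesis by auto
    qed
  qed (use assms in auto)
  then show ?thesis using coords_imp_qdim fB by blast
qed

text \<open>
  A subquotient of a finite-dimensional quotient is finite-dimensional; taking coordinates reduces this
  to subspaces of a coordinate space.
\<close>

lemma qdim_subquotient:
  fixes V :: "('k::field, 'm, 'y) module_scheme"
  assumes "kspace V" "ksub V U" "qdim V U W d" "ksub V U1" "ksub V W1" "U1 \<subseteq> U" "W1 \<subseteq> U1" "U1 \<inter> W \<subseteq> W1"
  shows "\<exists>n. qdim V U1 W1 n"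
proof -
  interpret V: kspace V by fact
  obtain \<Phi> where \<Phi>: "coords V U W {..<d} \<Phi>" using assms(3) by (auto simp: qdim_def)
  note lin = klinearD[OF coordsD(2)[OF \<Phi>]]
  define c where "c u = (\<lambda>i. if i < d then \<Phi> u i else 0)" for u
  have c_add: "c (u \<oplus>\<^bsub>V\<^esub> v) = c u + c v" if "u \<in> U" "v \<in> U" for u v
    using lin that by (auto simp: c_def fun_eq_iff)
  have c_smult: "c (a \<odot>\<^bsub>V\<^esub> u) = fscale a (c u)" if "u \<in> U" for u a
    using lin that by (auto simp: c_def fun_eq_iff)
  have c0: "c \<zero>\<^bsub>V\<^esub> = 0"
    using V.klinear_zero[OF coordsD(2)[OF \<Phi>] assms(2)] by (auto simp: c_def fun_eq_iff)
  have img: "ksub coord_space (c ` X)" if "ksub V X" "X \<subseteq> U" for X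
    unfolding ksub_def
  proof (intro conjI ballI allI)
    show "\<zero>\<^bsub>coord_space\<^esub> \<in> c ` X" using c0 ksubD(2)[OF that(1)] by (metis coord_space_simps(2) image_eqI)
    fix x assume "x \<in> c ` X"
    then obtain u where u: "u \<in> X" "x = c u" by auto
    show "a \<odot>\<^bsub>coord_space\<^esub> x \<in> c ` X" for a
      using u c_smult[of u a] ksubD(4)[OF that(1), of u a] that(2) by (auto intro!: image_eqI[of _ c "a \<odot>\<^bsub>V\<^esub> u"])
    fix y assume "y \<in> c ` X"
    then obtain v where v: "v \<in> X" "y = c v" by auto
    show "x \<oplus>\<^bsub>coord_space\<^esub> y \<in> c ` X"
      using u v c_add[of u v, symmetric] ksubD(3)[OF that(1), of u v] that(2) by auto
  qed auto
  obtain n where n: "qdim coord_space (c ` U1) (c ` W1) n"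
  proof -
    have "\<exists>n. qdim coord_space (c ` U1) (c ` W1) n"
    proof (rule qdim_coord_subquotient[of _ _ d])
      show "ksub coord_space (c ` U1)" "ksub coord_space (c ` W1)" using img assms(4-7) by auto
      show "c ` W1 \<subseteq> c ` U1" using assms(7) by auto
    qed (auto simp: c_def)
    then show ?thesis using that by blast
  qed
  have "qdim V U1 W1 n"
  proof (rule qdim_transfer[OF kspace_coord_space assms(1) img[OF assms(4,6)] assms(4), where R = "\<lambda>g u. g = c u"])
    fix g u assume g: "u \<in> U1" "g = c u"
    show "g \<in> c ` W1 \<longleftrightarrow> u \<in> W1"
    proof
      assume "g \<in> c ` W1"
      then obtain w where w: "w \<in> W1" "c u = c w" using g by auto
      have wu: "w \<in> U1" using w assms(7) by auto
      then have d: "u \<ominus>\<^bsub>V\<^esub> w \<in> U1" using V.ksub_minus[OF assms(4)] g by auto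
      have "\<Phi> u i = \<Phi> w i" if "i < d" for i using w(2) that by (metis c_def)
      then have "\<forall>i\<in>{..<d}. \<Phi> (u \<ominus>\<^bsub>V\<^esub> w) i = 0"
        using V.klinear_minus[OF coordsD(2)[OF \<Phi>] assms(2), of _ u w] g(1) wu assms(6) by auto
      then have "u \<ominus>\<^bsub>V\<^esub> w \<in> W" using coordsD(3)[OF \<Phi>] d assms(6) by blast
      then have "u \<ominus>\<^bsub>V\<^esub> w \<in> W1" using d assms(8) by blast
      then have "(u \<ominus>\<^bsub>V\<^esub> w) \<oplus>\<^bsub>V\<^esub> w \<in> W1" using w ksubD[OF assms(5)] by blast
      moreover have "(u \<ominus>\<^bsub>V\<^esub> w) \<oplus>\<^bsub>V\<^esub> w = u"
        using ksubD(1)[OF assms(4)] g wu by (simp add: V.minus_eq V.a_assoc V.l_neg)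
      ultimately show "u \<in> W1" by simp
    qed (use g in auto)
  qed (use n c_add[OF subsetD[OF assms(6)] subsetD[OF assms(6)]] c_smult[OF subsetD[OF assms(6)]] assms(7) in auto)
  then show ?thesis by blast
qed

text \<open>
  Two coordinate maps compose to an injective linear map between coordinate spaces, to which the exchange
  argument of the library applies.
\<close>

lemma qdim_le:
  fixes V :: "('k::field, 'm, 'y) module_scheme"
  assumes "kspace V" "ksub V U" "qdim V U W n" "qdim V U W m"
  shows "n \<le> m"
proof -
  interpret V: kspace V by fact
  interpret vector_space "fscale :: 'k \<Rightarrow> (nat \<Rightarrow> 'k) \<Rightarrow> _" by (rule vector_space_fscale)
  interpret P: vector_space_pair "fscale :: 'k \<Rightarrow> (nat \<Rightarrow> 'k) \<Rightarrow> _" "fscale :: 'k \<Rightarrow> (nat \<Rightarrow> 'k) \<Rightarrow> _"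
    by unfold_locales
  obtain \<Phi> \<Psi> where \<Phi>: "coords V U W {..<n} \<Phi>" and \<Psi>: "coords V U W {..<m} \<Psi>"
    using assms by (auto simp: qdim_def)
  note lin\<Phi> = klinearD[OF coordsD(2)[OF \<Phi>]] and lin\<Psi> = klinearD[OF coordsD(2)[OF \<Psi>]]
  (* The change of coordinates from \<Phi> to \<Psi>. *)
  define f :: "(nat \<Rightarrow> 'k) \<Rightarrow> (nat \<Rightarrow> 'k)" where
    "f g = (\<lambda>j. if j < m then \<Psi> (SOME u. u \<in> U \<and> (\<forall>i<n. \<Phi> u i = g i)) j else 0)" for g
  have f: "f g = (\<lambda>j. if j < m then \<Psi> u j else 0)" if u: "u \<in> U" "\<forall>i<n. \<Phi> u i = g i" for g u
  proof -
    let ?v = "SOME u. u \<in> U \<and> (\<forall>i<n. \<Phi> u i = g i)"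
    have v: "?v \<in> U" "\<forall>i<n. \<Phi> ?v i = g i" using someI[of "\<lambda>u. u \<in> U \<and> (\<forall>i<n. \<Phi> u i = g i)" u] u by auto
    have "?v \<ominus>\<^bsub>V\<^esub> u \<in> W"
      using coordsD(3)[OF \<Phi> V.ksub_minus[OF assms(2) v(1) u(1)]]
        V.klinear_minus[OF coordsD(2)[OF \<Phi>] assms(2) v(1) u(1)] v u by auto
    then have "\<forall>j<m. \<Psi> ?v j = \<Psi> u j"
      using coordsD(3)[OF \<Psi> V.ksub_minus[OF assms(2) v(1) u(1)]]
        V.klinear_minus[OF coordsD(2)[OF \<Psi>] assms(2) v(1) u(1)] by auto
    then show ?thesis by (auto simp: f_def fun_eq_iff)
  qed
  have ex: "\<exists>u\<in>U. \<forall>i<n. \<Phi> u i = g i" for g using coordsD(4)[OF \<Phi>, of g] by auto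
  have "Vector_Spaces.linear fscale fscale f"
  proof unfold_locales
    fix g h :: "nat \<Rightarrow> 'k" and c
    obtain u v where u: "u \<in> U" "\<forall>i<n. \<Phi> u i = g i" and v: "v \<in> U" "\<forall>i<n. \<Phi> v i = h i" using ex by metis
    show "f (g + h) = f g + f h"
      using f[of "u \<oplus>\<^bsub>V\<^esub> v" "g + h"] f[OF u] f[OF v] u v lin\<Phi>(1) lin\<Psi>(1) ksubD[OF assms(2)]
      by (auto simp: fun_eq_iff)
    show "f (fscale c g) = fscale c (f g)"
      using f[of "c \<odot>\<^bsub>V\<^esub> u" "fscale c g"] f[OF u] u lin\<Phi>(2) lin\<Psi>(2) ksubD[OF assms(2)]
      by (auto simp: fun_eq_iff)
  qed
  then interpret f: Vector_Spaces.linear fscale fscale f .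
  have supp: "g i = 0" if "g \<in> span (unit_vector ` {..<n})" "i \<ge> n" for g i
  proof -
    have "subspace {g :: nat \<Rightarrow> 'k. \<forall>i\<ge>n. g i = 0}" by (auto simp: subspace_def)
    then have "span (unit_vector ` {..<n}) \<subseteq> {g :: nat \<Rightarrow> 'k. \<forall>i\<ge>n. g i = 0}"
      by (intro span_minimal) (auto simp: unit_vector_def)
    then show ?thesis using that by auto
  qed
  have inj: "inj_on f (span (unit_vector ` {..<n}))"
  proof (subst f.inj_on_iff_eq_0[OF subspace_span], intro ballI impI)
    fix g assume g: "g \<in> span (unit_vector ` {..<n})" "f g = 0"
    obtain u where u: "u \<in> U" "\<forall>i<n. \<Phi> u i = g i" using ex by metis
    have "\<forall>j<m. \<Psi> u j = 0" using f[OF u] g(2) by (metis zero_fun_apply)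
    then have "u \<in> W" using coordsD(3)[OF \<Psi> u(1)] by auto
    then have "\<forall>i<n. g i = 0" using coordsD(3)[OF \<Phi> u(1)] u(2) by auto
    then show "g = 0" using supp[OF g(1)] by (auto simp: fun_eq_iff) (metis not_less)
  qed
  have inju: "inj (unit_vector :: nat \<Rightarrow> nat \<Rightarrow> 'k)"
    by (intro injI) (metis unit_vector_def zero_neq_one)
  have "independent (unit_vector ` {..<n} :: (nat \<Rightarrow> 'k) set)"
  proof (subst independent_alt, intro allI impI ballI)
    fix X :: "(nat \<Rightarrow> 'k) \<Rightarrow> 'k" and x
    assume "finite {x. X x \<noteq> 0}" "{x. X x \<noteq> 0} \<subseteq> unit_vector ` {..<n}"
      and s: "(\<Sum>x | X x \<noteq> 0. fscale (X x) x) = 0"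
    have "(\<Sum>x | X x \<noteq> 0. fscale (X x) x) = (\<Sum>x\<in>unit_vector ` {..<n}. fscale (X x) x)"
      using \<open>{x. X x \<noteq> 0} \<subseteq> unit_vector ` {..<n}\<close> by (intro sum.mono_neutral_left) (auto simp: fun_eq_iff)
    also have "\<dots> = (\<Sum>i<n. fscale (X (unit_vector i)) (unit_vector i))"
      by (subst sum.reindex) (auto intro: inj_on_subset[OF inju])
    finally have z: "(\<Sum>i<n. X (unit_vector i) * unit_vector i j) = 0" for j
      using s by (simp add: fun_eq_iff sum_function_apply)
    then have "X (unit_vector j) = 0" if "j < n" for j
    proof -
      have "(\<Sum>i<n. X (unit_vector i) * unit_vector i j) = (\<Sum>i<n. if j = i then X (unit_vector i) else 0)"
        by (intro sum.cong) (auto simp: unit_vector_def)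
      then show ?thesis using that z[of j] by simp
    qed
    then show "X x = 0" using \<open>{x. X x \<noteq> 0} \<subseteq> unit_vector ` {..<n}\<close> by blast
  qed
  then have ind: "independent (f ` unit_vector ` {..<n})"
    by (rule f.independent_injective_image[OF _ inj])
  have "f g \<in> span (unit_vector ` {..<m})" for g
    by (rule supported_in_span) (auto simp: f_def)
  then have "card (f ` unit_vector ` {..<n}) \<le> card (unit_vector ` {..<m} :: (nat \<Rightarrow> 'k) set)"
    using independent_span_bound[OF _ ind, of "unit_vector ` {..<m}"] by auto
  also have "card (f ` unit_vector ` {..<n}) = n"
    using card_image[OF inj_on_subset[OF inj span_superset]] card_image[OF inj_on_subset[OF inju]] by simp
  also have "card (unit_vector ` {..<m} :: (nat \<Rightarrow> 'k) set) = m"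
    using card_image[OF inj_on_subset[OF inju]] by simp
  finally show ?thesis .
qed

subsection \<open>Bases and extension of functionals\<close>

lemma (in kspace) coords_expansion:
  assumes U: "ksub V U" and \<Phi>: "coords V U W {..<d::nat} \<Phi>"
    and b: "\<And>i. i < d \<Longrightarrow> b i \<in> U" "\<And>i j. i < d \<Longrightarrow> j < d \<Longrightarrow> \<Phi> (b i) j = (if j = i then 1 else 0)"
  shows "(\<Oplus>i\<in>{..<d}. c i \<odot> b i) \<in> U" "j < d \<Longrightarrow> \<Phi> (\<Oplus>i\<in>{..<d}. c i \<odot> b i) j = c j"
proof -
  have m: "c i \<odot> b i \<in> U" if "i \<in> {..<d}" for i using ksubD[OF U] b that by auto
  have z: "klinear V U (\<lambda>_. 0)" by (auto simp: klinear_def)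
  show "(\<Oplus>i\<in>{..<d}. c i \<odot> b i) \<in> U" by (rule conjunct1[OF klinear_finsum[OF z U finite_lessThan m]])
  assume j: "j < d"
  then have l: "klinear V U (\<lambda>u. \<Phi> u j)" using coordsD(2)[OF \<Phi>] by simp
  have "\<Phi> (\<Oplus>i\<in>{..<d}. c i \<odot> b i) j = (\<Sum>i<d. \<Phi> (c i \<odot> b i) j)"
    by (rule conjunct2[OF klinear_finsum[OF l U finite_lessThan m]])
  also have "\<dots> = (\<Sum>i<d. c i * (if j = i then 1 else 0))"
    using b j klinearD(2)[OF l] by (intro sum.cong) auto
  finally show "\<Phi> (\<Oplus>i\<in>{..<d}. c i \<odot> b i) j = c j" using j by (simp add: if_distrib cong: if_cong)
qed

text \<open>
  This is how functionals are seen to be coboundaries: only finitely many values have to be tested.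
\<close>

lemma (in kspace) functional_determined_by_basis:
  assumes U: "ksub V U" and \<Phi>: "coords V U W {..<d::nat} \<Phi>"
    and b: "\<And>i. i < d \<Longrightarrow> b i \<in> U" "\<And>i j. i < d \<Longrightarrow> j < d \<Longrightarrow> \<Phi> (b i) j = (if j = i then 1 else 0)"
    and \<psi>: "klinear V U \<psi>" "\<And>w. w \<in> W \<Longrightarrow> \<psi> w = 0" "\<And>i. i < d \<Longrightarrow> \<psi> (b i) = 0" and u: "u \<in> U"
  shows "\<psi> u = 0"
proof -
  let ?v = "\<Oplus>i\<in>{..<d}. \<Phi> u i \<odot> b i"
  have v: "?v \<in> U" "\<And>j. j < d \<Longrightarrow> \<Phi> ?v j = \<Phi> u j" using coords_expansion[OF U \<Phi> b] by auto
  have "\<forall>j\<in>{..<d}. \<Phi> (u \<ominus> ?v) j = 0"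
    using klinear_minus[OF coordsD(2)[OF \<Phi>] U u v(1)] v(2) by auto
  then have "\<psi> (u \<ominus> ?v) = 0" using coordsD(3)[OF \<Phi> ksub_minus[OF U u v(1)]] \<psi>(2) by blast
  moreover have "\<psi> ?v = (\<Sum>i<d. \<psi> (\<Phi> u i \<odot> b i))"
    using klinear_finsum[OF \<psi>(1) U, of "{..<d}"] ksubD[OF U] b(1) by auto
  moreover have "\<dots> = 0" using klinearD(2)[OF \<psi>(1)] b(1) \<psi>(3) by (intro sum.neutral) auto
  ultimately show ?thesis using klinear_minus[OF \<psi>(1) U u v(1)] by simp
qed

lemma dual_basis_exists:
  fixes d :: nat
  assumes "coords V U W {..<d} \<Phi>"
  obtains b where "\<And>i. i < d \<Longrightarrow> b i \<in> U" "\<And>i j. i < d \<Longrightarrow> j < d \<Longrightarrow> \<Phi> (b i) j = (if j = i then 1 else 0)"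
proof -
  have "\<exists>u\<in>U. \<forall>j\<in>{..<d}. \<Phi> u j = (if j = i then 1 else 0)" for i
    by (rule coordsD(4)[OF assms])
  then obtain b where b: "\<And>i. b i \<in> U \<and> (\<forall>j\<in>{..<d}. \<Phi> (b i) j = (if j = i then 1 else 0))" by metis
  show ?thesis by (rule that[of b]) (use b in auto)
qed

lemma (in kspace) is_basis_imp_qdim:
  assumes "is_basis V bs"
  shows "qdim V (carrier V) {\<zero>} (length bs)"
proof -
  let ?n = "length bs" and ?s = "\<lambda>c. \<Oplus>i\<in>{..<length bs}. c i \<odot> (bs ! i)"
  have bs: "bs ! i \<in> carrier V" if "i < ?n" for i using assms that by (auto simp: is_basis_def)
  have ex1: "\<exists>!c. c \<in> {..<?n} \<rightarrow>\<^sub>E UNIV \<and> v = ?s c" if "v \<in> carrier V" for v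
    using assms that by (auto simp: is_basis_def)
  define \<Phi> where "\<Phi> v = (THE c. c \<in> {..<?n} \<rightarrow>\<^sub>E UNIV \<and> v = ?s c)" for v
  have \<Phi>: "\<Phi> v \<in> {..<?n} \<rightarrow>\<^sub>E UNIV" "v = ?s (\<Phi> v)" if "v \<in> carrier V" for v
    using theI'[OF ex1[OF that]] by (auto simp: \<Phi>_def)
  have uniq: "\<Phi> v = restrict c {..<?n}" if "v \<in> carrier V" "v = ?s c" for v c
  proof -
    have "?s c = ?s (restrict c {..<?n})" using bs by (intro finsum_cong') auto
    then have "restrict c {..<?n} \<in> {..<?n} \<rightarrow>\<^sub>E UNIV \<and> v = ?s (restrict c {..<?n})" using that(2) by simp
    then show ?thesis using ex1[OF that(1)] \<Phi>[OF that(1)] by blast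
  qed
  have cl: "?s c \<in> carrier V" for c using bs by (intro finsum_closed) auto
  have "coords V (carrier V) {\<zero>} {..<?n} \<Phi>"
    unfolding coords_def klinear_def
  proof (intro conjI ballI allI)
    fix i x assume i: "i \<in> {..<?n}" and x: "x \<in> carrier V"
    show "\<Phi> (x \<oplus> y) i = \<Phi> x i + \<Phi> y i" if y: "y \<in> carrier V" for y
    proof -
      have "x \<oplus> y = ?s (\<Phi> x) \<oplus> ?s (\<Phi> y)" using \<Phi>(2) x y by simp
      also have "\<dots> = (\<Oplus>i\<in>{..<?n}. \<Phi> x i \<odot> (bs ! i) \<oplus> \<Phi> y i \<odot> (bs ! i))"
        using bs by (intro finsum_addf[symmetric]) auto
      also have "\<dots> = ?s (\<lambda>i. \<Phi> x i + \<Phi> y i)"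
        using bs by (intro finsum_cong') (auto simp: ksm_l_distr)
      finally have "\<Phi> (x \<oplus> y) = restrict (\<lambda>i. \<Phi> x i + \<Phi> y i) {..<?n}" using x y by (intro uniq) (assumption | rule a_closed)+
      then show ?thesis using i by simp
    qed
    show "\<Phi> (c \<odot> x) i = c * \<Phi> x i" for c
    proof -
      have fs: "c \<odot> (\<Oplus>i\<in>S. g i) = (\<Oplus>i\<in>S. c \<odot> g i)" if "finite S" "g \<in> S \<rightarrow> carrier V" for S and g :: "nat \<Rightarrow> _"
        using that by (induction S rule: finite_induct) (auto simp: ksm_r_distr finsum_insert Pi_def)
      have "c \<odot> x = c \<odot> ?s (\<Phi> x)" using \<Phi>(2) x by simp
      also have "\<dots> = (\<Oplus>i\<in>{..<?n}. c \<odot> (\<Phi> x i \<odot> (bs ! i)))" using bs by (intro fs) auto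
      also have "\<dots> = ?s (\<lambda>i. c * \<Phi> x i)"
        using bs by (intro finsum_cong') (auto simp: ksm_assoc)
      finally have "\<Phi> (c \<odot> x) = restrict (\<lambda>i. c * \<Phi> x i) {..<?n}" using x by (intro uniq) (assumption | rule ksm_closed)+
      then show ?thesis using i by simp
    qed
  next
    have s0: "?s (\<lambda>_. 0) = \<zero>" using bs by (subst finsum_cong'[where g = "\<lambda>_. \<zero>"]) auto
    fix u assume u: "u \<in> carrier V"
    show "u \<in> {\<zero>} \<longleftrightarrow> (\<forall>i\<in>{..<?n}. \<Phi> u i = 0)"
    proof
      assume "\<forall>i\<in>{..<?n}. \<Phi> u i = 0"
      then have "?s (\<Phi> u) = \<zero>" using bs by (subst finsum_cong'[where g = "\<lambda>_. \<zero>"]) auto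
      then show "u \<in> {\<zero>}" using \<Phi>(2)[OF u] by simp
    next
      assume "u \<in> {\<zero>}"
      then have "\<Phi> u = restrict (\<lambda>_. 0) {..<?n}" using uniq[OF u, of "\<lambda>_. 0"] s0 by simp
      then show "\<forall>i\<in>{..<?n}. \<Phi> u i = 0" by simp
    qed
  next
    show "\<exists>u\<in>carrier V. \<forall>i\<in>{..<?n}. \<Phi> u i = g i" for g
      using uniq[OF cl refl, of g] cl by (intro bexI[of _ "?s g"]) auto
    show "{\<zero>} \<subseteq> carrier V" by simp
  qed
  then show ?thesis unfolding qdim_def by blast
qed

lemma (in kspace) dimension_eqI:
  assumes "qdim V (carrier V) {\<zero>} d"
  shows "finite_dimensional V" "dimension V = d"
proof -
  obtain \<Phi> where \<Phi>: "coords V (carrier V) {\<zero>} {..<d} \<Phi>" using assms by (auto simp: qdim_def)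
  obtain b where b: "\<And>i. i < d \<Longrightarrow> b i \<in> carrier V"
    "\<And>i j. i < d \<Longrightarrow> j < d \<Longrightarrow> \<Phi> (b i) j = (if j = i then 1 else 0)"
    using dual_basis_exists[OF \<Phi>] by blast
  note ex = coords_expansion[OF ksub_carrier \<Phi> b]
  have basis: "is_basis V (map b [0..<d])"
    unfolding is_basis_def
  proof (intro conjI ballI)
    show "set (map b [0..<d]) \<subseteq> carrier V" using b by auto
    fix v assume v: "v \<in> carrier V"
    have e: "(\<Oplus>i\<in>{..<length (map b [0..<d])}. c i \<odot> map b [0..<d] ! i) = (\<Oplus>i\<in>{..<d}. c i \<odot> b i)" for c
      using b by (intro finsum_cong') auto
    show "\<exists>!c. c \<in> {..<length (map b [0..<d])} \<rightarrow>\<^sub>E UNIV \<and> v = (\<Oplus>i\<in>{..<length (map b [0..<d])}. c i \<odot> map b [0..<d] ! i)"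
      unfolding e
    proof (rule ex1I[of _ "restrict (\<Phi> v) {..<d}"], intro conjI)
      let ?w = "\<Oplus>i\<in>{..<d}. restrict (\<Phi> v) {..<d} i \<odot> b i"
      have "\<forall>j\<in>{..<d}. \<Phi> (v \<ominus> ?w) j = 0"
        using klinear_minus[OF coordsD(2)[OF \<Phi>] ksub_carrier v ex(1)] ex(2) by auto
      then have "v \<ominus> ?w = \<zero>" using coordsD(3)[OF \<Phi>] ksub_minus[OF ksub_carrier v ex(1)] by blast
      then show "v = ?w" using minus_eq_zeroD[OF v ex(1)] by blast
    next
      fix c assume "c \<in> {..<length (map b [0..<d])} \<rightarrow>\<^sub>E UNIV \<and> v = (\<Oplus>i\<in>{..<d}. c i \<odot> b i)"
      then show "c = restrict (\<Phi> v) {..<d}" using ex(2)[of _ c]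
        by (auto simp: fun_eq_iff PiE_def extensional_def)
    qed auto
  qed
  then show "finite_dimensional V" unfolding finite_dimensional_def by blast
  have "length bs = d" if "is_basis V bs" for bs
    using qdim_le[OF kspace_axioms ksub_carrier] is_basis_imp_qdim[OF that] assms
    by (meson le_antisym)
  then show "dimension V = d" unfolding dimension_def using basis
    by (intro the_equality) (metis length_map length_upt diff_zero, blast)
qed

text \<open>
  If \<open>\<psi>\<close> takes the value 1 at \<open>u0\<close>, then an extension is determined by its kernel: a subspace \<open>H\<close> that
  contains \<open>W\<close> and the kernel of \<open>\<psi>\<close>, does not contain \<open>u0\<close>, and is maximal with these properties. By
  maximality, \<open>V = H \<oplus> k u0\<close>, and the extension is the coefficient at \<open>u0\<close>.
\<close>

lemma (in kspace) extend_functional: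
  assumes U: "ksub V U" and W: "ksub V W" and \<psi>: "klinear V U \<psi>" "\<And>x. x \<in> U \<inter> W \<Longrightarrow> \<psi> x = 0"
  obtains \<psi>' where "klinear V (carrier V) \<psi>'" "\<And>x. x \<in> U \<Longrightarrow> \<psi>' x = \<psi> x" "\<And>x. x \<in> W \<Longrightarrow> \<psi>' x = 0"
proof (cases "\<forall>x\<in>U. \<psi> x = 0")
  case True
  then show ?thesis by (intro that[of "\<lambda>_. 0"]) (auto simp: klinear_def)
next
  case False
  then obtain u1 where u1: "u1 \<in> U" "\<psi> u1 \<noteq> 0" by auto
  define u0 where "u0 = (1 / \<psi> u1) \<odot> u1"
  have u0: "u0 \<in> U" "\<psi> u0 = 1" using u1 ksubD[OF U] klinearD(2)[OF \<psi>(1)] by (auto simp: u0_def)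
  have u0V: "u0 \<in> carrier V" using u0 ksubD[OF U] by auto
  define K where "K = {x \<in> U. \<psi> x = 0}"
  (* The smallest admissible kernel; Zorn's lemma is applied to the subspaces above it. *)
  define H0 where "H0 = {x \<oplus> w | x w. x \<in> K \<and> w \<in> W}"
  have K: "ksub V K" using ksubD[OF U] klinearD[OF \<psi>(1)] klinear_zero[OF \<psi>(1) U]
    by (auto simp: K_def ksub_def)
  have H0: "ksub V H0" unfolding ksub_def
  proof (intro conjI ballI allI)
    show "H0 \<subseteq> carrier V" using ksubD[OF K] ksubD[OF W] by (auto simp: H0_def)
    show "\<zero> \<in> H0" using ksubD(2)[OF K] ksubD(2)[OF W] by (force simp: H0_def)
    fix x assume "x \<in> H0"
    then obtain k w where x: "x = k \<oplus> w" "k \<in> K" "w \<in> W" by (auto simp: H0_def)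
    show "c \<odot> x \<in> H0" for c
      using x ksubD(1,4)[OF K] ksubD(1,4)[OF W] ksm_r_distr[of k w c] unfolding H0_def by blast
    fix y assume "y \<in> H0"
    then obtain k' w' where y: "y = k' \<oplus> w'" "k' \<in> K" "w' \<in> W" by (auto simp: H0_def)
    have "x \<oplus> y = (k \<oplus> k') \<oplus> (w \<oplus> w')" using x y ksubD[OF K] ksubD[OF W] by (simp add: a_ac)
    then show "x \<oplus> y \<in> H0" using x y ksubD(3)[OF K] ksubD(3)[OF W] unfolding H0_def by blast
  qed
  have KH0: "K \<subseteq> H0" and WH0: "W \<subseteq> H0"
  proof -
    have "x = x \<oplus> \<zero>" if "x \<in> K" for x using ksubD[OF K] that by simp
    then show "K \<subseteq> H0" using ksubD(2)[OF W] by (fastforce simp: H0_def)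
    have "x = \<zero> \<oplus> x" if "x \<in> W" for x using ksubD[OF W] that by simp
    then show "W \<subseteq> H0" using ksubD(2)[OF K] by (fastforce simp: H0_def)
  qed
  have u0H0: "u0 \<notin> H0"
  proof
    assume "u0 \<in> H0"
    then obtain k w where h: "u0 = k \<oplus> w" "k \<in> K" "w \<in> W" by (auto simp: H0_def)
    have kU: "k \<in> U" using h by (auto simp: K_def)
    have "w = u0 \<ominus> k" using h ksubD[OF K] ksubD[OF W] by (metis add.inv_solve_right' a_comm a_minus_def u0V)
    then have "w \<in> U" "\<psi> w = 1"
      using ksub_minus[OF U u0(1) kU] klinear_minus[OF \<psi>(1) U u0(1) kU] u0 h by (auto simp: K_def)
    then show False using \<psi>(2)[of w] h by simp
  qed
  define F where "F = {H. ksub V H \<and> H0 \<subseteq> H \<and> u0 \<notin> H}"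
  have "\<exists>M\<in>F. \<forall>X\<in>F. M \<subseteq> X \<longrightarrow> X = M"
  proof (rule subset_Zorn_nonempty)
    show "F \<noteq> {}" using H0 u0H0 by (auto simp: F_def)
    fix C assume C: "C \<noteq> {}" "subset.chain F C"
    have CF: "\<And>X. X \<in> C \<Longrightarrow> ksub V X \<and> H0 \<subseteq> X \<and> u0 \<notin> X" using C by (auto simp: subset.chain_def F_def)
    have "ksub V (\<Union>C)" unfolding ksub_def
    proof (intro conjI ballI allI)
      show "\<Union>C \<subseteq> carrier V" using CF by (meson Union_least ksub_def)
      show "\<zero> \<in> \<Union>C" using CF C(1) by (auto simp: ksub_def)
      fix x assume "x \<in> \<Union>C"
      then obtain X where X: "X \<in> C" "x \<in> X" by auto
      then show "c \<odot> x \<in> \<Union>C" for c using CF[OF X(1)] X unfolding ksub_def by blast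
      fix y assume "y \<in> \<Union>C"
      then obtain Y where Y: "Y \<in> C" "y \<in> Y" by auto
      have "X \<subseteq> Y \<or> Y \<subseteq> X" using C(2) X Y by (auto simp: subset.chain_def)
      then obtain Z where Z: "Z \<in> C" "x \<in> Z" "y \<in> Z" using X Y by blast
      then show "x \<oplus> y \<in> \<Union>C" using CF[OF Z(1)] Z unfolding ksub_def by blast
    qed
    then show "\<Union>C \<in> F" using CF C(1) by (auto simp: F_def)
  qed
  then obtain H where H: "ksub V H" "H0 \<subseteq> H" "u0 \<notin> H" and max: "\<And>X. X \<in> F \<Longrightarrow> H \<subseteq> X \<Longrightarrow> X = H"
    by (auto simp: F_def)
  have scaled: "c = 0" if "c \<odot> u0 \<in> H" for c
  proof (rule ccontr)
    assume "c \<noteq> 0"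
    then have "(1/c) \<odot> (c \<odot> u0) = u0" using ksm_assoc[OF u0V, of "1/c" c] u0V by simp
    then show False using ksubD(4)[OF H(1) that, of "1/c"] H(3) by simp
  qed
  have decomp: "\<exists>c. v \<ominus> c \<odot> u0 \<in> H" if v: "v \<in> carrier V" for v
  proof (cases "v \<in> H")
    case True
    then have "v \<ominus> 0 \<odot> u0 \<in> H" using v u0V by (simp add: ksm_minus_zero)
    then show ?thesis by blast
  next
    case False
    define X where "X = {h \<oplus> c \<odot> v | h c. h \<in> H}"
    have X: "ksub V X" unfolding ksub_def
    proof (intro conjI ballI allI)
      show "X \<subseteq> carrier V" using ksubD[OF H(1)] v by (auto simp: X_def)
      have "\<zero> = \<zero> \<oplus> 0 \<odot> v" using v by simp
      then show "\<zero> \<in> X" using ksubD(2)[OF H(1)] unfolding X_def by blast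
      fix x assume "x \<in> X"
      then obtain h c where x: "x = h \<oplus> c \<odot> v" "h \<in> H" by (auto simp: X_def)
      have "a \<odot> x = a \<odot> h \<oplus> (a * c) \<odot> v" for a using x v ksubD[OF H(1)] by (simp add: ksm_r_distr ksm_assoc)
      then show "a \<odot> x \<in> X" for a using ksubD(4)[OF H(1) x(2)] unfolding X_def by blast
      fix y assume "y \<in> X"
      then obtain h' c' where y: "y = h' \<oplus> c' \<odot> v" "h' \<in> H" by (auto simp: X_def)
      have "x \<oplus> y = (h \<oplus> h') \<oplus> (c + c') \<odot> v" using x y v ksubD[OF H(1)] by (simp add: ksm_l_distr a_ac)
      then show "x \<oplus> y \<in> X" using ksubD(3)[OF H(1) x(2) y(2)] unfolding X_def by blast
    qed
    have HX: "H \<subseteq> X"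
    proof
      fix h assume h: "h \<in> H"
      then have "h = h \<oplus> 0 \<odot> v" using v ksubD[OF H(1)] by simp
      then show "h \<in> X" using h unfolding X_def by blast
    qed
    have "v = \<zero> \<oplus> 1 \<odot> v" using v by simp
    then have "v \<in> X" using ksubD(2)[OF H(1)] unfolding X_def by blast
    then have "X \<noteq> H" using False by blast
    then have "u0 \<in> X" using max[of X] X HX H(2) by (auto simp: F_def)
    then obtain h c where h: "u0 = h \<oplus> c \<odot> v" "h \<in> H" by (auto simp: X_def)
    have hV: "h \<in> carrier V" using h ksubD[OF H(1)] by auto
    have c: "c \<noteq> 0" using h H(3) v hV by auto
    have "(1/c) \<odot> u0 = (1/c) \<odot> h \<oplus> v"
      using h(1) hV v c ksm_r_distr[of h "c \<odot> v" "1/c"] ksm_assoc[OF v, of "1/c" c] by simp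
    then have "v \<ominus> (1/c) \<odot> u0 = \<ominus> ((1/c) \<odot> h)"
      using hV v by (simp add: minus_eq minus_add r_neg1 a_comm r_neg2)
    moreover have "\<ominus> ((1/c) \<odot> h) \<in> H"
      using ksubD[OF H(1)] h(2) ksm_minus[of "(1/c) \<odot> h"] hV by (metis ksm_closed)
    ultimately show ?thesis by metis
  qed
  define \<psi>' where "\<psi>' v = (THE c. v \<ominus> c \<odot> u0 \<in> H)" for v
  have \<psi>'I: "\<psi>' v = c" if v: "v \<in> carrier V" "v \<ominus> c \<odot> u0 \<in> H" for v c
    unfolding \<psi>'_def
  proof (rule the_equality)
    fix c' assume c': "v \<ominus> c' \<odot> u0 \<in> H"
    have "(v \<ominus> c \<odot> u0) \<ominus> (v \<ominus> c' \<odot> u0) \<in> H" using ksub_minus[OF H(1)] that c' by blast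
    also have "(v \<ominus> c \<odot> u0) \<ominus> (v \<ominus> c' \<odot> u0) = c' \<odot> u0 \<ominus> c \<odot> u0"
      using v u0V by (simp add: minus_eq minus_add a_ac r_neg2)
    also have "\<dots> = (c' - c) \<odot> u0"
      using ksm_l_distr[OF u0V, of c' "- c"] u0V ksm_assoc[OF u0V, of "-1" c] ksm_minus[of "c \<odot> u0"] by (simp add: minus_eq)
    finally show "c' = c" using scaled[of "c' - c"] by simp
  qed (rule that)
  have lin: "klinear V (carrier V) \<psi>'"
    unfolding klinear_def
  proof (intro conjI ballI allI)
    fix x a assume x: "x \<in> carrier V"
    obtain c where c: "x \<ominus> c \<odot> u0 \<in> H" using decomp x by blast
    have "a \<odot> (x \<ominus> c \<odot> u0) = a \<odot> x \<ominus> (a * c) \<odot> u0"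
      using x u0V ksm_minus[of "c \<odot> u0"] ksm_minus[of "a \<odot> (c \<odot> u0)"]
      by (simp add: minus_eq ksm_r_distr ksm_assoc)
        (metis ksm_assoc ksm_closed mult.commute)
    then show "\<psi>' (a \<odot> x) = a * \<psi>' x" using \<psi>'I[OF x c] \<psi>'I[of "a \<odot> x" "a * c"] ksubD(4)[OF H(1) c, of a] x by simp
    fix y assume y: "y \<in> carrier V"
    obtain d where d: "y \<ominus> d \<odot> u0 \<in> H" using decomp y by blast
    have "(x \<ominus> c \<odot> u0) \<oplus> (y \<ominus> d \<odot> u0) = (x \<oplus> y) \<ominus> (c + d) \<odot> u0"
      using x y u0V by (simp add: minus_eq ksm_l_distr minus_add a_ac)
    then show "\<psi>' (x \<oplus> y) = \<psi>' x + \<psi>' y"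
      using \<psi>'I[OF x c] \<psi>'I[OF y d] \<psi>'I[of "x \<oplus> y" "c + d"] ksubD(3)[OF H(1) c d] x y by simp
  qed
  show ?thesis
  proof (rule that[OF lin])
    fix x assume x: "x \<in> U"
    have xu: "\<psi> x \<odot> u0 \<in> U" using ksubD(4)[OF U u0(1)] .
    have "x \<ominus> \<psi> x \<odot> u0 \<in> K"
      using ksub_minus[OF U x xu] klinear_minus[OF \<psi>(1) U x xu] klinearD(2)[OF \<psi>(1) u0(1)] u0 by (auto simp: K_def)
    then show "\<psi>' x = \<psi> x" using \<psi>'I[of x "\<psi> x"] KH0 H(2) ksubD(1)[OF U x] by blast
  next
    fix x assume x: "x \<in> W"
    then have "x \<ominus> 0 \<odot> u0 \<in> H" using WH0 H(2) ksubD(1)[OF W x] u0V by (auto simp: ksm_minus_zero)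
    then show "\<psi>' x = 0" using \<psi>'I ksubD(1)[OF W x] by blast
  qed
qed

section \<open>Modules over a ring generated by orthogonal idempotents and arrows\<close>

lemma (in abelian_group) minus_zero_right [simp]: "x \<in> carrier G \<Longrightarrow> x \<ominus> \<zero> = x"
  using minus_equality[of \<zero> \<zero>] by (simp add: minus_eq)

context left_module
begin

lemma lsmult_zero_right: "a \<in> carrier R \<Longrightarrow> a \<odot>\<^bsub>M\<^esub> \<zero>\<^bsub>M\<^esub> = \<zero>\<^bsub>M\<^esub>"
  using lsmult_r_distr[of a "\<zero>\<^bsub>M\<^esub>" "\<zero>\<^bsub>M\<^esub>"] lsmult_closed[of a "\<zero>\<^bsub>M\<^esub>"]
  by (metis M.add.r_cancel_one' M.r_zero M.zero_closed)

lemma lsmult_zero_left: "x \<in> carrier M \<Longrightarrow> \<zero>\<^bsub>R\<^esub> \<odot>\<^bsub>M\<^esub> x = \<zero>\<^bsub>M\<^esub>"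
  using lsmult_l_distr[of "\<zero>\<^bsub>R\<^esub>" "\<zero>\<^bsub>R\<^esub>" x] lsmult_closed[of "\<zero>\<^bsub>R\<^esub>" x]
  by (metis M.add.r_cancel_one' R.r_zero R.zero_closed)

lemma lsmult_minus: "a \<in> carrier R \<Longrightarrow> x \<in> carrier M \<Longrightarrow> a \<odot>\<^bsub>M\<^esub> (\<ominus>\<^bsub>M\<^esub> x) = \<ominus>\<^bsub>M\<^esub> (a \<odot>\<^bsub>M\<^esub> x)"
  using lsmult_r_distr[of a "\<ominus>\<^bsub>M\<^esub> x" x] lsmult_zero_right[of a] lsmult_closed
  by (metis M.a_inv_closed M.l_neg M.minus_equality)

lemma lsmult_finsum:
  assumes "finite S" "a \<in> carrier R" "\<And>i. i \<in> S \<Longrightarrow> f i \<in> carrier M"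
  shows "a \<odot>\<^bsub>M\<^esub> (\<Oplus>\<^bsub>M\<^esub>i\<in>S. f i) = (\<Oplus>\<^bsub>M\<^esub>i\<in>S. a \<odot>\<^bsub>M\<^esub> f i)"
  using assms
proof (induction S rule: finite_induct)
  case (insert x S)
  then have "f \<in> S \<rightarrow> carrier M" "(\<lambda>i. a \<odot>\<^bsub>M\<^esub> f i) \<in> S \<rightarrow> carrier M" by (auto intro: lsmult_closed)
  then show ?case using insert by (simp add: M.finsum_insert lsmult_r_distr lsmult_closed)
qed (simp add: lsmult_zero_right)

lemma finsum_lsmult:
  assumes "finite S" "x \<in> carrier M" "\<And>i. i \<in> S \<Longrightarrow> f i \<in> carrier R"
  shows "(\<Oplus>\<^bsub>R\<^esub>i\<in>S. f i) \<odot>\<^bsub>M\<^esub> x = (\<Oplus>\<^bsub>M\<^esub>i\<in>S. f i \<odot>\<^bsub>M\<^esub> x)"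
  using assms
proof (induction S rule: finite_induct)
  case (insert y S)
  then have "f \<in> S \<rightarrow> carrier R" "(\<lambda>i. f i \<odot>\<^bsub>M\<^esub> x) \<in> S \<rightarrow> carrier M" by (auto intro: lsmult_closed)
  then show ?case using insert by (simp add: M.finsum_insert R.finsum_insert lsmult_l_distr lsmult_closed)
qed (simp add: lsmult_zero_left)

end

definition submod :: "('r, 'x) ring_scheme \<Rightarrow> ('r, 'm, 'y) module_scheme \<Rightarrow> 'm set \<Rightarrow> bool" where
  "submod R Y X \<longleftrightarrow> X \<subseteq> carrier Y \<and> \<zero>\<^bsub>Y\<^esub> \<in> X \<and> (\<forall>x\<in>X. \<forall>y\<in>X. x \<oplus>\<^bsub>Y\<^esub> y \<in> X) \<and>
     (\<forall>a\<in>carrier R. \<forall>x\<in>X. a \<odot>\<^bsub>Y\<^esub> x \<in> X)"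

lemma submodD:
  assumes "submod R Y X"
  shows "x \<in> X \<Longrightarrow> x \<in> carrier Y" "\<zero>\<^bsub>Y\<^esub> \<in> X" "x \<in> X \<Longrightarrow> y \<in> X \<Longrightarrow> x \<oplus>\<^bsub>Y\<^esub> y \<in> X"
    "a \<in> carrier R \<Longrightarrow> x \<in> X \<Longrightarrow> a \<odot>\<^bsub>Y\<^esub> x \<in> X"
  using assms by (auto simp: submod_def)

definition lmap :: "('r, 'x) ring_scheme \<Rightarrow> ('r, 'm, 'y) module_scheme \<Rightarrow> ('r, 'n, 'z) module_scheme \<Rightarrow> ('m \<Rightarrow> 'n) \<Rightarrow> bool" where
  "lmap R M N f \<longleftrightarrow> (\<forall>x\<in>carrier M. f x \<in> carrier N) \<and>
     (\<forall>x\<in>carrier M. \<forall>y\<in>carrier M. f (x \<oplus>\<^bsub>M\<^esub> y) = f x \<oplus>\<^bsub>N\<^esub> f y) \<and>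
     (\<forall>a\<in>carrier R. \<forall>x\<in>carrier M. f (a \<odot>\<^bsub>M\<^esub> x) = a \<odot>\<^bsub>N\<^esub> f x)"

lemma lmapD:
  assumes "lmap R M N f"
  shows "x \<in> carrier M \<Longrightarrow> f x \<in> carrier N"
    "x \<in> carrier M \<Longrightarrow> y \<in> carrier M \<Longrightarrow> f (x \<oplus>\<^bsub>M\<^esub> y) = f x \<oplus>\<^bsub>N\<^esub> f y"
    "a \<in> carrier R \<Longrightarrow> x \<in> carrier M \<Longrightarrow> f (a \<odot>\<^bsub>M\<^esub> x) = a \<odot>\<^bsub>N\<^esub> f x"
  using assms by (auto simp: lmap_def)

lemma lmod_hom_iff: "f \<in> lmod_hom R M N \<longleftrightarrow> lmap R M N f \<and> f \<in> extensional (carrier M)"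
  by (auto simp: lmod_hom_def lmap_def PiE_def)

lemma additive_zero:
  assumes "abelian_group M" "abelian_group N" "\<And>x. x \<in> carrier M \<Longrightarrow> f x \<in> carrier N"
    "\<And>x y. x \<in> carrier M \<Longrightarrow> y \<in> carrier M \<Longrightarrow> f (x \<oplus>\<^bsub>M\<^esub> y) = f x \<oplus>\<^bsub>N\<^esub> f y"
  shows "f \<zero>\<^bsub>M\<^esub> = \<zero>\<^bsub>N\<^esub>"
proof -
  interpret M: abelian_group M by fact
  interpret N: abelian_group N by fact
  have "f \<zero>\<^bsub>M\<^esub> \<oplus>\<^bsub>N\<^esub> f \<zero>\<^bsub>M\<^esub> = f \<zero>\<^bsub>M\<^esub>" using assms(4)[of "\<zero>\<^bsub>M\<^esub>" "\<zero>\<^bsub>M\<^esub>"] by simp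
  then show ?thesis using assms(3)[of "\<zero>\<^bsub>M\<^esub>"] by (metis M.zero_closed N.add.r_cancel_one')
qed

lemma additive_minus:
  assumes "abelian_group M" "abelian_group N" "\<And>x. x \<in> carrier M \<Longrightarrow> f x \<in> carrier N"
    "\<And>x y. x \<in> carrier M \<Longrightarrow> y \<in> carrier M \<Longrightarrow> f (x \<oplus>\<^bsub>M\<^esub> y) = f x \<oplus>\<^bsub>N\<^esub> f y"
    "x \<in> carrier M"
  shows "f (\<ominus>\<^bsub>M\<^esub> x) = \<ominus>\<^bsub>N\<^esub> f x"
proof -
  interpret M: abelian_group M by fact
  interpret N: abelian_group N by fact
  have "f (\<ominus>\<^bsub>M\<^esub> x) \<oplus>\<^bsub>N\<^esub> f x = \<zero>\<^bsub>N\<^esub>"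
    using assms(4)[of "\<ominus>\<^bsub>M\<^esub> x" x] additive_zero[OF assms(1-4)] assms(5) by (simp add: M.l_neg)
  then show ?thesis using assms(3,5) by (metis M.a_inv_closed N.minus_equality)
qed

lemma additive_finsum:
  assumes "abelian_group M" "abelian_group N" "\<And>x. x \<in> carrier M \<Longrightarrow> f x \<in> carrier N"
    "\<And>x y. x \<in> carrier M \<Longrightarrow> y \<in> carrier M \<Longrightarrow> f (x \<oplus>\<^bsub>M\<^esub> y) = f x \<oplus>\<^bsub>N\<^esub> f y"
    "finite S" "\<And>i. i \<in> S \<Longrightarrow> g i \<in> carrier M"
  shows "f (\<Oplus>\<^bsub>M\<^esub>i\<in>S. g i) = (\<Oplus>\<^bsub>N\<^esub>i\<in>S. f (g i))"
  using assms(5,6)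
proof (induction S rule: finite_induct)
  case empty
  interpret M: abelian_group M by fact
  interpret N: abelian_group N by fact
  show ?case using additive_zero[OF assms(1-4)] by simp
next
  case (insert x S)
  interpret M: abelian_group M by fact
  interpret N: abelian_group N by fact
  have "g \<in> S \<rightarrow> carrier M" "(\<lambda>i. f (g i)) \<in> S \<rightarrow> carrier N" using insert assms(3) by auto
  then show ?case using insert assms(3,4) by (simp add: M.finsum_insert N.finsum_insert)
qed

lemma lmap_minus:
  assumes "left_module R M" "left_module R N" "lmap R M N f" "x \<in> carrier M" "y \<in> carrier M"
  shows "f (x \<ominus>\<^bsub>M\<^esub> y) = f x \<ominus>\<^bsub>N\<^esub> f y"
proof -
  interpret M: left_module R M by fact
  interpret N: left_module R N by fact
  show ?thesis
    using lmapD(1,2)[OF assms(3)] additive_minus[OF M.abelian_group_axioms N.abelian_group_axioms, of f] assms(4,5)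
    by (simp add: a_minus_def)
qed

text \<open>
  The properties of a quadratic monomial algebra that the argument uses. The ring is spanned by the
  idempotents \<open>idm v\<close> and the right ideals generated by the arrows \<open>arr a\<close>; \<open>coeff v\<close> is the coefficient at
  \<open>idm v\<close>, and \<open>strip a r\<close> is a chosen element with \<open>arr a \<otimes> strip a r\<close> equal to the part of \<open>r\<close> in
  \<open>arr a \<otimes> R\<close>. A function with \<open>strip a \<zero> = \<zero>\<close> is used, rather than the mere existence of such elements,
  because it can be applied coordinatewise to free modules of infinite rank. The set \<open>perp a\<close> consists
  of the arrows \<open>b\<close> with \<open>arr a \<otimes> arr b = \<zero>\<close> that end where \<open>a\<close> starts; the last assumption says that these
  account for all of the right annihilator of \<open>arr a\<close>.
\<close>

locale monomial_ring = ring R for R :: "('r, 'x) ring_scheme" (structure) +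
  fixes \<iota> :: "'k::field \<Rightarrow> 'r" and V :: "'v set" and A :: "'a set"
    and idm :: "'v \<Rightarrow> 'r" and arr :: "'a \<Rightarrow> 'r" and src :: "'a \<Rightarrow> 'v" and perp :: "'a \<Rightarrow> 'a set"
    and coeff :: "'v \<Rightarrow> 'r \<Rightarrow> 'k" and strip :: "'a \<Rightarrow> 'r \<Rightarrow> 'r"
  assumes finite_V: "finite V" and finite_A: "finite A"
    and iota_closed [simp]: "\<iota> c \<in> carrier R"
    and iota_add: "\<iota> (c + d) = \<iota> c \<oplus> \<iota> d"
    and iota_mult: "\<iota> (c * d) = \<iota> c \<otimes> \<iota> d"
    and iota_one: "\<iota> 1 = \<one>"
    and iota_central: "r \<in> carrier R \<Longrightarrow> \<iota> c \<otimes> r = r \<otimes> \<iota> c"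
    and idm_closed [simp]: "v \<in> V \<Longrightarrow> idm v \<in> carrier R"
    and arr_closed [simp]: "a \<in> A \<Longrightarrow> arr a \<in> carrier R"
    and src_closed [simp]: "a \<in> A \<Longrightarrow> src a \<in> V"
    and perp_subset: "a \<in> A \<Longrightarrow> perp a \<subseteq> A"
    and sum_idm: "(\<Oplus>v\<in>V. idm v) = \<one>"
    and idm_idm: "v \<in> V \<Longrightarrow> w \<in> V \<Longrightarrow> idm v \<otimes> idm w = (if v = w then idm v else \<zero>)"
    and arr_src: "a \<in> A \<Longrightarrow> arr a \<otimes> idm (src a) = arr a"
    and arr_perp: "a \<in> A \<Longrightarrow> b \<in> perp a \<Longrightarrow> arr a \<otimes> arr b = \<zero>"
    and src_perp: "a \<in> A \<Longrightarrow> b \<in> perp a \<Longrightarrow> idm (src a) \<otimes> arr b = arr b"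
    and coeff_add: "v \<in> V \<Longrightarrow> r \<in> carrier R \<Longrightarrow> s \<in> carrier R \<Longrightarrow> coeff v (r \<oplus> s) = coeff v r + coeff v s"
    and coeff_iota: "v \<in> V \<Longrightarrow> r \<in> carrier R \<Longrightarrow> coeff v (\<iota> c \<otimes> r) = c * coeff v r"
    and coeff_idm_mult: "v \<in> V \<Longrightarrow> w \<in> V \<Longrightarrow> r \<in> carrier R \<Longrightarrow> coeff w (idm v \<otimes> r) = (if v = w then coeff v r else 0)"
    and coeff_idm: "v \<in> V \<Longrightarrow> w \<in> V \<Longrightarrow> coeff w (idm v) = (if v = w then 1 else 0)"
    and coeff_arr: "v \<in> V \<Longrightarrow> a \<in> A \<Longrightarrow> r \<in> carrier R \<Longrightarrow> coeff v (arr a \<otimes> r) = 0"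
    and strip_closed [simp]: "a \<in> A \<Longrightarrow> r \<in> carrier R \<Longrightarrow> strip a r \<in> carrier R"
    and strip_zero: "a \<in> A \<Longrightarrow> strip a \<zero> = \<zero>"
    and decomposition: "r \<in> carrier R \<Longrightarrow>
      r = (\<Oplus>v\<in>V. \<iota> (coeff v r) \<otimes> idm v) \<oplus> (\<Oplus>a\<in>A. arr a \<otimes> strip a r)"
    and arr_independent: "\<lbrakk>\<And>a. a \<in> A \<Longrightarrow> f a \<in> carrier R; (\<Oplus>a\<in>A. arr a \<otimes> f a) = \<zero>; a \<in> A\<rbrakk> \<Longrightarrow> arr a \<otimes> f a = \<zero>"
    and arr_annihilator: "\<lbrakk>a \<in> A; r \<in> carrier R; idm (src a) \<otimes> r = r; arr a \<otimes> r = \<zero>\<rbrakk> \<Longrightarrow>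
      (\<forall>v\<in>V. coeff v r = 0) \<and> (\<forall>b\<in>A - perp a. arr b \<otimes> strip b r = \<zero>)"
begin

definition kmod :: "('r, 'm, 'y) module_scheme \<Rightarrow> ('k, 'm) module" where
  "kmod Y = underlying_space \<iota> Y (carrier Y)"

lemma kmod_simps [simp]:
  "carrier (kmod Y) = carrier Y" "zero (kmod Y) = \<zero>\<^bsub>Y\<^esub>" "add (kmod Y) = add Y"
  "c \<odot>\<^bsub>kmod Y\<^esub> x = \<iota> c \<odot>\<^bsub>Y\<^esub> x"
  by (auto simp: kmod_def underlying_space_def)

lemma kspace_kmod:
  assumes "left_module R Y" shows "kspace (kmod Y)"
proof -
  interpret Y: left_module R Y by fact
  show ?thesis
  proof (intro kspace.intro kspace_axioms.intro abelian_groupI)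
    show "\<exists>y\<in>carrier (kmod Y). y \<oplus>\<^bsub>kmod Y\<^esub> x = \<zero>\<^bsub>kmod Y\<^esub>" if "x \<in> carrier (kmod Y)" for x
      using that Y.M.l_neg by (intro bexI[of _ "\<ominus>\<^bsub>Y\<^esub> x"]) auto
  qed (auto simp: Y.M.a_ac Y.lsmult_closed Y.lsmult_l_distr Y.lsmult_r_distr Y.lsmult_assoc Y.lsmult_one iota_add iota_mult iota_one)
qed

lemma submod_ksub: "submod R Y X \<Longrightarrow> ksub (kmod Y) X"
  by (auto simp: submod_def ksub_def)

lemma iota_commute:
  assumes "left_module R Y" "a \<in> carrier R" "x \<in> carrier Y"
  shows "a \<odot>\<^bsub>Y\<^esub> (\<iota> c \<odot>\<^bsub>Y\<^esub> x) = \<iota> c \<odot>\<^bsub>Y\<^esub> (a \<odot>\<^bsub>Y\<^esub> x)"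
proof -
  interpret Y: left_module R Y by fact
  show ?thesis using Y.lsmult_assoc[of a "\<iota> c" x] Y.lsmult_assoc[of "\<iota> c" a x] iota_central[of a c] assms by simp
qed

definition comb :: "('r, 'm, 'y) module_scheme \<Rightarrow> 'a set \<Rightarrow> ('a \<Rightarrow> 'm) \<Rightarrow> 'm" where
  "comb Y B f = (\<Oplus>\<^bsub>Y\<^esub>b\<in>B. arr b \<odot>\<^bsub>Y\<^esub> f b)"

definition arrow_span :: "('r, 'm, 'y) module_scheme \<Rightarrow> 'a set \<Rightarrow> 'm set \<Rightarrow> 'm set" where
  "arrow_span Y B X = {comb Y B f | f. \<forall>b. f b \<in> X}"

lemma finite_subset_A: "B \<subseteq> A \<Longrightarrow> finite B"
  using finite_A finite_subset by blast

context
  fixes Y :: "('r, 'm, 'y) module_scheme"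
  assumes Y: "left_module R Y"
begin

interpretation Y: left_module R Y by (rule Y)

lemma arr_smult_closed: "b \<in> A \<Longrightarrow> x \<in> carrier Y \<Longrightarrow> arr b \<odot>\<^bsub>Y\<^esub> x \<in> carrier Y"
  by (simp add: Y.lsmult_closed)

lemma comb_closed: "B \<subseteq> A \<Longrightarrow> (\<And>b. b \<in> B \<Longrightarrow> f b \<in> carrier Y) \<Longrightarrow> comb Y B f \<in> carrier Y"
  unfolding comb_def by (intro Y.M.finsum_closed) (auto intro: arr_smult_closed)

lemma comb_cong:
  assumes "B \<subseteq> A" "\<And>b. b \<in> B \<Longrightarrow> g b \<in> carrier Y"
    "\<And>b. b \<in> B \<Longrightarrow> arr b \<odot>\<^bsub>Y\<^esub> f b = arr b \<odot>\<^bsub>Y\<^esub> g b"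
  shows "comb Y B f = comb Y B g"
  unfolding comb_def using assms by (intro Y.M.finsum_cong') (auto intro: arr_smult_closed)

lemma comb_add:
  assumes "B \<subseteq> A" "\<And>b. b \<in> B \<Longrightarrow> f b \<in> carrier Y" "\<And>b. b \<in> B \<Longrightarrow> g b \<in> carrier Y"
  shows "comb Y B (\<lambda>b. f b \<oplus>\<^bsub>Y\<^esub> g b) = comb Y B f \<oplus>\<^bsub>Y\<^esub> comb Y B g"
proof -
  have "comb Y B f \<oplus>\<^bsub>Y\<^esub> comb Y B g = (\<Oplus>\<^bsub>Y\<^esub>b\<in>B. arr b \<odot>\<^bsub>Y\<^esub> f b \<oplus>\<^bsub>Y\<^esub> arr b \<odot>\<^bsub>Y\<^esub> g b)"
    unfolding comb_def using assms by (intro Y.M.finsum_addf[symmetric]) (auto intro: arr_smult_closed)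
  also have "\<dots> = comb Y B (\<lambda>b. f b \<oplus>\<^bsub>Y\<^esub> g b)"
    unfolding comb_def using assms by (intro Y.M.finsum_cong') (auto intro!: arr_smult_closed simp: Y.lsmult_r_distr subset_iff)
  finally show ?thesis by simp
qed

lemma comb_smult:
  assumes "B \<subseteq> A" "\<And>b. b \<in> B \<Longrightarrow> f b \<in> carrier Y"
  shows "comb Y B (\<lambda>b. \<iota> c \<odot>\<^bsub>Y\<^esub> f b) = \<iota> c \<odot>\<^bsub>Y\<^esub> comb Y B f"
proof -
  have "\<iota> c \<odot>\<^bsub>Y\<^esub> comb Y B f = (\<Oplus>\<^bsub>Y\<^esub>b\<in>B. \<iota> c \<odot>\<^bsub>Y\<^esub> (arr b \<odot>\<^bsub>Y\<^esub> f b))"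
    unfolding comb_def using assms finite_subset_A by (intro Y.lsmult_finsum) (auto intro: arr_smult_closed)
  also have "\<dots> = comb Y B (\<lambda>b. \<iota> c \<odot>\<^bsub>Y\<^esub> f b)"
    unfolding comb_def using assms iota_commute[OF Y]
    by (intro Y.M.finsum_cong') (auto intro!: arr_smult_closed Y.lsmult_closed simp: subset_iff)
  finally show ?thesis by simp
qed

lemma comb_zero: "B \<subseteq> A \<Longrightarrow> (\<And>b. b \<in> B \<Longrightarrow> arr b \<odot>\<^bsub>Y\<^esub> f b = \<zero>\<^bsub>Y\<^esub>) \<Longrightarrow> comb Y B f = \<zero>\<^bsub>Y\<^esub>"
  unfolding comb_def by (subst Y.M.finsum_cong'[where g = "\<lambda>_. \<zero>\<^bsub>Y\<^esub>"]) auto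

lemma comb_minus:
  assumes "B \<subseteq> A" "\<And>b. b \<in> B \<Longrightarrow> f b \<in> carrier Y" "\<And>b. b \<in> B \<Longrightarrow> g b \<in> carrier Y"
  shows "comb Y B (\<lambda>b. f b \<ominus>\<^bsub>Y\<^esub> g b) = comb Y B f \<ominus>\<^bsub>Y\<^esub> comb Y B g"
proof -
  have "comb Y B (\<lambda>b. f b \<ominus>\<^bsub>Y\<^esub> g b) \<oplus>\<^bsub>Y\<^esub> comb Y B g = comb Y B (\<lambda>b. (f b \<ominus>\<^bsub>Y\<^esub> g b) \<oplus>\<^bsub>Y\<^esub> g b)"
    using assms by (intro comb_add[symmetric]) auto
  also have "\<dots> = comb Y B f"
    using assms by (intro comb_cong) (auto simp: Y.M.minus_eq Y.M.a_assoc Y.M.l_neg)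
  finally show ?thesis using comb_closed[of B] assms
    by (metis (no_types, lifting) Y.M.add.inv_solve_right Y.M.minus_closed Y.M.minus_eq)
qed

lemma idm_smult_idem: "v \<in> V \<Longrightarrow> x \<in> carrier Y \<Longrightarrow> idm v \<odot>\<^bsub>Y\<^esub> (idm v \<odot>\<^bsub>Y\<^esub> x) = idm v \<odot>\<^bsub>Y\<^esub> x"
  using Y.lsmult_assoc[of "idm v" "idm v" x] idm_idm[of v v] by simp

lemma arr_smult_src: "a \<in> A \<Longrightarrow> x \<in> carrier Y \<Longrightarrow> arr a \<odot>\<^bsub>Y\<^esub> (idm (src a) \<odot>\<^bsub>Y\<^esub> x) = arr a \<odot>\<^bsub>Y\<^esub> x"
  using Y.lsmult_assoc[of "arr a" "idm (src a)" x] arr_src by simp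

lemma comb_src:
  assumes "B \<subseteq> A" "\<And>b. b \<in> B \<Longrightarrow> f b \<in> carrier Y"
  shows "comb Y B (\<lambda>b. idm (src b) \<odot>\<^bsub>Y\<^esub> f b) = comb Y B f"
  using assms by (intro comb_cong) (auto intro!: arr_smult_src)

lemma comb_extend:
  assumes "B \<subseteq> C" "C \<subseteq> A" "\<And>b. b \<in> B \<Longrightarrow> f b \<in> carrier Y" 
  shows "comb Y C (\<lambda>b. if b \<in> B then f b else \<zero>\<^bsub>Y\<^esub>) = comb Y B f"
  unfolding comb_def
  using assms finite_subset_A[OF assms(2)]
  by (intro Y.M.add.finprod_mono_neutral_cong_right) (auto intro!: arr_smult_closed simp: Y.lsmult_zero_right subset_iff)

lemma comb_in_submod:
  assumes "submod R Y X" "B \<subseteq> A" "\<And>b. b \<in> B \<Longrightarrow> f b \<in> X"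
  shows "comb Y B f \<in> X"
proof -
  have "finite B" using finite_subset_A assms(2) by blast
  then show ?thesis using assms(2,3) unfolding comb_def
  proof (induction B rule: finite_induct)
    case (insert b B)
    have "(\<lambda>b. arr b \<odot>\<^bsub>Y\<^esub> f b) \<in> B \<rightarrow> carrier Y" "arr b \<odot>\<^bsub>Y\<^esub> f b \<in> X"
      using insert submodD[OF assms(1)] by (auto intro!: arr_smult_closed)
    then show ?case using insert submodD[OF assms(1)] by (simp add: Y.M.finsum_insert)
  qed (simp add: submodD[OF assms(1)])
qed

lemma arrow_span_subset: "submod R Y X \<Longrightarrow> B \<subseteq> A \<Longrightarrow> arrow_span Y B X \<subseteq> X"
  using comb_in_submod by (auto simp: arrow_span_def)

lemma submod_carrier: "submod R Y (carrier Y)"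
  by (auto simp: submod_def Y.lsmult_closed)

lemma arrow_span_mono: "X \<subseteq> X' \<Longrightarrow> arrow_span Y B X \<subseteq> arrow_span Y B X'"
  unfolding arrow_span_def by blast

lemma arrow_spanI:
  assumes "\<And>b. b \<in> B \<Longrightarrow> f b \<in> X" "\<zero>\<^bsub>Y\<^esub> \<in> X" "X \<subseteq> carrier Y" "B \<subseteq> A"
  shows "comb Y B f \<in> arrow_span Y B X"
proof -
  have "comb Y B f = comb Y B (\<lambda>b. if b \<in> B then f b else \<zero>\<^bsub>Y\<^esub>)"
    using assms by (intro comb_cong) auto
  moreover have "\<forall>b. (if b \<in> B then f b else \<zero>\<^bsub>Y\<^esub>) \<in> X" using assms by auto
  ultimately show ?thesis unfolding arrow_span_def mem_Collect_eq
    by (intro exI[of _ "\<lambda>b. if b \<in> B then f b else \<zero>\<^bsub>Y\<^esub>"] conjI)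
qed

lemma ksub_arrow_span:
  assumes X: "submod R Y X" and B: "B \<subseteq> A"
  shows "ksub (kmod Y) (arrow_span Y B X)"
  unfolding ksub_def kmod_simps
proof (intro conjI ballI allI)
  note XD = submodD[OF X]
  show "arrow_span Y B X \<subseteq> carrier Y" using arrow_span_subset[OF X B] XD by auto
  have "\<zero>\<^bsub>Y\<^esub> = comb Y B (\<lambda>_. \<zero>\<^bsub>Y\<^esub>)" using B by (intro comb_zero[symmetric]) (auto simp: Y.lsmult_zero_right)
  then show "\<zero>\<^bsub>Y\<^esub> \<in> arrow_span Y B X" using XD unfolding arrow_span_def by blast
  fix x assume "x \<in> arrow_span Y B X"
  then obtain f where f: "x = comb Y B f" "\<forall>b. f b \<in> X" by (auto simp: arrow_span_def)
  have "\<iota> c \<odot>\<^bsub>Y\<^esub> x = comb Y B (\<lambda>b. \<iota> c \<odot>\<^bsub>Y\<^esub> f b)" for c using f XD comb_smult[OF B, of f c] by simp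
  then show "\<iota> c \<odot>\<^bsub>Y\<^esub> x \<in> arrow_span Y B X" for c
    using f XD(4)[OF iota_closed] unfolding arrow_span_def by blast
  fix y assume "y \<in> arrow_span Y B X"
  then obtain g where g: "y = comb Y B g" "\<forall>b. g b \<in> X" by (auto simp: arrow_span_def)
  have "x \<oplus>\<^bsub>Y\<^esub> y = comb Y B (\<lambda>b. f b \<oplus>\<^bsub>Y\<^esub> g b)" using f g XD comb_add[OF B, of f g] by simp
  then show "x \<oplus>\<^bsub>Y\<^esub> y \<in> arrow_span Y B X"
    using f g XD(3) unfolding arrow_span_def by blast
qed

end

lemma lmap_comb:
  assumes "left_module R F" "left_module R Y" "lmap R F Y p" "B \<subseteq> A" "\<And>b. b \<in> B \<Longrightarrow> f b \<in> carrier F"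
  shows "p (comb F B f) = comb Y B (\<lambda>b. p (f b))"
proof -
  interpret F: left_module R F by fact
  interpret Y: left_module R Y by fact
  have "p (comb F B f) = (\<Oplus>\<^bsub>Y\<^esub>b\<in>B. p (arr b \<odot>\<^bsub>F\<^esub> f b))"
    unfolding comb_def
    using assms lmapD[OF assms(3)] finite_subset_A[OF assms(4)]
    by (intro additive_finsum) (auto intro!: arr_smult_closed F.abelian_group_axioms Y.abelian_group_axioms)
  also have "\<dots> = comb Y B (\<lambda>b. p (f b))"
    unfolding comb_def using assms lmapD[OF assms(3)]
    by (intro Y.M.finsum_cong') (auto intro!: arr_smult_closed simp: subset_iff)
  finally show ?thesis .
qed

lemma submod_kernel:
  assumes "left_module R F" "left_module R Y" "lmap R F Y p"
  shows "submod R F {z \<in> carrier F. p z = \<zero>\<^bsub>Y\<^esub>}"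
proof -
  interpret F: left_module R F by fact
  interpret Y: left_module R Y by fact
  show ?thesis using lmapD[OF assms(3)] additive_zero[OF F.abelian_group_axioms Y.abelian_group_axioms, of p]
    by (auto simp: submod_def F.lsmult_closed Y.lsmult_zero_right)
qed

text \<open>
  The two consequences of freeness on which the recurrence rests: the sum of the submodules
  \<open>arr a F\<close> is direct, and the elements killed by \<open>arr a\<close> are the obvious ones.
\<close>

definition arrow_free :: "('r, 'm, 'y) module_scheme \<Rightarrow> bool" where
  "arrow_free F \<longleftrightarrow>
     (\<forall>f. (\<forall>a. f a \<in> carrier F) \<longrightarrow> comb F A f = \<zero>\<^bsub>F\<^esub> \<longrightarrow> (\<forall>a\<in>A. arr a \<odot>\<^bsub>F\<^esub> f a = \<zero>\<^bsub>F\<^esub>)) \<and>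
     (\<forall>a\<in>A. \<forall>x\<in>carrier F. idm (src a) \<odot>\<^bsub>F\<^esub> x = x \<longrightarrow> arr a \<odot>\<^bsub>F\<^esub> x = \<zero>\<^bsub>F\<^esub> \<longrightarrow>
       x \<in> arrow_span F (perp a) (carrier F))"

lemma arrow_free_independent:
  assumes "left_module R F" "arrow_free F" "B \<subseteq> A" "\<And>b. b \<in> B \<Longrightarrow> f b \<in> carrier F" "comb F B f = \<zero>\<^bsub>F\<^esub>" "b \<in> B"
  shows "arr b \<odot>\<^bsub>F\<^esub> f b = \<zero>\<^bsub>F\<^esub>"
proof -
  interpret F: left_module R F by fact
  let ?g = "\<lambda>b. if b \<in> B then f b else \<zero>\<^bsub>F\<^esub>"
  have "comb F A ?g = \<zero>\<^bsub>F\<^esub>" using comb_extend[OF assms(1,3), of f] assms by simp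
  moreover have "\<forall>a. ?g a \<in> carrier F" using assms(4) by auto
  ultimately have "arr b \<odot>\<^bsub>F\<^esub> ?g b = \<zero>\<^bsub>F\<^esub>"
    using conjunct1[OF assms(2)[unfolded arrow_free_def], THEN spec, of ?g] assms(3,6) by blast
  then show ?thesis using assms(6) by simp
qed

lemma arrow_free_annihilator:
  assumes "arrow_free F" "a \<in> A" "x \<in> carrier F" "idm (src a) \<odot>\<^bsub>F\<^esub> x = x" "arr a \<odot>\<^bsub>F\<^esub> x = \<zero>\<^bsub>F\<^esub>"
  shows "x \<in> arrow_span F (perp a) (carrier F)"
  using assms unfolding arrow_free_def by blast

text \<open>
  The converse to the second property, which holds in every module.
\<close>

lemma perp_span_annihilated:
  assumes "left_module R F" "a \<in> A" "x \<in> arrow_span F (perp a) (carrier F)"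
  shows "arr a \<odot>\<^bsub>F\<^esub> x = \<zero>\<^bsub>F\<^esub>" "idm (src a) \<odot>\<^bsub>F\<^esub> x = x"
proof -
  interpret F: left_module R F by fact
  have p: "perp a \<subseteq> A" "finite (perp a)" using assms(2) perp_subset finite_subset_A by auto
  obtain f where f: "x = comb F (perp a) f" "\<forall>b. f b \<in> carrier F" using assms(3) by (auto simp: arrow_span_def)
  have m: "r \<odot>\<^bsub>F\<^esub> x = (\<Oplus>\<^bsub>F\<^esub>b\<in>perp a. (r \<otimes> arr b) \<odot>\<^bsub>F\<^esub> f b)" if "r \<in> carrier R" for r
  proof -
    have "r \<odot>\<^bsub>F\<^esub> x = (\<Oplus>\<^bsub>F\<^esub>b\<in>perp a. r \<odot>\<^bsub>F\<^esub> (arr b \<odot>\<^bsub>F\<^esub> f b))"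
      unfolding f comb_def using p f that by (intro F.lsmult_finsum) (auto intro!: F.lsmult_closed simp: subset_iff)
    also have "\<dots> = (\<Oplus>\<^bsub>F\<^esub>b\<in>perp a. (r \<otimes> arr b) \<odot>\<^bsub>F\<^esub> f b)"
      using p f that by (intro F.M.finsum_cong') (auto intro!: F.lsmult_closed F.lsmult_assoc[symmetric] simp: subset_iff)
    finally show ?thesis .
  qed
  show "arr a \<odot>\<^bsub>F\<^esub> x = \<zero>\<^bsub>F\<^esub>"
    unfolding m[OF arr_closed[OF assms(2)]] using assms(2) f
    by (subst F.M.finsum_cong'[where g = "\<lambda>_. \<zero>\<^bsub>F\<^esub>"]) (auto simp: arr_perp F.lsmult_zero_left)
  show "idm (src a) \<odot>\<^bsub>F\<^esub> x = x"
    unfolding m[OF idm_closed[OF src_closed[OF assms(2)]]] using assms(2) f p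
    by (subst F.M.finsum_cong'[where g = "\<lambda>b. arr b \<odot>\<^bsub>F\<^esub> f b"])
      (auto simp: src_perp comb_def subset_iff intro!: F.lsmult_closed)
qed

subsection \<open>Relations between the arrows\<close>

definition fun_space :: "('r, 'm, 'y) module_scheme \<Rightarrow> ('k, 'a \<Rightarrow> 'm) module" where
  "fun_space Y = \<lparr>carrier = {f. \<forall>a. f a \<in> carrier Y}, mult = undefined, one = undefined,
     zero = (\<lambda>_. \<zero>\<^bsub>Y\<^esub>), add = (\<lambda>f g a. f a \<oplus>\<^bsub>Y\<^esub> g a), smult = (\<lambda>c f a. \<iota> c \<odot>\<^bsub>Y\<^esub> f a)\<rparr>"

lemma fun_space_simps [simp]:
  "f \<in> carrier (fun_space Y) \<longleftrightarrow> (\<forall>a. f a \<in> carrier Y)" "zero (fun_space Y) = (\<lambda>_. \<zero>\<^bsub>Y\<^esub>)"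
  "f \<oplus>\<^bsub>fun_space Y\<^esub> g = (\<lambda>a. f a \<oplus>\<^bsub>Y\<^esub> g a)" "c \<odot>\<^bsub>fun_space Y\<^esub> f = (\<lambda>a. \<iota> c \<odot>\<^bsub>Y\<^esub> f a)"
  by (auto simp: fun_space_def)

lemma kspace_fun_space:
  assumes "left_module R Y" shows "kspace (fun_space Y)"
proof -
  interpret Y: left_module R Y by fact
  show ?thesis
  proof (intro kspace.intro kspace_axioms.intro abelian_groupI)
    show "\<exists>y\<in>carrier (fun_space Y). y \<oplus>\<^bsub>fun_space Y\<^esub> x = \<zero>\<^bsub>fun_space Y\<^esub>" if "x \<in> carrier (fun_space Y)" for x
      using that Y.M.l_neg by (intro bexI[of _ "\<lambda>a. \<ominus>\<^bsub>Y\<^esub> x a"]) auto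
  qed (auto simp: Y.M.a_ac Y.lsmult_closed Y.lsmult_l_distr Y.lsmult_r_distr Y.lsmult_assoc Y.lsmult_one iota_add iota_mult iota_one fun_eq_iff)
qed

text \<open>
  The families are normalised by \<open>idm (src a) \<odot> x a = x a\<close>, as \<open>arr a \<odot> x\<close> sees no other part of \<open>x\<close>, and by
  zero outside of \<open>B\<close>, so that they form a space.
\<close>

definition relations :: "('r, 'm, 'y) module_scheme \<Rightarrow> 'a set \<Rightarrow> 'm set \<Rightarrow> ('a \<Rightarrow> 'm) set" where
  "relations Y B X = {x. (\<forall>a. x a \<in> X) \<and> (\<forall>a\<in>B. idm (src a) \<odot>\<^bsub>Y\<^esub> x a = x a) \<and>
     (\<forall>a. a \<notin> B \<longrightarrow> x a = \<zero>\<^bsub>Y\<^esub>) \<and> comb Y B x = \<zero>\<^bsub>Y\<^esub>}"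

text \<open>
  The relations that hold in every module because of \<open>arr a \<otimes> arr b = \<zero>\<close> for \<open>b \<in> perp a\<close>.
\<close>

definition trivial_relations :: "('r, 'm, 'y) module_scheme \<Rightarrow> 'a set \<Rightarrow> 'm set \<Rightarrow> ('a \<Rightarrow> 'm) set" where
  "trivial_relations Y B X = {x \<in> relations Y B X. \<forall>a\<in>B. x a \<in> arrow_span Y (perp a) X}"

lemma ksub_relations:
  assumes "left_module R Y" "submod R Y X" "B \<subseteq> A"
  shows "ksub (fun_space Y) (relations Y B X)"
proof -
  interpret Y: left_module R Y by fact
  note XD = submodD[OF assms(2)]
  have BA: "b \<in> A" if "b \<in> B" for b using assms(3) that by auto
  show ?thesis unfolding ksub_def
  proof (intro conjI ballI allI)
    show "relations Y B X \<subseteq> carrier (fun_space Y)" using XD by (auto simp: relations_def)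
    show "\<zero>\<^bsub>fun_space Y\<^esub> \<in> relations Y B X"
      using XD assms BA by (auto simp: relations_def Y.lsmult_zero_right intro!: comb_zero)
    fix x assume x: "x \<in> relations Y B X"
    then have xc: "x b \<in> carrier Y" "x b \<in> X" for b using XD by (auto simp: relations_def)
    show "c \<odot>\<^bsub>fun_space Y\<^esub> x \<in> relations Y B X" for c
      using x XD xc comb_smult[OF assms(1,3), of x c] BA iota_commute[OF assms(1) idm_closed[OF src_closed]]
      by (auto simp: relations_def Y.lsmult_zero_right)
    fix y assume y: "y \<in> relations Y B X"
    then have yc: "y b \<in> carrier Y" "y b \<in> X" for b using XD by (auto simp: relations_def)
    show "x \<oplus>\<^bsub>fun_space Y\<^esub> y \<in> relations Y B X"
      using x y XD xc yc comb_add[OF assms(1,3), of x y] BA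
      by (auto simp: relations_def Y.lsmult_r_distr)
  qed
qed

text \<open>
  Only the module \<open>X\<close> enters on the right-hand side. The lemma therefore has two uses: it compares any
  two resolutions of the same module, and it passes from one syzygy to the next. The isomorphism sends
  \<open>\<Sum>\<^sub>b arr b f\<^sub>b\<close> to the family of the \<open>p f\<^sub>b\<close>. Directness of the sum of the \<open>arr b F\<close> makes the \<open>f\<^sub>b\<close> unique
  up to elements killed by \<open>arr b\<close>, which change the family by a trivial relation; a family of trivial
  relations lifts to \<open>F\<close> in such a way that the \<open>f\<^sub>b\<close> can be corrected to elements of \<open>K\<close>.
\<close>

lemma syzygy_relations:
  assumes F: "left_module R F" "arrow_free F" and Y: "left_module R Y" and X: "submod R Y X"
    and p: "lmap R F Y p" "p ` carrier F = X" and B: "B \<subseteq> A"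
    and K: "K = {z \<in> carrier F. p z = \<zero>\<^bsub>Y\<^esub>}"
  shows "qdim (kmod F) (K \<inter> arrow_span F B (carrier F)) (arrow_span F B K) d \<longleftrightarrow>
    qdim (fun_space Y) (relations Y B X) (trivial_relations Y B X) d"
proof -
  interpret F: left_module R F by fact
  interpret Y: left_module R Y by fact
  note XD = submodD[OF X] and pD = lmapD[OF p(1)]
  have Kmod: "submod R F K" unfolding K by (rule submod_kernel[OF F(1) Y p(1)])
  note KD = submodD[OF Kmod]
  have BA: "b \<in> A" if "b \<in> B" for b using B that by auto
  have pe: "p (idm v \<odot>\<^bsub>F\<^esub> z) = idm v \<odot>\<^bsub>Y\<^esub> p z" if "v \<in> V" "z \<in> carrier F" for v z using pD(3) that by simp
  note pminus = lmap_minus[OF F(1) Y p(1)]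
  define Rel where "Rel z x \<longleftrightarrow> (\<exists>f. (\<forall>b. f b \<in> carrier F \<and> (b \<in> B \<longrightarrow> idm (src b) \<odot>\<^bsub>F\<^esub> f b = f b)) \<and> z = comb F B f \<and>
    x = (\<lambda>b. if b \<in> B then p (f b) else \<zero>\<^bsub>Y\<^esub>))" for z x
  have normal: "\<exists>f. (\<forall>b. f b \<in> carrier F \<and> (b \<in> B \<longrightarrow> idm (src b) \<odot>\<^bsub>F\<^esub> f b = f b)) \<and> comb F B f = comb F B g \<and>
      (\<forall>b\<in>B. p (f b) = idm (src b) \<odot>\<^bsub>Y\<^esub> p (g b))"
    if "\<forall>b\<in>B. g b \<in> carrier F" for g
  proof (intro exI[of _ "\<lambda>b. if b \<in> B then idm (src b) \<odot>\<^bsub>F\<^esub> g b else \<zero>\<^bsub>F\<^esub>"] conjI allI impI ballI)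
    have "comb F B (\<lambda>b. if b \<in> B then idm (src b) \<odot>\<^bsub>F\<^esub> g b else \<zero>\<^bsub>F\<^esub>) = comb F B (\<lambda>b. idm (src b) \<odot>\<^bsub>F\<^esub> g b)"
      using that BA by (intro comb_cong F B) (auto intro!: F.lsmult_closed)
    then show "comb F B (\<lambda>b. if b \<in> B then idm (src b) \<odot>\<^bsub>F\<^esub> g b else \<zero>\<^bsub>F\<^esub>) = comb F B g"
      using comb_src[OF F(1) B, of g] that by simp
  qed (use that BA F.lsmult_closed idm_smult_idem[OF F(1)] pe in auto)
  show ?thesis
  proof (rule qdim_transfer_iff[where R = Rel, OF kspace_kmod[OF F(1)] kspace_fun_space[OF Y] _ ksub_relations[OF Y X B]])
    show "ksub (kmod F) (K \<inter> arrow_span F B (carrier F))"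
      using submod_ksub[OF Kmod] ksub_arrow_span[OF F(1) submod_carrier[OF F(1)] B] by (auto simp: ksub_def)
    show "arrow_span F B K \<subseteq> K \<inter> arrow_span F B (carrier F)"
      using arrow_span_subset[OF F(1) Kmod B] arrow_span_mono[OF F(1), of K "carrier F" B] KD by blast
    show "trivial_relations Y B X \<subseteq> relations Y B X" by (auto simp: trivial_relations_def)
  next
    fix z assume z: "z \<in> K \<inter> arrow_span F B (carrier F)"
    then obtain g where g: "z = comb F B g" "\<forall>b. g b \<in> carrier F" by (auto simp: arrow_span_def)
    obtain f where f: "\<forall>b. f b \<in> carrier F \<and> (b \<in> B \<longrightarrow> idm (src b) \<odot>\<^bsub>F\<^esub> f b = f b)" "z = comb F B f"
      using normal[of g] g by metis
    let ?x = "\<lambda>b. if b \<in> B then p (f b) else \<zero>\<^bsub>Y\<^esub>"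
    have "comb Y B ?x = comb Y B (\<lambda>b. p (f b))" using f pD by (intro comb_cong Y B) auto
    also have "\<dots> = p z" using lmap_comb[OF F(1) Y p(1) B, of f] f by simp
    also have "\<dots> = \<zero>\<^bsub>Y\<^esub>" using z by (simp add: K)
    finally have "?x \<in> relations Y B X"
    proof -
      assume c: "comb Y B ?x = \<zero>\<^bsub>Y\<^esub>"
      have 1: "\<forall>b. ?x b \<in> X" using f(1) p(2) XD(2) by auto
      have 2: "\<forall>b\<in>B. idm (src b) \<odot>\<^bsub>Y\<^esub> ?x b = ?x b"
        using pe[OF src_closed[OF BA], symmetric] f(1) by simp
      show ?thesis using 1 2 c unfolding relations_def mem_Collect_eq by simp
    qed
    then show "\<exists>x\<in>relations Y B X. Rel z x" using f unfolding Rel_def by blast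
  next
    fix x assume x: "x \<in> relations Y B X"
    have "\<forall>b. \<exists>g. g \<in> carrier F \<and> p g = x b" using x p(2) by (auto simp: relations_def image_iff) (metis imageE)
    then obtain g where g: "\<And>b. g b \<in> carrier F" "\<And>b. p (g b) = x b" by metis
    obtain f where f: "\<forall>b. f b \<in> carrier F \<and> (b \<in> B \<longrightarrow> idm (src b) \<odot>\<^bsub>F\<^esub> f b = f b)" "comb F B f = comb F B g"
        "\<forall>b\<in>B. p (f b) = idm (src b) \<odot>\<^bsub>Y\<^esub> p (g b)"
      using normal[of g] g by metis
    have pf: "\<forall>b\<in>B. p (f b) = x b" using f(3) g x by (auto simp: relations_def)
    have "p (comb F B f) = comb Y B (\<lambda>b. p (f b))" using lmap_comb[OF F(1) Y p(1) B, of f] f by simp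
    also have "\<dots> = comb Y B x" using pf x XD by (intro comb_cong Y B) (auto simp: relations_def)
    finally have "p (comb F B f) = \<zero>\<^bsub>Y\<^esub>" using x by (simp add: relations_def)
    moreover have "comb F B f \<in> carrier F" using f(1) comb_closed[OF F(1) B, of f] by blast
    ultimately have "comb F B f \<in> K" by (simp add: K)
    moreover have "comb F B f \<in> arrow_span F B (carrier F)" using f(1) unfolding arrow_span_def by blast
    moreover have "x = (\<lambda>b. if b \<in> B then p (f b) else \<zero>\<^bsub>Y\<^esub>)" using pf x by (auto simp: relations_def)
    ultimately show "\<exists>z\<in>K \<inter> arrow_span F B (carrier F). Rel z x" using f(1) unfolding Rel_def by blast
  next
    fix z x z' x' assume "Rel z x" "Rel z' x'"
    then obtain f f' where f: "\<forall>b. f b \<in> carrier F \<and> (b \<in> B \<longrightarrow> idm (src b) \<odot>\<^bsub>F\<^esub> f b = f b)" "z = comb F B f"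
      "x = (\<lambda>b. if b \<in> B then p (f b) else \<zero>\<^bsub>Y\<^esub>)"
      and f': "\<forall>b. f' b \<in> carrier F \<and> (b \<in> B \<longrightarrow> idm (src b) \<odot>\<^bsub>F\<^esub> f' b = f' b)" "z' = comb F B f'"
      "x' = (\<lambda>b. if b \<in> B then p (f' b) else \<zero>\<^bsub>Y\<^esub>)" unfolding Rel_def by blast
    show "Rel (z \<oplus>\<^bsub>kmod F\<^esub> z') (x \<oplus>\<^bsub>fun_space Y\<^esub> x')" unfolding Rel_def
      by (rule exI[of _ "\<lambda>b. f b \<oplus>\<^bsub>F\<^esub> f' b"])
        (use f f' comb_add[OF F(1) B, of f f'] pD BA in \<open>auto simp: fun_eq_iff F.lsmult_r_distr\<close>)
  next
    fix c z x assume "Rel z x"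
    then obtain f where f: "\<forall>b. f b \<in> carrier F \<and> (b \<in> B \<longrightarrow> idm (src b) \<odot>\<^bsub>F\<^esub> f b = f b)" "z = comb F B f"
      "x = (\<lambda>b. if b \<in> B then p (f b) else \<zero>\<^bsub>Y\<^esub>)" unfolding Rel_def by blast
    show "Rel (c \<odot>\<^bsub>kmod F\<^esub> z) (c \<odot>\<^bsub>fun_space Y\<^esub> x)" unfolding Rel_def
      by (rule exI[of _ "\<lambda>b. \<iota> c \<odot>\<^bsub>F\<^esub> f b"])
        (use f comb_smult[OF F(1) B, of f c] pD BA iota_commute[OF F(1)] in
          \<open>auto simp: fun_eq_iff F.lsmult_closed Y.lsmult_zero_right\<close>)
  next
    fix z x assume z: "z \<in> K \<inter> arrow_span F B (carrier F)" and x: "x \<in> relations Y B X" and "Rel z x"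
    then obtain f where f: "\<And>b. f b \<in> carrier F" "\<And>b. b \<in> B \<Longrightarrow> idm (src b) \<odot>\<^bsub>F\<^esub> f b = f b" "z = comb F B f"
      "x = (\<lambda>b. if b \<in> B then p (f b) else \<zero>\<^bsub>Y\<^esub>)" unfolding Rel_def by blast
    show "z \<in> arrow_span F B K \<longleftrightarrow> x \<in> trivial_relations Y B X"
    proof
      assume "z \<in> arrow_span F B K"
      then obtain k where k: "z = comb F B k" "\<And>b. k b \<in> K" by (auto simp: arrow_span_def)
      have kF: "k b \<in> carrier F" "p (k b) = \<zero>\<^bsub>Y\<^esub>" for b using k(2)[of b] by (auto simp: K)
      have "comb F B (\<lambda>b. f b \<ominus>\<^bsub>F\<^esub> k b) = \<zero>\<^bsub>F\<^esub>"
        using comb_minus[OF F(1) B, of f k] f k kF comb_closed[OF F(1) B, of k] by (simp add: F.M.minus_eq F.M.r_neg)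
      then have an: "arr b \<odot>\<^bsub>F\<^esub> (f b \<ominus>\<^bsub>F\<^esub> k b) = \<zero>\<^bsub>F\<^esub>" if "b \<in> B" for b
        using arrow_free_independent[OF F B, of "\<lambda>b. f b \<ominus>\<^bsub>F\<^esub> k b"] f kF that by auto
      have "x b \<in> arrow_span Y (perp b) X" if b: "b \<in> B" for b
      proof -
        let ?y = "idm (src b) \<odot>\<^bsub>F\<^esub> (f b \<ominus>\<^bsub>F\<^esub> k b)"
        have y: "?y \<in> carrier F" "arr b \<odot>\<^bsub>F\<^esub> ?y = \<zero>\<^bsub>F\<^esub>" "idm (src b) \<odot>\<^bsub>F\<^esub> ?y = ?y"
          using an[OF b] f kF BA[OF b] arr_smult_src[OF F(1), of b] idm_smult_idem[OF F(1)] by (auto intro!: F.lsmult_closed)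
        then have "?y \<in> arrow_span F (perp b) (carrier F)" using arrow_free_annihilator[OF F(2)] BA[OF b] by blast
        then obtain h where h: "?y = comb F (perp b) h" "\<And>c. h c \<in> carrier F" by (auto simp: arrow_span_def)
        have "p ?y = idm (src b) \<odot>\<^bsub>Y\<^esub> (p (f b) \<ominus>\<^bsub>Y\<^esub> \<zero>\<^bsub>Y\<^esub>)"
          using pe pminus f kF BA[OF b] by simp
        also have "\<dots> = x b" using f b x pD(1)
          by (auto simp: relations_def)
        finally have "x b = comb Y (perp b) (\<lambda>c. p (h c))"
          using lmap_comb[OF F(1) Y p(1) perp_subset[OF BA[OF b]], of h] h by simp
        then show ?thesis using h(2) p(2) unfolding arrow_span_def by blast
      qed
      then show "x \<in> trivial_relations Y B X" using x by (auto simp: trivial_relations_def)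
    next
      assume t: "x \<in> trivial_relations Y B X"
      have "\<exists>k\<in>K. arr b \<odot>\<^bsub>F\<^esub> k = arr b \<odot>\<^bsub>F\<^esub> f b" if b: "b \<in> B" for b
      proof -
        have "x b \<in> arrow_span Y (perp b) X" using t b by (auto simp: trivial_relations_def)
        then obtain y where y: "x b = comb Y (perp b) y" "\<And>c. y c \<in> X" by (auto simp: arrow_span_def)
        have "\<forall>c. \<exists>g. g \<in> carrier F \<and> p g = y c" using y(2) p(2) by (metis imageE)
        then obtain g where g: "\<And>c. g c \<in> carrier F" "\<And>c. p (g c) = y c" by metis
        note pb = perp_subset[OF BA[OF b]]
        let ?g = "comb F (perp b) g"
        have gF: "?g \<in> carrier F" using g comb_closed[OF F(1) pb] by blast
        have "p ?g = x b" using lmap_comb[OF F(1) Y p(1) pb, of g] g y by simp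
        then have "p (f b \<ominus>\<^bsub>F\<^esub> ?g) = \<zero>\<^bsub>Y\<^esub>" using pminus[OF f(1) gF, of b] f(4) b pD(1)[OF f(1)] by (simp add: Y.M.minus_eq Y.M.r_neg)
        then have kK: "f b \<ominus>\<^bsub>F\<^esub> ?g \<in> K" using f gF by (auto simp: K)
        have "arr b \<odot>\<^bsub>F\<^esub> ?g = \<zero>\<^bsub>F\<^esub>"
          using perp_span_annihilated(1)[OF F(1) BA[OF b], of ?g] g by (auto simp: arrow_span_def)
        then have "arr b \<odot>\<^bsub>F\<^esub> (f b \<ominus>\<^bsub>F\<^esub> ?g) = arr b \<odot>\<^bsub>F\<^esub> f b"
          using F.lsmult_r_distr[of "arr b" "f b" "\<ominus>\<^bsub>F\<^esub> ?g"] F.lsmult_minus[of "arr b" ?g] f gF BA[OF b] arr_smult_closed[OF F(1)]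
            F.M.minus_zero_right[OF arr_smult_closed[OF F(1) BA[OF b] f(1)[of b]]] by (simp add: a_minus_def)
        then show ?thesis using kK by blast
      qed
      then obtain k where k: "\<And>b. b \<in> B \<Longrightarrow> k b \<in> K \<and> arr b \<odot>\<^bsub>F\<^esub> k b = arr b \<odot>\<^bsub>F\<^esub> f b" by metis
      have "z = comb F B k" using k KD(1) f(3) by (auto intro!: comb_cong F B)
      then show "z \<in> arrow_span F B K" using arrow_spanI[OF F(1) _ KD(2) _ B, of k] k KD(1) by auto
    qed
  qed
qed

text \<open>
  Inside \<open>F\<close> all terms of a relation vanish separately, so each component of a relation ranges
  independently over \<open>X \<inter> arrow_span F (perp c) (carrier F)\<close>.
\<close>

lemma relations_in_arrow_free:
  assumes F: "left_module R F" "arrow_free F" and X: "submod R F X" and B: "B \<subseteq> A"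
    and d: "\<And>c. c \<in> B \<Longrightarrow> qdim (kmod F) (X \<inter> arrow_span F (perp c) (carrier F)) (arrow_span F (perp c) X) (d c)"
  shows "qdim (fun_space F) (relations F B X) (trivial_relations F B X) (\<Sum>c\<in>B. d c)"
proof -
  interpret F: left_module R F by fact
  note XD = submodD[OF X]
  have BA: "b \<in> A" if "b \<in> B" for b using B that by auto
  define U where "U c = X \<inter> arrow_span F (perp c) (carrier F)" for c
  obtain \<Phi> where \<Phi>: "\<And>c. c \<in> B \<Longrightarrow> coords (kmod F) (U c) (arrow_span F (perp c) X) {..<d c} (\<Phi> c)"
    using d unfolding qdim_def U_def by metis
  have rel: "x \<in> relations F B X \<longleftrightarrow> (\<forall>c\<in>B. x c \<in> U c) \<and> (\<forall>c. c \<notin> B \<longrightarrow> x c = \<zero>\<^bsub>F\<^esub>)" for x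
  proof
    assume x: "x \<in> relations F B X"
    then have xF: "x b \<in> carrier F" "x b \<in> X" for b using XD by (auto simp: relations_def)
    have "x c \<in> arrow_span F (perp c) (carrier F)" if c: "c \<in> B" for c
      using arrow_free_annihilator[OF F(2) BA[OF c] xF(1), of c] arrow_free_independent[OF F B, of x c] x xF c
      by (auto simp: relations_def)
    then show "(\<forall>c\<in>B. x c \<in> U c) \<and> (\<forall>c. c \<notin> B \<longrightarrow> x c = \<zero>\<^bsub>F\<^esub>)"
      using x xF by (auto simp: U_def relations_def)
  next
    assume x: "(\<forall>c\<in>B. x c \<in> U c) \<and> (\<forall>c. c \<notin> B \<longrightarrow> x c = \<zero>\<^bsub>F\<^esub>)"
    then have "x b \<in> X" for b using XD(2) by (cases "b \<in> B") (auto simp: U_def)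
    moreover have "arr c \<odot>\<^bsub>F\<^esub> x c = \<zero>\<^bsub>F\<^esub>" "idm (src c) \<odot>\<^bsub>F\<^esub> x c = x c" if "c \<in> B" for c
      using perp_span_annihilated[OF F(1) BA[OF that], of "x c"] x that by (auto simp: U_def)
    ultimately show "x \<in> relations F B X" using x comb_zero[OF F(1) B, of x] by (auto simp: relations_def)
  qed
  let ?S = "SIGMA c:B. {..<d c}"
  have "coords (fun_space F) (relations F B X) (trivial_relations F B X) ?S (\<lambda>x (c, i). \<Phi> c (x c) i)"
    unfolding coords_def
  proof (intro conjI ballI allI)
    show "trivial_relations F B X \<subseteq> relations F B X" by (auto simp: trivial_relations_def)
    show "klinear (fun_space F) (relations F B X) (\<lambda>u. case s of (c, i) \<Rightarrow> \<Phi> c (u c) i)" if s0: "s \<in> ?S" for s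
    proof -
      obtain c i where s: "s = (c, i)" "c \<in> B" "i < d c" using s0 by auto
      have "klinear (kmod F) (U c) (\<lambda>u. \<Phi> c u i)" using coordsD(2)[OF \<Phi>[OF s(2)]] s by simp
      from klinearD[OF this] show ?thesis using s rel by (auto simp: klinear_def)
    qed
    show "u \<in> trivial_relations F B X \<longleftrightarrow> (\<forall>s\<in>?S. (case s of (c, i) \<Rightarrow> \<Phi> c (u c) i) = 0)" if u: "u \<in> relations F B X" for u
      using coordsD(3)[OF \<Phi>] u rel by (auto simp: trivial_relations_def)
    show "\<exists>u\<in>relations F B X. \<forall>s\<in>?S. (case s of (c, i) \<Rightarrow> \<Phi> c (u c) i) = g s" for g
    proof -
      have "\<exists>u\<in>U c. \<forall>i\<in>{..<d c}. \<Phi> c u i = g (c, i)" if "c \<in> B" for c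
        by (rule coordsD(4)[OF \<Phi>[OF that]])
      then obtain u where u: "\<And>c. c \<in> B \<Longrightarrow> u c \<in> U c" "\<And>c i. c \<in> B \<Longrightarrow> i < d c \<Longrightarrow> \<Phi> c (u c) i = g (c, i)" 
        by (metis lessThan_iff)
      show ?thesis
        by (rule bexI[of _ "\<lambda>c. if c \<in> B then u c else \<zero>\<^bsub>F\<^esub>"]) (use u rel in auto)
    qed
  qed
  then show ?thesis using coords_imp_qdim[of "fun_space F" _ _ ?S] finite_subset_A[OF B] by (auto simp: card_SigmaI)
qed

subsection \<open>Finiteness\<close>

lemma arrow_span_inter:
  assumes F: "left_module R F" "arrow_free F" and K: "submod R F K" and B: "B \<subseteq> A"
  shows "arrow_span F A K \<inter> arrow_span F B (carrier F) \<subseteq> arrow_span F B K"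
proof
  interpret F: left_module R F by fact
  note KD = submodD[OF K]
  fix x assume "x \<in> arrow_span F A K \<inter> arrow_span F B (carrier F)"
  then have "x \<in> arrow_span F A K" "x \<in> arrow_span F B (carrier F)" by auto
  then obtain k f where k: "x = comb F A k" "\<And>a. k a \<in> K" and f: "x = comb F B f" "\<And>a. f a \<in> carrier F"
    unfolding arrow_span_def by blast
  let ?f = "\<lambda>a. if a \<in> B then f a else \<zero>\<^bsub>F\<^esub>"
  have kF: "k a \<in> carrier F" for a using k KD by auto
  have "comb F A (\<lambda>a. k a \<ominus>\<^bsub>F\<^esub> ?f a) = \<zero>\<^bsub>F\<^esub>"
    using comb_minus[OF F(1) subset_refl, of k ?f] comb_extend[OF F(1) B subset_refl, of f] k f kF
      comb_closed[OF F(1) B, of f] by (simp add: F.M.minus_eq F.M.r_neg)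
  then have z: "arr a \<odot>\<^bsub>F\<^esub> (k a \<ominus>\<^bsub>F\<^esub> ?f a) = \<zero>\<^bsub>F\<^esub>" if "a \<in> A" for a
    using arrow_free_independent[OF F subset_refl, of "\<lambda>a. k a \<ominus>\<^bsub>F\<^esub> ?f a" a] kF f(2) that by auto
  have "arr a \<odot>\<^bsub>F\<^esub> (if a \<in> B then k a else \<zero>\<^bsub>F\<^esub>) = arr a \<odot>\<^bsub>F\<^esub> k a" if a: "a \<in> A" for a
    using z[OF a] kF a
    by (cases "a \<in> B") (auto simp: F.lsmult_zero_right)
  then have "x = comb F A (\<lambda>a. if a \<in> B then k a else \<zero>\<^bsub>F\<^esub>)"
    unfolding k(1) using kF by (intro comb_cong[OF F(1) subset_refl, symmetric]) auto
  then have "x = comb F B k" using comb_extend[OF F(1) B subset_refl, of k] kF by simp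
  then show "x \<in> arrow_span F B K" using k by (auto simp: arrow_span_def)
qed

text \<open>
  For finitely generated \<open>K = g G\<close> the quotient of \<open>K\<close> by \<open>arrow_span F A K\<close> is finite-dimensional, and
  a quotient \<open>U / W\<close> that embeds into it is so as well. The argument runs in \<open>G\<close>, where the dimension of
  the top is known.
\<close>

lemma qdim_image:
  assumes G: "left_module R G" and F: "left_module R F" and g: "lmap R G F g"
    and fd: "qdim (kmod G) (carrier G) (arrow_span G A (carrier G)) d"
    and U: "ksub (kmod F) U" "U \<subseteq> g ` carrier G" and W: "ksub (kmod F) W" "W \<subseteq> U"
    and top: "arrow_span F A (g ` carrier G) \<inter> U \<subseteq> W"
  shows "\<exists>n. qdim (kmod F) U W n"
proof -
  interpret G: left_module R G by fact
  interpret F: left_module R F by fact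
  interpret kG: kspace "kmod G" by (rule kspace_kmod[OF G])
  note gD = lmapD[OF g]
  have pre: "ksub (kmod G) {y \<in> carrier G. g y \<in> S}" if "ksub (kmod F) S" for S
    using ksubD[OF that] gD additive_zero[OF G.abelian_group_axioms F.abelian_group_axioms, of g]
    by (auto simp: ksub_def G.lsmult_closed)
  have "\<exists>n. qdim (kmod G) {y \<in> carrier G. g y \<in> U} {y \<in> carrier G. g y \<in> W} n"
  proof (rule qdim_subquotient[OF kspace_kmod[OF G] _ fd pre[OF U(1)] pre[OF W(1)]])
    show "ksub (kmod G) (carrier G)" using kG.ksub_carrier by simp
    show "{y \<in> carrier G. g y \<in> U} \<inter> arrow_span G A (carrier G) \<subseteq> {y \<in> carrier G. g y \<in> W}"
    proof
      fix y assume y: "y \<in> {y \<in> carrier G. g y \<in> U} \<inter> arrow_span G A (carrier G)"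
      then obtain f where f: "y = comb G A f" "\<And>a. f a \<in> carrier G" by (auto simp: arrow_span_def)
      have "g y = comb F A (\<lambda>a. g (f a))" using lmap_comb[OF G F g subset_refl, of f] f by simp
      then have "g y \<in> arrow_span F A (g ` carrier G)" using f unfolding arrow_span_def by blast
      then show "y \<in> {y \<in> carrier G. g y \<in> W}" using y top by auto
    qed
  qed (use W in auto)
  then obtain n where n: "qdim (kmod G) {y \<in> carrier G. g y \<in> U} {y \<in> carrier G. g y \<in> W} n" by blast
  have "qdim (kmod F) U W n"
    by (rule qdim_transfer[OF kspace_kmod[OF G] kspace_kmod[OF F] pre[OF U(1)] U(1), where R = "\<lambda>y x. x = g y", OF _ _ _ _ _ W(2) n])
      (use U(2) gD in auto)
  then show ?thesis by blast
qed

end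

section \<open>Quotients of vector spaces as modules\<close>

lemma kspace_subspace:
  assumes "kspace V" "ksub V U" shows "kspace (V\<lparr>carrier := U\<rparr>)"
proof -
  interpret V: kspace V by fact
  note UD = ksubD[OF assms(2)]
  show ?thesis
  proof (intro kspace.intro kspace_axioms.intro abelian_groupI)
    show "\<exists>y\<in>carrier (V\<lparr>carrier := U\<rparr>). y \<oplus>\<^bsub>V\<lparr>carrier := U\<rparr>\<^esub> x = \<zero>\<^bsub>V\<lparr>carrier := U\<rparr>\<^esub>"
      if "x \<in> carrier (V\<lparr>carrier := U\<rparr>)" for x
      using that UD V.l_neg[of x] V.ksm_minus[of x] UD(4)[of x "-1"] by (intro bexI[of _ "(-1) \<odot>\<^bsub>V\<^esub> x"]) auto
  qed (use UD in \<open>auto simp: V.a_ac V.ksm_l_distr V.ksm_r_distr V.ksm_assoc\<close>)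
qed

lemma quot_module_rules:
  assumes V: "abelian_group V" and W: "subgroup W (add_monoid V)"
  shows "carrier (quot_module V W) = (\<lambda>x. W +>\<^bsub>V\<^esub> x) ` carrier V"
    and "\<zero>\<^bsub>quot_module V W\<^esub> = W +>\<^bsub>V\<^esub> \<zero>\<^bsub>V\<^esub>"
    and "\<lbrakk>x \<in> carrier V; y \<in> carrier V\<rbrakk> \<Longrightarrow>
      (W +>\<^bsub>V\<^esub> x) \<oplus>\<^bsub>quot_module V W\<^esub> (W +>\<^bsub>V\<^esub> y) = W +>\<^bsub>V\<^esub> (x \<oplus>\<^bsub>V\<^esub> y)"
    and "\<lbrakk>x \<in> carrier V; y \<in> carrier V\<rbrakk> \<Longrightarrow> W +>\<^bsub>V\<^esub> x = W +>\<^bsub>V\<^esub> y \<longleftrightarrow> x \<ominus>\<^bsub>V\<^esub> y \<in> W"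
    and "\<lbrakk>\<And>x. x \<in> carrier V \<Longrightarrow> c \<odot>\<^bsub>V\<^esub> x \<in> carrier V;
        \<And>x y. \<lbrakk>x \<in> carrier V; y \<in> carrier V\<rbrakk> \<Longrightarrow> c \<odot>\<^bsub>V\<^esub> (x \<oplus>\<^bsub>V\<^esub> y) = c \<odot>\<^bsub>V\<^esub> x \<oplus>\<^bsub>V\<^esub> c \<odot>\<^bsub>V\<^esub> y;
        \<And>w. w \<in> W \<Longrightarrow> c \<odot>\<^bsub>V\<^esub> w \<in> W; x \<in> carrier V\<rbrakk> \<Longrightarrow>
      c \<odot>\<^bsub>quot_module V W\<^esub> (W +>\<^bsub>V\<^esub> x) = W +>\<^bsub>V\<^esub> (c \<odot>\<^bsub>V\<^esub> x)"
proof -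
  interpret V: abelian_group V by fact
  interpret abelian_subgroup W V
    by (rule abelian_subgroupI3[OF additive_subgroup.intro[OF W] V])
  have WV: "W \<subseteq> carrier V" by (rule a_subset)
  show "carrier (quot_module V W) = (\<lambda>x. W +>\<^bsub>V\<^esub> x) ` carrier V"
    by (auto simp: quot_module_def A_RCOSETS_def')
  show "\<zero>\<^bsub>quot_module V W\<^esub> = W +>\<^bsub>V\<^esub> \<zero>\<^bsub>V\<^esub>"
    using V.a_coset_add_zero[OF WV] by (simp add: quot_module_def)
  show "(W +>\<^bsub>V\<^esub> x) \<oplus>\<^bsub>quot_module V W\<^esub> (W +>\<^bsub>V\<^esub> y) = W +>\<^bsub>V\<^esub> (x \<oplus>\<^bsub>V\<^esub> y)"
    if "x \<in> carrier V" "y \<in> carrier V"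
    using a_rcos_sum[OF that] by (simp add: quot_module_def)
  have eq: "W +>\<^bsub>V\<^esub> x = W +>\<^bsub>V\<^esub> y \<longleftrightarrow> x \<ominus>\<^bsub>V\<^esub> y \<in> W" if "x \<in> carrier V" "y \<in> carrier V" for x y
  proof -
    have e: "x = (x \<ominus>\<^bsub>V\<^esub> y) \<oplus>\<^bsub>V\<^esub> y" using that by (simp add: V.minus_eq V.a_assoc V.l_neg)
    have "W +>\<^bsub>V\<^esub> x = W +>\<^bsub>V\<^esub> y \<longleftrightarrow> x \<in> W +>\<^bsub>V\<^esub> y"
      using V.a_repr_independence[OF _ _ W, of x y] a_rcos_self[of x] that by auto
    also have "\<dots> \<longleftrightarrow> x \<ominus>\<^bsub>V\<^esub> y \<in> W"
    proof
      assume "x \<in> W +>\<^bsub>V\<^esub> y"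
      then obtain w where w: "w \<in> W" "x = w \<oplus>\<^bsub>V\<^esub> y" by (auto simp: a_r_coset_def')
      then have "x \<ominus>\<^bsub>V\<^esub> y = w" using WV that by (auto simp: V.minus_eq V.a_assoc V.r_neg subset_iff)
      then show "x \<ominus>\<^bsub>V\<^esub> y \<in> W" using w by simp
    next
      assume "x \<ominus>\<^bsub>V\<^esub> y \<in> W"
      then show "x \<in> W +>\<^bsub>V\<^esub> y" using e unfolding a_r_coset_def' by auto
    qed
    finally show ?thesis .
  qed
  then show "W +>\<^bsub>V\<^esub> x = W +>\<^bsub>V\<^esub> y \<longleftrightarrow> x \<ominus>\<^bsub>V\<^esub> y \<in> W" if "x \<in> carrier V" "y \<in> carrier V"
    using that by blast
  assume closed: "\<And>x. x \<in> carrier V \<Longrightarrow> c \<odot>\<^bsub>V\<^esub> x \<in> carrier V"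
    and distr: "\<And>x y. \<lbrakk>x \<in> carrier V; y \<in> carrier V\<rbrakk> \<Longrightarrow> c \<odot>\<^bsub>V\<^esub> (x \<oplus>\<^bsub>V\<^esub> y) = c \<odot>\<^bsub>V\<^esub> x \<oplus>\<^bsub>V\<^esub> c \<odot>\<^bsub>V\<^esub> y"
    and stable: "\<And>w. w \<in> W \<Longrightarrow> c \<odot>\<^bsub>V\<^esub> w \<in> W" and x: "x \<in> carrier V"
  have c: "W +>\<^bsub>V\<^esub> (c \<odot>\<^bsub>V\<^esub> y) = W +>\<^bsub>V\<^esub> (c \<odot>\<^bsub>V\<^esub> x)" if y: "y \<in> W +>\<^bsub>V\<^esub> x" for y
  proof -
    obtain w where w: "w \<in> W" "y = w \<oplus>\<^bsub>V\<^esub> x" using y by (auto simp: a_r_coset_def')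
    have wV: "w \<in> carrier V" using w WV by auto
    have "c \<odot>\<^bsub>V\<^esub> y \<ominus>\<^bsub>V\<^esub> c \<odot>\<^bsub>V\<^esub> x = c \<odot>\<^bsub>V\<^esub> w"
      using wV x by (simp add: w distr closed V.minus_eq V.a_assoc V.r_neg)
    then show ?thesis using eq[of "c \<odot>\<^bsub>V\<^esub> y" "c \<odot>\<^bsub>V\<^esub> x"] stable[OF w(1)] closed wV x w by simp
  qed
  have "(\<Union>y\<in>W +>\<^bsub>V\<^esub> x. W +>\<^bsub>V\<^esub> (c \<odot>\<^bsub>V\<^esub> y)) = W +>\<^bsub>V\<^esub> (c \<odot>\<^bsub>V\<^esub> x)"
    by (rule UN_constant_eq[OF a_rcos_self[OF x]]) (rule ballI, rule c)
  then show "c \<odot>\<^bsub>quot_module V W\<^esub> (W +>\<^bsub>V\<^esub> x) = W +>\<^bsub>V\<^esub> (c \<odot>\<^bsub>V\<^esub> x)" by (simp add: quot_module_def)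
qed

text \<open>
  This translates coordinates on \<open>U / W\<close> into bases of the quotient module, in which the dimension of
  Ext is measured.
\<close>

lemma quotient_dimension:
  assumes V: "kspace V" and U: "ksub V U" and W: "ksub V W" "W \<subseteq> U" and d: "qdim V U W d"
  shows "finite_dimensional (quot_module (V\<lparr>carrier := U\<rparr>) W)" "dimension (quot_module (V\<lparr>carrier := U\<rparr>) W) = d"
proof -
  let ?V = "V\<lparr>carrier := U\<rparr>"
  let ?Q = "quot_module ?V W"
  interpret V: kspace V by fact
  interpret S: kspace ?V by (rule kspace_subspace[OF V U])
  note UD = ksubD[OF U] and WD = ksubD[OF W(1)]
  have sg: "subgroup W (add_monoid ?V)"
  proof (rule S.add.subgroupI)
    fix x assume x: "x \<in> W"
    then have xU: "x \<in> carrier ?V" using W by auto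
    show "\<ominus>\<^bsub>?V\<^esub> x \<in> W"
      using S.ksm_minus[OF xU] WD(4)[OF x, of "-1"] by simp
  qed (use W WD in auto)
  note rules = quot_module_rules[OF S.abelian_group_axioms sg]
  have cl: "W +>\<^bsub>?V\<^esub> x \<in> carrier ?Q" if "x \<in> U" for x
    using that by (simp add: rules(1))
  have ex: "\<exists>x\<in>U. X = W +>\<^bsub>?V\<^esub> x" if "X \<in> carrier ?Q" for X
    using that by (auto simp: rules(1))
  have add: "(W +>\<^bsub>?V\<^esub> x) \<oplus>\<^bsub>?Q\<^esub> (W +>\<^bsub>?V\<^esub> y) = W +>\<^bsub>?V\<^esub> (x \<oplus>\<^bsub>V\<^esub> y)" if "x \<in> U" "y \<in> U" for x y
    using rules(3)[of x y] that by simp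
  have eqI: "W +>\<^bsub>?V\<^esub> x = W +>\<^bsub>?V\<^esub> y \<longleftrightarrow> x \<ominus>\<^bsub>V\<^esub> y \<in> W" if "x \<in> U" "y \<in> U" for x y
  proof -
    have "x \<ominus>\<^bsub>?V\<^esub> y = x \<ominus>\<^bsub>V\<^esub> y"
      using S.ksm_minus[of y] V.ksm_minus[of y] that UD by (simp add: a_minus_def)
    then show ?thesis using rules(4)[of x y] that by simp
  qed
  have smult: "c \<odot>\<^bsub>?Q\<^esub> (W +>\<^bsub>?V\<^esub> x) = W +>\<^bsub>?V\<^esub> (c \<odot>\<^bsub>V\<^esub> x)" if "x \<in> U" for c x
    using rules(5)[of c x] that UD WD by (simp add: V.ksm_r_distr)
  have zero: "\<zero>\<^bsub>?Q\<^esub> = W +>\<^bsub>?V\<^esub> \<zero>\<^bsub>V\<^esub>" using rules(2) by simp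
  note qs = add smult zero
  interpret Q: kspace ?Q
  proof (intro kspace.intro kspace_axioms.intro abelian_groupI)
    show "\<zero>\<^bsub>?Q\<^esub> \<in> carrier ?Q" using cl zero UD by simp
    fix X assume X: "X \<in> carrier ?Q"
    then obtain x where x: "x \<in> U" "X = W +>\<^bsub>?V\<^esub> x" using ex by blast
    have xV: "x \<in> carrier V" using x UD by auto
    show "\<zero>\<^bsub>?Q\<^esub> \<oplus>\<^bsub>?Q\<^esub> X = X" "1 \<odot>\<^bsub>?Q\<^esub> X = X" using x xV UD qs by simp_all
    show "\<And>c. c \<odot>\<^bsub>?Q\<^esub> X \<in> carrier ?Q" using x UD qs cl by simp
    obtain m where m: "m \<in> U" "m \<oplus>\<^bsub>V\<^esub> x = \<zero>\<^bsub>V\<^esub>"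
      using UD(4)[OF x(1), of "-1"] V.ksm_minus[OF xV] V.l_neg[OF xV] by auto
    show "\<exists>Y\<in>carrier ?Q. Y \<oplus>\<^bsub>?Q\<^esub> X = \<zero>\<^bsub>?Q\<^esub>"
      using cl[OF m(1)] m x by (intro bexI[of _ "W +>\<^bsub>?V\<^esub> m"]) (simp_all add: qs)
    show "\<And>c d. (c + d) \<odot>\<^bsub>?Q\<^esub> X = c \<odot>\<^bsub>?Q\<^esub> X \<oplus>\<^bsub>?Q\<^esub> d \<odot>\<^bsub>?Q\<^esub> X"
      "\<And>c d. (c * d) \<odot>\<^bsub>?Q\<^esub> X = c \<odot>\<^bsub>?Q\<^esub> (d \<odot>\<^bsub>?Q\<^esub> X)"
      using x xV UD by (simp_all add: qs V.ksm_l_distr V.ksm_assoc)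
    fix Y assume "Y \<in> carrier ?Q"
    then obtain y where y: "y \<in> U" "Y = W +>\<^bsub>?V\<^esub> y" using ex by blast
    have yV: "y \<in> carrier V" using y UD by auto
    show "X \<oplus>\<^bsub>?Q\<^esub> Y \<in> carrier ?Q" using x y UD cl by (simp add: qs)
    show "X \<oplus>\<^bsub>?Q\<^esub> Y = Y \<oplus>\<^bsub>?Q\<^esub> X" using x y xV yV by (simp add: qs V.a_comm)
    show "\<And>c. c \<odot>\<^bsub>?Q\<^esub> (X \<oplus>\<^bsub>?Q\<^esub> Y) = c \<odot>\<^bsub>?Q\<^esub> X \<oplus>\<^bsub>?Q\<^esub> c \<odot>\<^bsub>?Q\<^esub> Y"
      using x y xV yV UD by (simp add: qs V.ksm_r_distr)
    fix Z assume "Z \<in> carrier ?Q"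
    then obtain z where z: "z \<in> U" "Z = W +>\<^bsub>?V\<^esub> z" using ex by blast
    have zV: "z \<in> carrier V" using z UD by auto
    show "X \<oplus>\<^bsub>?Q\<^esub> Y \<oplus>\<^bsub>?Q\<^esub> Z = X \<oplus>\<^bsub>?Q\<^esub> (Y \<oplus>\<^bsub>?Q\<^esub> Z)"
      using x y z xV yV zV UD by (simp add: qs V.a_assoc)
  qed
  have "qdim ?Q (carrier ?Q) {\<zero>\<^bsub>?Q\<^esub>} d"
  proof (rule qdim_transfer[OF V Q.kspace_axioms U Q.ksub_carrier, where R = "\<lambda>u X. X = W +>\<^bsub>?V\<^esub> u", OF _ _ _ _ _ _ d])
    fix u X assume u: "u \<in> U" "X = W +>\<^bsub>?V\<^esub> u"
    show "u \<in> W \<longleftrightarrow> X \<in> {\<zero>\<^bsub>?Q\<^esub>}" using eqI[of u "\<zero>\<^bsub>V\<^esub>"] u UD zero by simp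
  qed (use cl ex add smult in auto)
  then show "finite_dimensional ?Q" "dimension ?Q = d" using Q.dimension_eqI by blast+
qed

section \<open>Homomorphisms into the semisimple module\<close>

text \<open>
  The module \<open>N\<close> plays the role of \<open>\<Lambda>\<^sub>0\<close>, which as a ring is a product of copies of \<open>k\<close>, hence self-dual:
  the functional \<open>\<sigma>\<close>, the sum of all coordinates, is not a homomorphism of modules, but composing with it
  turns homomorphisms to \<open>N\<close> into arbitrary functionals that vanish on the radical.
\<close>

locale monomial_target = monomial_ring R \<iota> V A idm arr src perp coeff strip
  for R :: "('r, 'x) ring_scheme" (structure) and \<iota> :: "'k::field \<Rightarrow> 'r" and V :: "'v set" and A :: "'a set"
    and idm :: "'v \<Rightarrow> 'r" and arr :: "'a \<Rightarrow> 'r" and src :: "'a \<Rightarrow> 'v" and perp :: "'a \<Rightarrow> 'a set"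
    and coeff :: "'v \<Rightarrow> 'r \<Rightarrow> 'k" and strip :: "'a \<Rightarrow> 'r \<Rightarrow> 'r" +
  fixes N :: "('r, 'n, 'w) module_scheme" and \<sigma> :: "'n \<Rightarrow> 'k" and top :: "'v \<Rightarrow> 'n"
  assumes N: "left_module R N"
    and sigma_linear: "klinear (kmod N) (carrier N) \<sigma>"
    and top_closed [simp]: "v \<in> V \<Longrightarrow> top v \<in> carrier N"
    and arr_N: "a \<in> A \<Longrightarrow> x \<in> carrier N \<Longrightarrow> arr a \<odot>\<^bsub>N\<^esub> x = \<zero>\<^bsub>N\<^esub>"
    and idm_top: "v \<in> V \<Longrightarrow> w \<in> V \<Longrightarrow> idm v \<odot>\<^bsub>N\<^esub> top w = (if v = w then top w else \<zero>\<^bsub>N\<^esub>)"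
    and sigma_top: "v \<in> V \<Longrightarrow> \<sigma> (top v) = 1"
    and sigma_faithful: "x \<in> carrier N \<Longrightarrow> (\<And>v. v \<in> V \<Longrightarrow> \<sigma> (idm v \<odot>\<^bsub>N\<^esub> x) = 0) \<Longrightarrow> x = \<zero>\<^bsub>N\<^esub>"

lemma left_module_regular:
  assumes "ring R" shows "left_module R (regular_module R)"
proof -
  interpret ring R by fact
  show ?thesis
  proof (intro left_module.intro left_module_axioms.intro abelian_groupI assms)
    show "\<exists>y\<in>carrier (regular_module R). y \<oplus>\<^bsub>regular_module R\<^esub> x = \<zero>\<^bsub>regular_module R\<^esub>"
      if "x \<in> carrier (regular_module R)" for x
      using that by (intro bexI[of _ "\<ominus>\<^bsub>R\<^esub> x"]) (auto simp: regular_module_def l_neg)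
  qed (auto simp: regular_module_def a_ac l_distr r_distr m_assoc)
qed

context monomial_ring
begin

lemma iota_zero: "\<iota> 0 = \<zero>"
  using iota_add[of 0 0] by (metis add.r_cancel_one' add_0 iota_closed)

text \<open>
  A functional that vanishes on the radical sees only the semisimple part of the ring. This gives the
  linearity of \<open>hom_of\<close> below.
\<close>

lemma functional_idm_smult:
  assumes Y: "left_module R Y" and \<psi>: "klinear (kmod Y) (carrier Y) \<psi>"
    "\<And>x. x \<in> arrow_span Y A (carrier Y) \<Longrightarrow> \<psi> x = 0"
    and v: "v \<in> V" and r: "r \<in> carrier R" and x: "x \<in> carrier Y"
  shows "\<psi> (idm v \<odot>\<^bsub>Y\<^esub> (r \<odot>\<^bsub>Y\<^esub> x)) = coeff v r * \<psi> (idm v \<odot>\<^bsub>Y\<^esub> x)"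
proof -
  interpret Y: left_module R Y by fact
  define s where "s = idm v \<otimes> r"
  have s: "s \<in> carrier R" using v r by (simp add: s_def)
  have "(\<Oplus>w\<in>V. \<iota> (coeff w s) \<otimes> idm w) = (\<Oplus>w\<in>V. if v = w then \<iota> (coeff w r) \<otimes> idm w else \<zero>)"
    using v r by (intro finsum_cong') (auto simp: s_def coeff_idm_mult iota_zero)
  also have "\<dots> = \<iota> (coeff v r) \<otimes> idm v"
    using v finite_V by (intro finsum_singleton) auto
  finally have s': "s = \<iota> (coeff v r) \<otimes> idm v \<oplus> (\<Oplus>a\<in>A. arr a \<otimes> strip a s)"
    using decomposition[OF s] by simp
  have "idm v \<odot>\<^bsub>Y\<^esub> (r \<odot>\<^bsub>Y\<^esub> x) = s \<odot>\<^bsub>Y\<^esub> x" using v r x by (simp add: s_def Y.lsmult_assoc)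
  also have "\<dots> = (\<iota> (coeff v r) \<otimes> idm v) \<odot>\<^bsub>Y\<^esub> x \<oplus>\<^bsub>Y\<^esub> (\<Oplus>a\<in>A. arr a \<otimes> strip a s) \<odot>\<^bsub>Y\<^esub> x"
    using v x s by (subst s', intro Y.lsmult_l_distr) (auto intro!: finsum_closed)
  also have "(\<Oplus>a\<in>A. arr a \<otimes> strip a s) \<odot>\<^bsub>Y\<^esub> x = (\<Oplus>\<^bsub>Y\<^esub>a\<in>A. (arr a \<otimes> strip a s) \<odot>\<^bsub>Y\<^esub> x)"
    using s x finite_A by (intro Y.finsum_lsmult) auto
  also have "\<dots> = comb Y A (\<lambda>a. strip a s \<odot>\<^bsub>Y\<^esub> x)"
    unfolding comb_def using s x by (intro Y.M.finsum_cong') (auto simp: Y.lsmult_assoc Y.lsmult_closed)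
  finally have e: "idm v \<odot>\<^bsub>Y\<^esub> (r \<odot>\<^bsub>Y\<^esub> x) = \<iota> (coeff v r) \<odot>\<^bsub>Y\<^esub> (idm v \<odot>\<^bsub>Y\<^esub> x) \<oplus>\<^bsub>Y\<^esub> comb Y A (\<lambda>a. strip a s \<odot>\<^bsub>Y\<^esub> x)"
    using v x by (simp add: Y.lsmult_assoc)
  have c: "comb Y A (\<lambda>a. strip a s \<odot>\<^bsub>Y\<^esub> x) \<in> arrow_span Y A (carrier Y)"
    using s x by (intro arrow_spanI Y) (auto intro: Y.lsmult_closed)
  have cY: "comb Y A (\<lambda>a. strip a s \<odot>\<^bsub>Y\<^esub> x) \<in> carrier Y"
    using s x by (intro comb_closed Y) (auto intro: Y.lsmult_closed)
  show ?thesis unfolding e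
    using klinearD[OF \<psi>(1)] \<psi>(2)[OF c] cY v x by (simp add: Y.lsmult_closed)
qed

lemma sum_idm_smult:
  assumes "left_module R Y" "x \<in> carrier Y"
  shows "(\<Oplus>\<^bsub>Y\<^esub>v\<in>V. idm v \<odot>\<^bsub>Y\<^esub> x) = x"
proof -
  interpret Y: left_module R Y by fact
  show ?thesis using Y.finsum_lsmult[OF finite_V assms(2), of idm] sum_idm Y.lsmult_one[OF assms(2)] by simp
qed

lemma iota_minus_one:
  assumes "left_module R Y" "x \<in> carrier Y"
  shows "\<iota> (-1) \<odot>\<^bsub>Y\<^esub> x = \<ominus>\<^bsub>Y\<^esub> x"
proof -
  interpret Y: left_module R Y by fact
  interpret kY: kspace "kmod Y" by (rule kspace_kmod[OF assms(1)])
  have "\<iota> (-1) \<odot>\<^bsub>Y\<^esub> x \<oplus>\<^bsub>Y\<^esub> x = \<zero>\<^bsub>Y\<^esub>"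
    using kY.ksm_l_distr[of x "-1" 1] kY.ksm_one[of x] kY.ksm_zero[of x] assms(2) by simp
  then show ?thesis using assms(2) Y.lsmult_closed[of "\<iota> (-1)" x] by (simp add: Y.M.minus_equality)
qed

lemma submod_subgroup:
  assumes "left_module R Y" "submod R Y X"
  shows "subgroup X (add_monoid Y)"
proof -
  interpret Y: left_module R Y by fact
  note XD = submodD[OF assms(2)]
  show ?thesis
  proof (rule Y.M.add.subgroupI)
    show "\<ominus>\<^bsub>Y\<^esub> x \<in> X" if "x \<in> X" for x
      using iota_minus_one[OF assms(1), of x] XD that by (metis iota_closed)
  qed (use XD in auto)
qed

lemma left_module_quotient:
  assumes Y: "left_module R Y" and X: "submod R Y X"
  shows "left_module R (quot_module Y X)"
proof -
  interpret Y: left_module R Y by fact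
  let ?Q = "quot_module Y X"
  note rules = quot_module_rules[OF Y.abelian_group_axioms submod_subgroup[OF Y X]]
  have smult: "a \<odot>\<^bsub>?Q\<^esub> (X +>\<^bsub>Y\<^esub> x) = X +>\<^bsub>Y\<^esub> (a \<odot>\<^bsub>Y\<^esub> x)" if "a \<in> carrier R" "x \<in> carrier Y" for a x
    using that submodD(4)[OF X] by (intro rules(5)) (auto simp: Y.lsmult_closed Y.lsmult_r_distr)
  note simps = rules(2,3) smult Y.lsmult_closed Y.M.a_ac Y.lsmult_l_distr Y.lsmult_r_distr Y.lsmult_assoc Y.lsmult_one
  have el: "\<exists>x\<in>carrier Y. Z = X +>\<^bsub>Y\<^esub> x" if "Z \<in> carrier ?Q" for Z using that rules(1) by auto
  have cl: "X +>\<^bsub>Y\<^esub> x \<in> carrier ?Q" if "x \<in> carrier Y" for x using that rules(1) by auto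
  show ?thesis
  proof (intro left_module.intro left_module_axioms.intro abelian_groupI ring_axioms)
    show "\<zero>\<^bsub>?Q\<^esub> \<in> carrier ?Q" using cl by (simp add: rules(2))
    fix Z assume "Z \<in> carrier ?Q"
    then obtain z where z: "z \<in> carrier Y" "Z = X +>\<^bsub>Y\<^esub> z" using el by blast
    show "\<zero>\<^bsub>?Q\<^esub> \<oplus>\<^bsub>?Q\<^esub> Z = Z" "\<one> \<odot>\<^bsub>?Q\<^esub> Z = Z" using z by (simp_all add: simps)
    show "\<exists>W\<in>carrier ?Q. W \<oplus>\<^bsub>?Q\<^esub> Z = \<zero>\<^bsub>?Q\<^esub>"
      using cl[of "\<ominus>\<^bsub>Y\<^esub> z"] z by (intro bexI[of _ "X +>\<^bsub>Y\<^esub> (\<ominus>\<^bsub>Y\<^esub> z)"]) (simp_all add: rules(2,3) Y.M.l_neg)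
    show "\<And>W. W \<in> carrier ?Q \<Longrightarrow> Z \<oplus>\<^bsub>?Q\<^esub> W \<in> carrier ?Q" using z cl by (auto dest!: el simp: simps)
    show "\<And>W. W \<in> carrier ?Q \<Longrightarrow> Z \<oplus>\<^bsub>?Q\<^esub> W = W \<oplus>\<^bsub>?Q\<^esub> Z" using z by (auto dest!: el simp: simps)
    show "\<And>W W'. W \<in> carrier ?Q \<Longrightarrow> W' \<in> carrier ?Q \<Longrightarrow> Z \<oplus>\<^bsub>?Q\<^esub> W \<oplus>\<^bsub>?Q\<^esub> W' = Z \<oplus>\<^bsub>?Q\<^esub> (W \<oplus>\<^bsub>?Q\<^esub> W')"
      using z by (auto dest!: el simp: simps)
    fix a assume a: "a \<in> carrier R"
    show "a \<odot>\<^bsub>?Q\<^esub> Z \<in> carrier ?Q" using a z cl by (simp add: simps)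
    show "\<And>W. W \<in> carrier ?Q \<Longrightarrow> a \<odot>\<^bsub>?Q\<^esub> (Z \<oplus>\<^bsub>?Q\<^esub> W) = a \<odot>\<^bsub>?Q\<^esub> Z \<oplus>\<^bsub>?Q\<^esub> a \<odot>\<^bsub>?Q\<^esub> W"
      using a z by (auto dest!: el simp: simps)
    fix b assume b: "b \<in> carrier R"
    show "(a \<oplus> b) \<odot>\<^bsub>?Q\<^esub> Z = a \<odot>\<^bsub>?Q\<^esub> Z \<oplus>\<^bsub>?Q\<^esub> b \<odot>\<^bsub>?Q\<^esub> Z"
      "(a \<otimes> b) \<odot>\<^bsub>?Q\<^esub> Z = a \<odot>\<^bsub>?Q\<^esub> (b \<odot>\<^bsub>?Q\<^esub> Z)" using a b z by (simp_all add: simps)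
  qed
qed

lemma functional_finsum:
  assumes Y: "left_module R Y" and \<psi>: "klinear (kmod Y) (carrier Y) \<psi>"
    and S: "finite S" "\<And>i. i \<in> S \<Longrightarrow> f i \<in> carrier Y"
  shows "\<psi> (\<Oplus>\<^bsub>Y\<^esub>i\<in>S. f i) = (\<Sum>i\<in>S. \<psi> (f i))"
proof -
  interpret Y: left_module R Y by fact
  interpret kY: kspace "kmod Y" by (rule kspace_kmod[OF Y])
  show ?thesis using S
  proof (induction S rule: finite_induct)
    case empty
    then show ?case using kY.klinear_zero[OF \<psi>] kY.ksub_carrier by simp
  next
    case (insert x S)
    then have "f \<in> S \<rightarrow> carrier Y" by auto
    then show ?case using insert klinearD(1)[OF \<psi>, of "f x" "finsum Y f S"] by (simp add: Y.M.finsum_insert)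
  qed
qed

lemma klinear_comp:
  assumes "lmap R M N p" "klinear (kmod N) U \<psi>" "\<And>x. x \<in> carrier M \<Longrightarrow> p x \<in> U"
  shows "klinear (kmod M) (carrier M) (\<lambda>x. \<psi> (p x))"
  using assms lmapD[OF assms(1)] by (auto simp: klinear_def)

end

context monomial_target
begin

interpretation N: left_module R N by (rule N)
interpretation kN: kspace "kmod N" by (rule kspace_kmod[OF N])

lemmas sigma_simps = klinearD[OF sigma_linear, unfolded kmod_simps]

lemma sigma_zero: "\<sigma> \<zero>\<^bsub>N\<^esub> = 0"
  using kN.klinear_zero[OF sigma_linear] kN.ksub_carrier by simp

lemma comb_N: "B \<subseteq> A \<Longrightarrow> (\<And>b. b \<in> B \<Longrightarrow> f b \<in> carrier N) \<Longrightarrow> comb N B f = \<zero>\<^bsub>N\<^esub>"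
  by (intro comb_zero N arr_N) auto

lemma N_eqI:
  assumes "x \<in> carrier N" "y \<in> carrier N" "\<And>v. v \<in> V \<Longrightarrow> \<sigma> (idm v \<odot>\<^bsub>N\<^esub> x) = \<sigma> (idm v \<odot>\<^bsub>N\<^esub> y)"
  shows "x = y"
proof -
  let ?m = "\<iota> (-1) \<odot>\<^bsub>N\<^esub> y"
  have m: "?m \<in> carrier N" using assms by (simp add: N.lsmult_closed)
  have my: "?m = \<ominus>\<^bsub>N\<^esub> y" by (rule iota_minus_one[OF N assms(2)])
  have "x \<oplus>\<^bsub>N\<^esub> ?m = \<zero>\<^bsub>N\<^esub>"
    using assms m iota_commute[OF N idm_closed assms(2)]
    by (intro sigma_faithful) (simp_all add: N.lsmult_r_distr sigma_simps N.lsmult_closed)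
  then show ?thesis using assms m my by (metis N.M.add.inv_solve_right' N.M.l_zero N.M.zero_closed)
qed

text \<open>
  The homomorphism that corresponds to \<open>\<psi>\<close>: its coordinate at \<open>v\<close> is \<open>\<psi>\<close> on the component \<open>idm v \<odot> x\<close>.
\<close>

definition hom_of :: "('r, 'm, 'y) module_scheme \<Rightarrow> ('m \<Rightarrow> 'k) \<Rightarrow> 'm \<Rightarrow> 'n" where
  "hom_of Y \<psi> = (\<lambda>x\<in>carrier Y. \<Oplus>\<^bsub>N\<^esub>v\<in>V. \<iota> (\<psi> (idm v \<odot>\<^bsub>Y\<^esub> x)) \<odot>\<^bsub>N\<^esub> top v)"

lemma hom_of_closed: "x \<in> carrier Y \<Longrightarrow> hom_of Y \<psi> x \<in> carrier N"
  unfolding hom_of_def by (auto intro!: N.M.finsum_closed N.lsmult_closed)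

lemma idm_hom_of:
  assumes "x \<in> carrier Y" "v \<in> V"
  shows "\<sigma> (idm v \<odot>\<^bsub>N\<^esub> hom_of Y \<psi> x) = \<psi> (idm v \<odot>\<^bsub>Y\<^esub> x)"
proof -
  let ?t = "\<lambda>w. \<iota> (\<psi> (idm w \<odot>\<^bsub>Y\<^esub> x)) \<odot>\<^bsub>N\<^esub> top w"
  have t: "?t w \<in> carrier N" if "w \<in> V" for w using that by (simp add: N.lsmult_closed)
  have "idm v \<odot>\<^bsub>N\<^esub> hom_of Y \<psi> x = (\<Oplus>\<^bsub>N\<^esub>w\<in>V. idm v \<odot>\<^bsub>N\<^esub> ?t w)"
    using assms t finite_V by (simp add: hom_of_def N.lsmult_finsum)
  also have "\<dots> = (\<Oplus>\<^bsub>N\<^esub>w\<in>V. if v = w then ?t w else \<zero>\<^bsub>N\<^esub>)"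
    using assms(2) t by (intro N.M.finsum_cong') (auto simp: iota_commute[OF N] idm_top N.lsmult_zero_right)
  also have "\<dots> = ?t v" using assms(2) t finite_V by (intro N.M.finsum_singleton) auto
  finally show ?thesis using assms(2) by (simp add: sigma_simps sigma_top)
qed

lemma hom_of_in_hom:
  assumes Y: "left_module R Y" and \<psi>: "klinear (kmod Y) (carrier Y) \<psi>"
    "\<And>x. x \<in> arrow_span Y A (carrier Y) \<Longrightarrow> \<psi> x = 0"
  shows "hom_of Y \<psi> \<in> lmod_hom R Y N"
proof -
  interpret Y: left_module R Y by fact
  note lin = klinearD[OF \<psi>(1), unfolded kmod_simps]
  have "hom_of Y \<psi> (x \<oplus>\<^bsub>Y\<^esub> y) = hom_of Y \<psi> x \<oplus>\<^bsub>N\<^esub> hom_of Y \<psi> y" if "x \<in> carrier Y" "y \<in> carrier Y" for x y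
    using that by (intro N_eqI) (auto simp: hom_of_closed idm_hom_of N.lsmult_r_distr Y.lsmult_r_distr sigma_simps lin N.lsmult_closed Y.lsmult_closed)
  moreover have "hom_of Y \<psi> (r \<odot>\<^bsub>Y\<^esub> x) = r \<odot>\<^bsub>N\<^esub> hom_of Y \<psi> x" if r: "r \<in> carrier R" and x: "x \<in> carrier Y" for r x
  proof (rule N_eqI)
    fix v assume v: "v \<in> V"
    (* Compare the coordinates of both sides: r acts on each of them through coeff. *)
    have "\<sigma> z = 0" if "z \<in> arrow_span N A (carrier N)" for z
      using that comb_N[OF subset_refl] sigma_zero by (auto simp: arrow_span_def)
    then have "\<sigma> (idm v \<odot>\<^bsub>N\<^esub> (r \<odot>\<^bsub>N\<^esub> hom_of Y \<psi> x)) = coeff v r * \<sigma> (idm v \<odot>\<^bsub>N\<^esub> hom_of Y \<psi> x)"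
      using functional_idm_smult[OF N sigma_linear _ v r hom_of_closed[OF x]] by blast
    also have "\<dots> = \<psi> (idm v \<odot>\<^bsub>Y\<^esub> (r \<odot>\<^bsub>Y\<^esub> x))"
      using functional_idm_smult[OF Y \<psi> v r x] idm_hom_of[OF x v] by simp
    also have "\<dots> = \<sigma> (idm v \<odot>\<^bsub>N\<^esub> hom_of Y \<psi> (r \<odot>\<^bsub>Y\<^esub> x))"
      using idm_hom_of[of "r \<odot>\<^bsub>Y\<^esub> x" Y v] r x v by (simp add: Y.lsmult_closed)
    finally show "\<sigma> (idm v \<odot>\<^bsub>N\<^esub> hom_of Y \<psi> (r \<odot>\<^bsub>Y\<^esub> x)) = \<sigma> (idm v \<odot>\<^bsub>N\<^esub> (r \<odot>\<^bsub>N\<^esub> hom_of Y \<psi> x))" by simp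
  qed (use r x in \<open>auto intro!: hom_of_closed Y.lsmult_closed N.lsmult_closed\<close>)
  moreover have "hom_of Y \<psi> \<in> extensional (carrier Y)" by (simp add: hom_of_def)
  ultimately show ?thesis unfolding lmod_hom_iff lmap_def by (simp add: hom_of_closed)
qed

lemma sigma_hom_of:
  assumes Y: "left_module R Y" and \<psi>: "klinear (kmod Y) (carrier Y) \<psi>" and x: "x \<in> carrier Y"
  shows "\<sigma> (hom_of Y \<psi> x) = \<psi> x"
proof -
  interpret Y: left_module R Y by fact
  interpret kY: kspace "kmod Y" by (rule kspace_kmod[OF Y])
  let ?t = "\<lambda>w. \<iota> (\<psi> (idm w \<odot>\<^bsub>Y\<^esub> x)) \<odot>\<^bsub>N\<^esub> top w"
  have "\<sigma> (hom_of Y \<psi> x) = (\<Sum>v\<in>V. \<sigma> (?t v))"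
    using functional_finsum[OF N sigma_linear finite_V, of ?t] x
    by (simp add: hom_of_def N.lsmult_closed)
  also have "\<dots> = (\<Sum>v\<in>V. \<psi> (idm v \<odot>\<^bsub>Y\<^esub> x))"
    by (intro sum.cong) (auto simp: sigma_simps sigma_top)
  also have "\<dots> = \<psi> (\<Oplus>\<^bsub>Y\<^esub>v\<in>V. idm v \<odot>\<^bsub>Y\<^esub> x)"
    using functional_finsum[OF Y \<psi> finite_V, of "\<lambda>v. idm v \<odot>\<^bsub>Y\<^esub> x"] x
    by (simp add: Y.lsmult_closed)
  finally show ?thesis using sum_idm_smult[OF Y x] by simp
qed

lemma hom_eqI:
  assumes f: "f \<in> lmod_hom R Y N" and g: "g \<in> lmod_hom R Y N" and Y: "left_module R Y"
    and eq: "\<And>x. x \<in> carrier Y \<Longrightarrow> \<sigma> (f x) = \<sigma> (g x)"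
  shows "f = g"
proof (rule extensionalityI[of f "carrier Y"])
  interpret Y: left_module R Y by fact
  fix x assume x: "x \<in> carrier Y"
  have fl: "lmap R Y N f" "lmap R Y N g" using f g by (auto simp: lmod_hom_iff)
  show "f x = g x"
    using lmapD[OF fl(1)] lmapD[OF fl(2)] x eq
    by (intro N_eqI) (auto simp flip: lmapD(3)[OF fl(1)] lmapD(3)[OF fl(2)] simp: Y.lsmult_closed)
qed (use f g in \<open>auto simp: lmod_hom_iff\<close>)

lemma kspace_hom_space:
  assumes Y: "left_module R Y"
  shows "kspace (hom_space \<iota> R Y N)"
proof -
  interpret Y: left_module R Y by fact
  let ?H = "hom_space \<iota> R Y N"
  have car: "f \<in> carrier ?H \<longleftrightarrow> lmap R Y N f \<and> f \<in> extensional (carrier Y)" for f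
    by (simp add: hom_space_def lmod_hom_iff)
  have ops: "f \<oplus>\<^bsub>?H\<^esub> g = (\<lambda>x\<in>carrier Y. f x \<oplus>\<^bsub>N\<^esub> g x)" "c \<odot>\<^bsub>?H\<^esub> f = (\<lambda>x\<in>carrier Y. \<iota> c \<odot>\<^bsub>N\<^esub> f x)"
    "\<zero>\<^bsub>?H\<^esub> = (\<lambda>x\<in>carrier Y. \<zero>\<^bsub>N\<^esub>)" for f g c by (auto simp: hom_space_def)
  have addc: "f \<oplus>\<^bsub>?H\<^esub> g \<in> carrier ?H" if "f \<in> carrier ?H" "g \<in> carrier ?H" for f g
    using that unfolding car ops lmap_def
    by (auto simp: N.lsmult_r_distr N.lsmult_closed Y.lsmult_closed N.M.a_ac)
  have smc: "c \<odot>\<^bsub>?H\<^esub> f \<in> carrier ?H" if "f \<in> carrier ?H" for f c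
    using that unfolding car ops lmap_def
    by (auto simp: N.lsmult_r_distr N.lsmult_closed Y.lsmult_closed iota_commute[OF N])
  have zc: "\<zero>\<^bsub>?H\<^esub> \<in> carrier ?H"
    unfolding car ops lmap_def by (auto simp: N.lsmult_zero_right Y.lsmult_closed)
  have ext: "f = g" if "f \<in> carrier ?H" "g \<in> carrier ?H" "\<And>x. x \<in> carrier Y \<Longrightarrow> f x = g x" for f g
    using that extensionalityI[of f "carrier Y" g] car by blast
  have fc: "f x \<in> carrier N" if "f \<in> carrier ?H" "x \<in> carrier Y" for f x
    using that lmapD(1)[of R Y N f x] unfolding car by blast
  show ?thesis
  proof (intro kspace.intro kspace_axioms.intro abelian_groupI)
    show "\<zero>\<^bsub>?H\<^esub> \<in> carrier ?H" by (rule zc)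
    fix f assume f: "f \<in> carrier ?H"
    show "\<exists>g\<in>carrier ?H. g \<oplus>\<^bsub>?H\<^esub> f = \<zero>\<^bsub>?H\<^esub>"
    proof (rule bexI[OF _ smc[OF f, of "-1"]], rule ext)
      fix x assume x: "x \<in> carrier Y"
      have "\<iota> (-1) \<odot>\<^bsub>N\<^esub> f x = \<ominus>\<^bsub>N\<^esub> f x" by (rule iota_minus_one[OF N fc[OF f x]])
      then show "((-1) \<odot>\<^bsub>?H\<^esub> f \<oplus>\<^bsub>?H\<^esub> f) x = \<zero>\<^bsub>?H\<^esub> x"
        using x fc[OF f x] by (simp add: ops N.M.l_neg)
    qed (use addc smc zc f in auto)
    note simps = ops fc N.lsmult_closed N.M.a_ac N.lsmult_l_distr N.lsmult_r_distr N.lsmult_assoc N.lsmult_one iota_add iota_mult iota_one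
    show "\<And>c. c \<odot>\<^bsub>?H\<^esub> f \<in> carrier ?H" using smc[OF f] by auto
    show "\<zero>\<^bsub>?H\<^esub> \<oplus>\<^bsub>?H\<^esub> f = f" "1 \<odot>\<^bsub>?H\<^esub> f = f"
      by (rule ext, simp_all only: addc smc zc f, simp add: simps f)+
    show "\<And>c d. (c + d) \<odot>\<^bsub>?H\<^esub> f = c \<odot>\<^bsub>?H\<^esub> f \<oplus>\<^bsub>?H\<^esub> d \<odot>\<^bsub>?H\<^esub> f"
      "\<And>c d. (c * d) \<odot>\<^bsub>?H\<^esub> f = c \<odot>\<^bsub>?H\<^esub> (d \<odot>\<^bsub>?H\<^esub> f)"
      by (rule ext, simp_all only: addc smc zc f, simp add: simps f)+
    fix g assume g: "g \<in> carrier ?H"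
    show "f \<oplus>\<^bsub>?H\<^esub> g \<in> carrier ?H" using addc f g by blast
    show "f \<oplus>\<^bsub>?H\<^esub> g = g \<oplus>\<^bsub>?H\<^esub> f" 
      "\<And>c. c \<odot>\<^bsub>?H\<^esub> (f \<oplus>\<^bsub>?H\<^esub> g) = c \<odot>\<^bsub>?H\<^esub> f \<oplus>\<^bsub>?H\<^esub> c \<odot>\<^bsub>?H\<^esub> g"
      by (rule ext, simp_all only: addc smc zc f g, simp add: simps f g)+
    fix h assume h: "h \<in> carrier ?H"
    show "f \<oplus>\<^bsub>?H\<^esub> g \<oplus>\<^bsub>?H\<^esub> h = f \<oplus>\<^bsub>?H\<^esub> (g \<oplus>\<^bsub>?H\<^esub> h)"
      by (rule ext, simp_all only: addc smc zc f g h, simp add: simps f g h)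
  qed
qed

text \<open>
  Cocycles on \<open>F\<close> are functionals on the image of the differential.
\<close>

lemma descend_functional:
  assumes F: "left_module R F" and Y: "left_module R Y" and p: "lmap R F Y p" "p ` carrier F = X"
    and f: "lmap R F N f" and ker: "\<And>y. y \<in> carrier F \<Longrightarrow> p y = \<zero>\<^bsub>Y\<^esub> \<Longrightarrow> f y = \<zero>\<^bsub>N\<^esub>"
  obtains \<psi> where "\<And>z. z \<in> carrier F \<Longrightarrow> \<psi> (p z) = \<sigma> (f z)" "klinear (kmod Y) X \<psi>"
proof -
  interpret F: left_module R F by fact
  interpret Y: left_module R Y by fact
  note pD = lmapD[OF p(1)] and fD = lmapD[OF f]
  define \<psi> where "\<psi> x = \<sigma> (f (SOME z. z \<in> carrier F \<and> p z = x))" for x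
  have \<psi>: "\<psi> (p z) = \<sigma> (f z)" if z: "z \<in> carrier F" for z
  proof -
    let ?w = "SOME w. w \<in> carrier F \<and> p w = p z"
    have w: "?w \<in> carrier F" "p ?w = p z" using someI[of "\<lambda>w. w \<in> carrier F \<and> p w = p z" z] z by auto
    have "p (?w \<ominus>\<^bsub>F\<^esub> z) = \<zero>\<^bsub>Y\<^esub>"
      using lmap_minus[OF F Y p(1) w(1) z] w(2) pD(1)[OF z] by (simp add: Y.M.minus_eq Y.M.r_neg)
    then have "f (?w \<ominus>\<^bsub>F\<^esub> z) = \<zero>\<^bsub>N\<^esub>" using ker w z by simp
    moreover have "?w = (?w \<ominus>\<^bsub>F\<^esub> z) \<oplus>\<^bsub>F\<^esub> z" using w z by (simp add: F.M.minus_eq F.M.a_assoc F.M.l_neg)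
    ultimately have "f ?w = f z" using fD(1)[OF z] fD(2)[of "?w \<ominus>\<^bsub>F\<^esub> z" z] w z by simp
    then show ?thesis by (simp add: \<psi>_def)
  qed
  have "klinear (kmod Y) X \<psi>"
    unfolding klinear_def kmod_simps
  proof (intro conjI ballI allI)
    fix u c assume "u \<in> X"
    then obtain z where z: "z \<in> carrier F" "u = p z" using p(2) by blast
    show "\<psi> (\<iota> c \<odot>\<^bsub>Y\<^esub> u) = c * \<psi> u"
      using \<psi>[of "\<iota> c \<odot>\<^bsub>F\<^esub> z"] \<psi>[OF z(1)] z pD(3) fD by (simp add: F.lsmult_closed sigma_simps)
    fix v assume "v \<in> X"
    then obtain w where w: "w \<in> carrier F" "v = p w" using p(2) by blast
    show "\<psi> (u \<oplus>\<^bsub>Y\<^esub> v) = \<psi> u + \<psi> v"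
      using \<psi>[of "z \<oplus>\<^bsub>F\<^esub> w"] \<psi>[OF z(1)] \<psi>[OF w(1)] z w pD(2) fD by (simp add: sigma_simps)
  qed
  then show ?thesis using \<psi> that by blast
qed

text \<open>
  Cocycles \<open>Z\<close> are the functionals on \<open>X\<close> that vanish on the radical of \<open>X\<close>, and coboundaries are those
  that vanish on \<open>U\<close> in addition. Evaluation at preimages \<open>y i\<close> of a basis of \<open>U\<close> modulo the radical of
  \<open>X\<close> is then a coordinate map on the quotient; it is onto because functionals extend from \<open>U\<close> to the
  whole of \<open>Y\<close>.
\<close>

lemma cohomology_dimension:
  assumes F: "left_module R F" and Y: "left_module R Y" and X: "submod R Y X"
    and p: "lmap R F Y p" "p ` carrier F = X"
    and Z: "Z = {f \<in> lmod_hom R F N. \<forall>y\<in>carrier F. p y = \<zero>\<^bsub>Y\<^esub> \<longrightarrow> f y = \<zero>\<^bsub>N\<^esub>}"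
    and U: "ksub (kmod Y) U" "U \<subseteq> X"
    and Bd: "Bd \<subseteq> Z" "\<And>f. f \<in> Z \<Longrightarrow> f \<in> Bd \<longleftrightarrow> (\<forall>y\<in>carrier F. p y \<in> U \<longrightarrow> \<sigma> (f y) = 0)"
    and d: "qdim (kmod Y) U (arrow_span Y A X) d"
  shows "finite_dimensional (quot_module (hom_space \<iota> R F N\<lparr>carrier := Z\<rparr>) Bd)"
    and "dimension (quot_module (hom_space \<iota> R F N\<lparr>carrier := Z\<rparr>) Bd) = d"
proof -
  interpret F: left_module R F by fact
  interpret Y: left_module R Y by fact
  interpret kY: kspace "kmod Y" by (rule kspace_kmod[OF Y])
  let ?H = "hom_space \<iota> R F N"
  interpret H: kspace ?H by (rule kspace_hom_space[OF F])
  note pD = lmapD[OF p(1)] and XD = submodD[OF X]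
  have ops: "f \<oplus>\<^bsub>?H\<^esub> g = (\<lambda>x\<in>carrier F. f x \<oplus>\<^bsub>N\<^esub> g x)" "c \<odot>\<^bsub>?H\<^esub> f = (\<lambda>x\<in>carrier F. \<iota> c \<odot>\<^bsub>N\<^esub> f x)"
    "\<zero>\<^bsub>?H\<^esub> = (\<lambda>x\<in>carrier F. \<zero>\<^bsub>N\<^esub>)" "carrier ?H = lmod_hom R F N" for f g c by (auto simp: hom_space_def)
  have ZH: "f \<in> carrier ?H" "lmap R F N f" if "f \<in> Z" for f using that by (auto simp: Z ops lmod_hom_iff)
  have Zk: "f y = \<zero>\<^bsub>N\<^esub>" if "f \<in> Z" "y \<in> carrier F" "p y = \<zero>\<^bsub>Y\<^esub>" for f y using that by (auto simp: Z)
  have kZ: "ksub ?H Z" unfolding ksub_def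
  proof (intro conjI ballI allI)
    show "Z \<subseteq> carrier ?H" using ZH by auto
    show "\<zero>\<^bsub>?H\<^esub> \<in> Z" using H.zero_closed by (auto simp: Z ops)
    fix f assume f: "f \<in> Z"
    show "c \<odot>\<^bsub>?H\<^esub> f \<in> Z" for c
      using H.ksm_closed[OF ZH(1)[OF f], of c] Zk[OF f] by (auto simp: Z ops N.lsmult_zero_right)
    fix g assume g: "g \<in> Z"
    show "f \<oplus>\<^bsub>?H\<^esub> g \<in> Z"
      using H.a_closed[OF ZH(1)[OF f] ZH(1)[OF g]] Zk[OF f] Zk[OF g] by (auto simp: Z ops)
  qed
  have sadd: "\<sigma> ((f \<oplus>\<^bsub>?H\<^esub> g) y) = \<sigma> (f y) + \<sigma> (g y)" if "f \<in> Z" "g \<in> Z" "y \<in> carrier F" for f g y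
    using that lmapD(1)[OF ZH(2)] by (simp add: ops sigma_simps)
  have ssm: "\<sigma> ((c \<odot>\<^bsub>?H\<^esub> f) y) = c * \<sigma> (f y)" if "f \<in> Z" "y \<in> carrier F" for f y c
    using that lmapD(1)[OF ZH(2)] by (simp add: ops sigma_simps)
  have kB: "ksub ?H Bd" unfolding ksub_def
  proof (intro conjI ballI allI)
    show "Bd \<subseteq> carrier ?H" using ZH Bd(1) by auto
    show "\<zero>\<^bsub>?H\<^esub> \<in> Bd" using Bd(2)[OF ksubD(2)[OF kZ]] by (simp add: ops sigma_zero)
    fix f assume f: "f \<in> Bd"
    then have fZ: "f \<in> Z" using Bd(1) by auto
    show "c \<odot>\<^bsub>?H\<^esub> f \<in> Bd" for c
      using Bd(2)[OF ksubD(4)[OF kZ fZ, of c]] Bd(2)[OF fZ] f ssm[OF fZ] by simp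
    fix g assume g: "g \<in> Bd"
    then have gZ: "g \<in> Z" using Bd(1) by auto
    show "f \<oplus>\<^bsub>?H\<^esub> g \<in> Bd"
      using Bd(2)[OF ksubD(3)[OF kZ fZ gZ]] Bd(2)[OF fZ] Bd(2)[OF gZ] f g sadd[OF fZ gZ] by simp
  qed
  obtain \<Phi> where \<Phi>: "coords (kmod Y) U (arrow_span Y A X) {..<d} \<Phi>" using d by (auto simp: qdim_def)
  obtain b where b: "\<And>i. i < d \<Longrightarrow> b i \<in> U" "\<And>i j. i < d \<Longrightarrow> j < d \<Longrightarrow> \<Phi> (b i) j = (if j = i then 1 else 0)"
    using dual_basis_exists[OF \<Phi>] by blast
  have "\<forall>i. \<exists>y. i < d \<longrightarrow> y \<in> carrier F \<and> p y = b i" using b(1) U(2) p(2) by (metis imageE subsetD)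
  then obtain y where y: "\<And>i. i < d \<Longrightarrow> y i \<in> carrier F" "\<And>i. i < d \<Longrightarrow> p (y i) = b i" by metis
  have "coords ?H Z Bd {..<d} (\<lambda>f i. \<sigma> (f (y i)))"
    unfolding coords_def
  proof (intro conjI ballI allI)
    show "Bd \<subseteq> Z" by (rule Bd(1))
    show "klinear ?H Z (\<lambda>f. \<sigma> (f (y i)))" if "i \<in> {..<d}" for i
      using that y(1)[of i] by (auto simp: klinear_def sadd ssm)
  next
    fix f assume f: "f \<in> Z"
    note fD = lmapD[OF ZH(2)[OF f]]
    show "f \<in> Bd \<longleftrightarrow> (\<forall>i\<in>{..<d}. \<sigma> (f (y i)) = 0)"
    proof
      assume "f \<in> Bd"
      then show "\<forall>i\<in>{..<d}. \<sigma> (f (y i)) = 0" using Bd(2)[OF f] y b(1) by auto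
    next
      assume a: "\<forall>i\<in>{..<d}. \<sigma> (f (y i)) = 0"
      obtain \<psi> where \<psi>: "\<And>z. z \<in> carrier F \<Longrightarrow> \<psi> (p z) = \<sigma> (f z)" and linX: "klinear (kmod Y) X \<psi>"
        using descend_functional[OF F Y p ZH(2)[OF f] Zk[OF f]] by blast
      have lin: "klinear (kmod Y) U \<psi>" using linX U(2) unfolding klinear_def by blast
      have kill: "\<psi> x = 0" if "x \<in> arrow_span Y A X" for x
      proof -
        obtain g where g: "x = comb Y A g" "\<And>a. g a \<in> X" using \<open>x \<in> arrow_span Y A X\<close> by (auto simp: arrow_span_def)
        have "\<forall>a. \<exists>z. z \<in> carrier F \<and> p z = g a" using g(2) p(2) by (metis imageE)
        then obtain z where z: "\<And>a. z a \<in> carrier F" "\<And>a. p (z a) = g a" by metis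
        have "x = p (comb F A z)" using lmap_comb[OF F Y p(1) subset_refl, of z] z g by simp
        moreover have "f (comb F A z) = \<zero>\<^bsub>N\<^esub>"
          using lmap_comb[OF F N ZH(2)[OF f] subset_refl, of z] z fD comb_N[OF subset_refl, of "\<lambda>b. f (z b)"] by simp
        ultimately show ?thesis using \<psi>[of "comb F A z"] comb_closed[OF F subset_refl, of z] z sigma_zero by simp
      qed
      have "\<psi> u = 0" if "u \<in> U" for u
        using kY.functional_determined_by_basis[OF U(1) \<Phi> b lin kill _ that] \<psi>[OF y(1)] y(2) a by auto
      then have "\<sigma> (f z) = 0" if "z \<in> carrier F" "p z \<in> U" for z using \<psi>[OF that(1)] that(2) by simp
      then show "f \<in> Bd" using Bd(2)[OF f] by blast
    qed
  next
    fix g :: "nat \<Rightarrow> 'k"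
    define \<psi> where "\<psi> u = (\<Sum>i<d. g i * \<Phi> u i)" for u
    have lin: "klinear (kmod Y) U \<psi>"
      unfolding klinear_def
    proof (intro conjI ballI allI)
      fix u v c assume u: "u \<in> U"
      show "\<psi> (c \<odot>\<^bsub>kmod Y\<^esub> u) = c * \<psi> u"
        using klinearD(2)[OF coordsD(2)[OF \<Phi>] u] unfolding \<psi>_def sum_distrib_left by (intro sum.cong) auto
      assume v: "v \<in> U"
      show "\<psi> (u \<oplus>\<^bsub>kmod Y\<^esub> v) = \<psi> u + \<psi> v"
        using klinearD(1)[OF coordsD(2)[OF \<Phi>] u v] unfolding \<psi>_def sum.distrib[symmetric] by (intro sum.cong) (auto simp: algebra_simps)
    qed
    have kill: "\<psi> x = 0" if "x \<in> U \<inter> arrow_span Y A X" for x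
      using coordsD(3)[OF \<Phi>, of x] that by (auto simp: \<psi>_def)
    obtain \<psi>' where \<psi>': "klinear (kmod Y) (carrier (kmod Y)) \<psi>'" "\<And>x. x \<in> U \<Longrightarrow> \<psi>' x = \<psi> x"
        "\<And>x. x \<in> arrow_span Y A X \<Longrightarrow> \<psi>' x = 0"
      using kY.extend_functional[OF U(1) ksub_arrow_span[OF Y X subset_refl] lin kill] by blast
    have lin': "klinear (kmod F) (carrier F) (\<lambda>x. \<psi>' (p x))"
      using klinear_comp[OF p(1), of "carrier Y" \<psi>'] \<psi>'(1) pD(1) by simp
    have kill': "\<psi>' (p x) = 0" if x: "x \<in> arrow_span F A (carrier F)" for x
    proof -
      obtain h where h: "x = comb F A h" "\<And>a. h a \<in> carrier F" using x by (auto simp: arrow_span_def)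
      have "p x = comb Y A (\<lambda>a. p (h a))" using lmap_comb[OF F Y p(1) subset_refl, of h] h by simp
      then have "p x \<in> arrow_span Y A X" using h p(2) unfolding arrow_span_def by blast
      then show ?thesis using \<psi>'(3) by blast
    qed
    let ?f = "hom_of F (\<lambda>x. \<psi>' (p x))"
    have "?f z = \<zero>\<^bsub>N\<^esub>" if z: "z \<in> carrier F" "p z = \<zero>\<^bsub>Y\<^esub>" for z
    proof (rule N_eqI)
      fix v assume v: "v \<in> V"
      have "\<sigma> (idm v \<odot>\<^bsub>N\<^esub> ?f z) = \<psi>' \<zero>\<^bsub>Y\<^esub>"
        using idm_hom_of[OF z(1) v] pD(3)[OF idm_closed[OF v] z(1)] z(2) v by (simp add: Y.lsmult_zero_right)
      also have "\<dots> = 0" using kY.klinear_zero[OF \<psi>'(1) kY.ksub_carrier] by simp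
      finally show "\<sigma> (idm v \<odot>\<^bsub>N\<^esub> ?f z) = \<sigma> (idm v \<odot>\<^bsub>N\<^esub> \<zero>\<^bsub>N\<^esub>)" using v by (simp add: N.lsmult_zero_right sigma_zero)
    qed (use z hom_of_closed in auto)
    then have "?f \<in> Z" using hom_of_in_hom[OF F lin' kill'] by (simp add: Z)
    moreover have "\<sigma> (?f (y i)) = g i" if "i < d" for i
    proof -
      have "\<sigma> (?f (y i)) = \<psi> (b i)" using sigma_hom_of[OF F lin' y(1)[OF that]] y(2) \<psi>'(2) b(1) that by simp
      also have "\<dots> = (\<Sum>j<d. if j = i then g j else 0)" unfolding \<psi>_def using b(2) that by (intro sum.cong) auto
      finally show ?thesis using that by simp
    qed
    ultimately show "\<exists>f\<in>Z. \<forall>i\<in>{..<d}. \<sigma> (f (y i)) = g i" by auto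
  qed
  then have "qdim ?H Z Bd d" unfolding qdim_def by blast
  from quotient_dimension[OF H.kspace_axioms kZ kB Bd(1) this]
  show "finite_dimensional (quot_module (?H\<lparr>carrier := Z\<rparr>) Bd)" "dimension (quot_module (?H\<lparr>carrier := Z\<rparr>) Bd) = d" .
qed

text \<open>
  A functional on the syzygy \<open>X\<close> is the restriction of a functional on \<open>Y\<close> that vanishes on the radical of
  \<open>Y\<close> if and only if it vanishes on the intersection of \<open>X\<close> with that radical.
\<close>

lemma coboundary_iff:
  assumes F: "left_module R F" and Y: "left_module R Y" and X: "submod R Y X"
    and p: "lmap R F Y p" "p ` carrier F = X"
    and f: "f \<in> lmod_hom R F N" "\<And>y. y \<in> carrier F \<Longrightarrow> p y = \<zero>\<^bsub>Y\<^esub> \<Longrightarrow> f y = \<zero>\<^bsub>N\<^esub>"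
  shows "f \<in> (\<lambda>g. \<lambda>x\<in>carrier F. g (p x)) ` lmod_hom R Y N \<longleftrightarrow>
    (\<forall>y\<in>carrier F. p y \<in> X \<inter> arrow_span Y A (carrier Y) \<longrightarrow> \<sigma> (f y) = 0)"
proof -
  interpret F: left_module R F by fact
  interpret Y: left_module R Y by fact
  interpret kY: kspace "kmod Y" by (rule kspace_kmod[OF Y])
  note pD = lmapD[OF p(1)]
  have fl: "lmap R F N f" "f \<in> extensional (carrier F)" using f(1) by (auto simp: lmod_hom_iff)
  note fD = lmapD[OF fl(1)]
  show ?thesis
  proof
    assume "f \<in> (\<lambda>g. \<lambda>x\<in>carrier F. g (p x)) ` lmod_hom R Y N"
    then obtain g where g: "g \<in> lmod_hom R Y N" "f = (\<lambda>x\<in>carrier F. g (p x))" by auto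
    have gl: "lmap R Y N g" using g by (auto simp: lmod_hom_iff)
    show "\<forall>y\<in>carrier F. p y \<in> X \<inter> arrow_span Y A (carrier Y) \<longrightarrow> \<sigma> (f y) = 0"
    proof (intro ballI impI)
      fix y assume y: "y \<in> carrier F" "p y \<in> X \<inter> arrow_span Y A (carrier Y)"
      then obtain h where h: "p y = comb Y A h" "\<And>a. h a \<in> carrier Y" by (auto simp: arrow_span_def)
      have "g (p y) = \<zero>\<^bsub>N\<^esub>"
        using lmap_comb[OF Y N gl subset_refl, of h] h lmapD(1)[OF gl] comb_N[OF subset_refl, of "\<lambda>b. g (h b)"] by simp
      then show "\<sigma> (f y) = 0" using y g sigma_zero by simp
    qed
  next
    assume a: "\<forall>y\<in>carrier F. p y \<in> X \<inter> arrow_span Y A (carrier Y) \<longrightarrow> \<sigma> (f y) = 0"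
    obtain \<psi> where \<psi>: "\<And>z. z \<in> carrier F \<Longrightarrow> \<psi> (p z) = \<sigma> (f z)" and lin: "klinear (kmod Y) X \<psi>"
      using descend_functional[OF F Y p fl(1) f(2)] by blast
    have kill: "\<psi> x = 0" if x: "x \<in> X \<inter> arrow_span Y A (carrier Y)" for x
    proof -
      have "x \<in> p ` carrier F" using x p(2) by simp
      then obtain z where "z \<in> carrier F" "x = p z" by (rule imageE)
      then show ?thesis using x a \<psi>[of z] by simp
    qed
    obtain \<psi>' where \<psi>': "klinear (kmod Y) (carrier (kmod Y)) \<psi>'" "\<And>x. x \<in> X \<Longrightarrow> \<psi>' x = \<psi> x"
        "\<And>x. x \<in> arrow_span Y A (carrier Y) \<Longrightarrow> \<psi>' x = 0"
      using kY.extend_functional[OF submod_ksub[OF X] ksub_arrow_span[OF Y submod_carrier[OF Y] subset_refl] lin kill] by blast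
    let ?g = "hom_of Y \<psi>'"
    have g: "?g \<in> lmod_hom R Y N" using hom_of_in_hom[OF Y] \<psi>' by simp
    have "f x = ?g (p x)" if x: "x \<in> carrier F" for x
    proof (rule N_eqI)
      fix v assume v: "v \<in> V"
      have e: "idm v \<odot>\<^bsub>F\<^esub> x \<in> carrier F" "idm v \<odot>\<^bsub>Y\<^esub> p x = p (idm v \<odot>\<^bsub>F\<^esub> x)"
        using v x pD(3) by (auto simp: F.lsmult_closed)
      have "\<sigma> (idm v \<odot>\<^bsub>N\<^esub> ?g (p x)) = \<psi>' (p (idm v \<odot>\<^bsub>F\<^esub> x))"
        using idm_hom_of[OF pD(1)[OF x] v] e(2) by simp
      also have "\<dots> = \<sigma> (f (idm v \<odot>\<^bsub>F\<^esub> x))" using \<psi>'(2)[of "p (idm v \<odot>\<^bsub>F\<^esub> x)"] \<psi>[OF e(1)] p(2) e(1) by auto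
      also have "\<dots> = \<sigma> (idm v \<odot>\<^bsub>N\<^esub> f x)" using fD(3) v x by simp
      finally show "\<sigma> (idm v \<odot>\<^bsub>N\<^esub> f x) = \<sigma> (idm v \<odot>\<^bsub>N\<^esub> ?g (p x))" by simp
    qed (use x in \<open>auto intro!: fD(1) pD(1) hom_of_closed\<close>)
    then have "f = (\<lambda>x\<in>carrier F. ?g (p x))" using fl(2) by (auto intro!: extensionalityI)
    then show "f \<in> (\<lambda>g. \<lambda>x\<in>carrier F. g (p x)) ` lmod_hom R Y N" using g by blast
  qed
qed

end

section \<open>Free modules and the standard resolution\<close>

lemma free_module_simps [simp]:
  "zero (free_module R B) = (\<lambda>b. \<zero>\<^bsub>R\<^esub>)"
  "f \<oplus>\<^bsub>free_module R B\<^esub> g = (\<lambda>b. f b \<oplus>\<^bsub>R\<^esub> g b)"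
  "a \<odot>\<^bsub>free_module R B\<^esub> f = (\<lambda>b. a \<otimes>\<^bsub>R\<^esub> f b)"
  by (auto simp: free_module_def)

lemma free_module_carrier:
  "f \<in> carrier (free_module R B) \<longleftrightarrow> (\<forall>b. f b \<in> carrier R) \<and> finite {b. f b \<noteq> \<zero>\<^bsub>R\<^esub>} \<and> (\<forall>b. b \<notin> B \<longrightarrow> f b = \<zero>\<^bsub>R\<^esub>)"
  by (auto simp: free_module_def)

lemma left_module_free:
  assumes "ring R" shows "left_module R (free_module R B)"
proof -
  interpret ring R by fact
  have add: "f \<oplus>\<^bsub>free_module R B\<^esub> g \<in> carrier (free_module R B)"
    if "f \<in> carrier (free_module R B)" "g \<in> carrier (free_module R B)" for f g
  proof -
    have "{b. f b \<oplus>\<^bsub>R\<^esub> g b \<noteq> \<zero>\<^bsub>R\<^esub>} \<subseteq> {b. f b \<noteq> \<zero>\<^bsub>R\<^esub>} \<union> {b. g b \<noteq> \<zero>\<^bsub>R\<^esub>}" by auto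
    then have "finite {b. f b \<oplus>\<^bsub>R\<^esub> g b \<noteq> \<zero>\<^bsub>R\<^esub>}"
      using that by (auto simp: free_module_carrier intro: finite_subset)
    then show ?thesis using that by (auto simp: free_module_carrier)
  qed
  have smult: "a \<odot>\<^bsub>free_module R B\<^esub> f \<in> carrier (free_module R B)"
    if "f \<in> carrier (free_module R B)" "a \<in> carrier R" for f a
  proof -
    have "{b. a \<otimes>\<^bsub>R\<^esub> f b \<noteq> \<zero>\<^bsub>R\<^esub>} \<subseteq> {b. f b \<noteq> \<zero>\<^bsub>R\<^esub>}" using that by auto
    then have "finite {b. a \<otimes>\<^bsub>R\<^esub> f b \<noteq> \<zero>\<^bsub>R\<^esub>}"
      using that by (auto simp: free_module_carrier intro: finite_subset)
    then show ?thesis using that by (auto simp: free_module_carrier)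
  qed
  have inv: "(\<lambda>b. \<ominus>\<^bsub>R\<^esub> f b) \<in> carrier (free_module R B)" if "f \<in> carrier (free_module R B)" for f
  proof -
    have "{b. \<ominus>\<^bsub>R\<^esub> f b \<noteq> \<zero>\<^bsub>R\<^esub>} \<subseteq> {b. f b \<noteq> \<zero>\<^bsub>R\<^esub>}" using that by auto
    then have "finite {b. \<ominus>\<^bsub>R\<^esub> f b \<noteq> \<zero>\<^bsub>R\<^esub>}"
      using that by (auto simp: free_module_carrier intro: finite_subset)
    then show ?thesis using that by (auto simp: free_module_carrier)
  qed
  show ?thesis
  proof (intro left_module.intro left_module_axioms.intro abelian_groupI assms)
    show "\<exists>g\<in>carrier (free_module R B). g \<oplus>\<^bsub>free_module R B\<^esub> f = \<zero>\<^bsub>free_module R B\<^esub>"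
      if "f \<in> carrier (free_module R B)" for f
      using inv[OF that] that by (intro bexI[of _ "\<lambda>b. \<ominus>\<^bsub>R\<^esub> f b"]) (auto simp: free_module_carrier l_neg)
    show "\<zero>\<^bsub>free_module R B\<^esub> \<in> carrier (free_module R B)" by (auto simp: free_module_carrier)
  qed (use add smult in \<open>auto simp: free_module_carrier fun_eq_iff a_ac l_distr r_distr m_assoc\<close>)
qed

lemma free_module_finsum_apply:
  assumes "ring R" "finite S" "\<And>i. i \<in> S \<Longrightarrow> f i \<in> carrier (free_module R B)"
  shows "(\<Oplus>\<^bsub>free_module R B\<^esub>i\<in>S. f i) b = (\<Oplus>\<^bsub>R\<^esub>i\<in>S. f i b)"
proof -
  interpret ring R by fact
  interpret F: left_module R "free_module R B" by (rule left_module_free[OF assms(1)])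
  show ?thesis
    using assms(2,3)
    by (intro additive_finsum[of "free_module R B" R "\<lambda>g. g b"])
      (auto simp: F.abelian_group_axioms abelian_group_axioms free_module_carrier)
qed

text \<open>
  Both the augmentation and the differentials of the standard resolution have this form.
\<close>

definition linear_extension ::
  "('r, 'x) ring_scheme \<Rightarrow> ('r, 'm, 'y) module_scheme \<Rightarrow> ('b \<Rightarrow> 'm) \<Rightarrow> ('b \<Rightarrow> 'r) \<Rightarrow> 'm" where
  "linear_extension R Y val f = (\<Oplus>\<^bsub>Y\<^esub>s\<in>{s. f s \<noteq> \<zero>\<^bsub>R\<^esub>}. f s \<odot>\<^bsub>Y\<^esub> val s)"

lemma linear_extension_superset:
  assumes Y: "left_module R Y" and val: "\<And>s. s \<in> B \<Longrightarrow> val s \<in> carrier Y"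
    and f: "f \<in> carrier (free_module R B)" and T: "{s. f s \<noteq> \<zero>\<^bsub>R\<^esub>} \<subseteq> T" "T \<subseteq> B" "finite T"
  shows "linear_extension R Y val f = (\<Oplus>\<^bsub>Y\<^esub>s\<in>T. f s \<odot>\<^bsub>Y\<^esub> val s)"
proof -
  interpret Y: left_module R Y by fact
  show ?thesis unfolding linear_extension_def
    using f T val
    by (intro Y.M.add.finprod_mono_neutral_cong_left)
      (auto simp: free_module_carrier subset_iff Y.lsmult_zero_left intro!: Y.lsmult_closed)
qed

lemma lmap_linear_extension:
  assumes Y: "left_module R Y" and val: "\<And>s. s \<in> B \<Longrightarrow> val s \<in> carrier Y"
  shows "lmap R (free_module R B) Y (linear_extension R Y val)"
proof -
  interpret Y: left_module R Y by fact
  interpret F: left_module R "free_module R B" by (rule left_module_free[OF Y.R.ring_axioms])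
  let ?L = "linear_extension R Y val"
  have supp: "finite {s. f s \<noteq> \<zero>\<^bsub>R\<^esub>}" "{s. f s \<noteq> \<zero>\<^bsub>R\<^esub>} \<subseteq> B" if "f \<in> carrier (free_module R B)" for f
    using that by (auto simp: free_module_carrier)
  have fc: "f s \<in> carrier R" if "f \<in> carrier (free_module R B)" for f s using that by (auto simp: free_module_carrier)
  note ext = linear_extension_superset[OF Y val]
  show ?thesis unfolding lmap_def
  proof (intro conjI ballI)
    fix f assume f: "f \<in> carrier (free_module R B)"
    let ?S = "{s. f s \<noteq> \<zero>\<^bsub>R\<^esub>}"
    have trm: "f s \<odot>\<^bsub>Y\<^esub> val s \<in> carrier Y" if "s \<in> B" for s using fc[OF f] val that Y.lsmult_closed by blast
    show "?L f \<in> carrier Y"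
      unfolding linear_extension_def using supp[OF f] trm by (intro Y.M.finsum_closed) auto
    show "?L (a \<odot>\<^bsub>free_module R B\<^esub> f) = a \<odot>\<^bsub>Y\<^esub> ?L f" if a: "a \<in> carrier R" for a
    proof -
      have af: "a \<odot>\<^bsub>free_module R B\<^esub> f \<in> carrier (free_module R B)" using F.lsmult_closed[OF a f] .
      have "?L (a \<odot>\<^bsub>free_module R B\<^esub> f) = (\<Oplus>\<^bsub>Y\<^esub>s\<in>?S. (a \<odot>\<^bsub>free_module R B\<^esub> f) s \<odot>\<^bsub>Y\<^esub> val s)"
        using supp[OF f] a by (intro ext[OF _ af]) auto
      also have "\<dots> = (\<Oplus>\<^bsub>Y\<^esub>s\<in>?S. a \<odot>\<^bsub>Y\<^esub> (f s \<odot>\<^bsub>Y\<^esub> val s))"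
        using supp[OF f] a fc[OF f] val trm
        by (intro Y.M.finsum_cong') (auto simp: Y.lsmult_assoc subset_iff intro!: Y.lsmult_closed)
      also have "\<dots> = a \<odot>\<^bsub>Y\<^esub> ?L f"
        unfolding linear_extension_def using supp[OF f] a trm by (intro Y.lsmult_finsum[symmetric]) auto
      finally show ?thesis .
    qed
    fix g assume g: "g \<in> carrier (free_module R B)"
    let ?T = "?S \<union> {s. g s \<noteq> \<zero>\<^bsub>R\<^esub>}"
    have T: "finite ?T" "?T \<subseteq> B" using supp[OF f] supp[OF g] by auto
    have gterm: "g s \<odot>\<^bsub>Y\<^esub> val s \<in> carrier Y" if "s \<in> B" for s using fc[OF g] val that Y.lsmult_closed by blast
    have fg: "f \<oplus>\<^bsub>free_module R B\<^esub> g \<in> carrier (free_module R B)" by (rule F.M.a_closed[OF f g])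
    have "?L (f \<oplus>\<^bsub>free_module R B\<^esub> g) = (\<Oplus>\<^bsub>Y\<^esub>s\<in>?T. (f \<oplus>\<^bsub>free_module R B\<^esub> g) s \<odot>\<^bsub>Y\<^esub> val s)"
      using T by (intro ext[OF _ fg]) auto
    also have "\<dots> = (\<Oplus>\<^bsub>Y\<^esub>s\<in>?T. f s \<odot>\<^bsub>Y\<^esub> val s \<oplus>\<^bsub>Y\<^esub> g s \<odot>\<^bsub>Y\<^esub> val s)"
      using T fc[OF f] fc[OF g] val trm gterm
      by (intro Y.M.finsum_cong') (auto simp: Y.lsmult_l_distr subset_iff)
    also have "\<dots> = (\<Oplus>\<^bsub>Y\<^esub>s\<in>?T. f s \<odot>\<^bsub>Y\<^esub> val s) \<oplus>\<^bsub>Y\<^esub> (\<Oplus>\<^bsub>Y\<^esub>s\<in>?T. g s \<odot>\<^bsub>Y\<^esub> val s)"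
      using T trm gterm by (intro Y.M.finsum_addf) auto
    also have "\<dots> = ?L f \<oplus>\<^bsub>Y\<^esub> ?L g"
      using ext[OF _ f _ T(2,1)] ext[OF _ g _ T(2,1)] by auto
    finally show "?L (f \<oplus>\<^bsub>free_module R B\<^esub> g) = ?L f \<oplus>\<^bsub>Y\<^esub> ?L g" .
  qed
qed

lemma linear_extension_image:
  fixes val :: "'b \<Rightarrow> 'm"
  assumes Y: "left_module R Y" and X: "submod R Y X" and val: "val ` B = X"
  shows "linear_extension R Y val ` carrier (free_module R B) = X"
proof
  interpret Y: left_module R Y by fact
  note XD = submodD[OF X]
  have vc: "val s \<in> carrier Y" if "s \<in> B" for s using that val XD by auto
  show "linear_extension R Y val ` carrier (free_module R B) \<subseteq> X"
  proof
    fix y assume "y \<in> linear_extension R Y val ` carrier (free_module R B)"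
    then obtain f where f: "f \<in> carrier (free_module R B)" "y = linear_extension R Y val f" by auto
    have fs: "finite S \<Longrightarrow> (\<And>s. s \<in> S \<Longrightarrow> h s \<in> X) \<Longrightarrow> (\<Oplus>\<^bsub>Y\<^esub>s\<in>S. h s) \<in> X" for S and h :: "'b \<Rightarrow> _"
    proof (induction S rule: finite_induct)
      case (insert x S)
      then have "h \<in> S \<rightarrow> carrier Y" "h x \<in> carrier Y" using XD by auto
      then show ?case using insert XD by (simp add: Y.M.finsum_insert)
    qed (simp add: XD)
    have "f s \<odot>\<^bsub>Y\<^esub> val s \<in> X" if "f s \<noteq> \<zero>\<^bsub>R\<^esub>" for s
    proof -
      have "s \<in> B" "f s \<in> carrier R" using f that by (auto simp: free_module_carrier)
      then show ?thesis using val XD(4) by blast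
    qed
    then show "y \<in> X" unfolding f linear_extension_def using f(1) by (intro fs) (auto simp: free_module_carrier)
  qed
  show "X \<subseteq> linear_extension R Y val ` carrier (free_module R B)"
  proof
    fix x assume "x \<in> X"
    then obtain s where s: "s \<in> B" "x = val s" using val by auto
    let ?f = "\<lambda>b. if b = s then \<one>\<^bsub>R\<^esub> else \<zero>\<^bsub>R\<^esub>"
    have f: "?f \<in> carrier (free_module R B)"
      using s finite_subset[of "{b. ?f b \<noteq> \<zero>\<^bsub>R\<^esub>}" "{s}"] by (auto simp: free_module_carrier)
    have "linear_extension R Y val ?f = (\<Oplus>\<^bsub>Y\<^esub>b\<in>{s}. ?f b \<odot>\<^bsub>Y\<^esub> val b)"
      using s by (intro linear_extension_superset[OF Y vc f]) auto
    also have "\<dots> = x" using s vc[OF s(1)] by (simp add: Y.M.finsum_insert Y.lsmult_one)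
    finally show "x \<in> linear_extension R Y val ` carrier (free_module R B)" using f by (metis imageI)
  qed
qed

context monomial_ring
begin

lemma coeff_zero: "v \<in> V \<Longrightarrow> coeff v \<zero> = 0"
  using coeff_add[of v \<zero> \<zero>] by (metis add_cancel_right_right r_zero zero_closed)

lemma coeff_finsum:
  assumes "finite S" "v \<in> V" "\<And>i. i \<in> S \<Longrightarrow> f i \<in> carrier R"
  shows "coeff v (\<Oplus>i\<in>S. f i) = (\<Sum>i\<in>S. coeff v (f i))"
  using assms(1,3)
proof (induction S rule: finite_induct)
  case (insert x S)
  then have "f \<in> S \<rightarrow> carrier R" by auto
  then show ?case using insert assms(2) by (simp add: coeff_add)
qed (simp add: coeff_zero assms(2))

lemma free_comb_apply:
  fixes f :: "'a \<Rightarrow> 'i \<Rightarrow> 'r"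
  assumes "\<And>a. a \<in> S \<Longrightarrow> f a \<in> carrier (free_module R B)" "S \<subseteq> A"
  shows "comb (free_module R B) S f b = (\<Oplus>a\<in>S. arr a \<otimes> f a b)"
proof -
  interpret F: left_module R "free_module R B" by (rule left_module_free[OF ring_axioms])
  have "arr a \<odot>\<^bsub>free_module R B\<^esub> f a \<in> carrier (free_module R B)" if "a \<in> S" for a
    using that assms by (intro F.lsmult_closed) auto
  from free_module_finsum_apply[OF ring_axioms finite_subset_A[OF assms(2)] this, where b = b] show ?thesis
    unfolding comb_def by simp
qed

lemma strip_free_closed:
  assumes "x \<in> carrier (free_module R B)" "a \<in> A"
  shows "(\<lambda>b. strip a (x b)) \<in> carrier (free_module R B)"
proof -
  have "{b. strip a (x b) \<noteq> \<zero>} \<subseteq> {b. x b \<noteq> \<zero>}" using strip_zero[OF assms(2)] by auto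
  then show ?thesis
    using assms by (auto simp: free_module_carrier strip_zero intro: finite_subset)
qed

lemma decomposition_zero_coeff:
  assumes "r \<in> carrier R" "\<And>v. v \<in> V \<Longrightarrow> coeff v r = 0"
  shows "r = (\<Oplus>a\<in>A. arr a \<otimes> strip a r)"
proof -
  have "(\<Oplus>v\<in>V. \<iota> (coeff v r) \<otimes> idm v) = \<zero>"
    using assms by (subst finsum_cong'[where g = "\<lambda>_. \<zero>"]) (auto simp: iota_zero)
  then show ?thesis using decomposition[OF assms(1)] assms(1) finite_A by (simp add: finsum_closed)
qed

text \<open>
  Both properties are inherited from the ring coordinate by coordinate.
\<close>

lemma arrow_free_free: "arrow_free (free_module R B)"
proof -
  let ?F = "free_module R B"
  show ?thesis unfolding arrow_free_def
  proof (intro conjI allI impI ballI)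
    fix f a assume f: "\<forall>a. f a \<in> carrier ?F" and z: "comb ?F A f = \<zero>\<^bsub>?F\<^esub>" and a: "a \<in> A"
    have "arr a \<otimes> f a b = \<zero>" for b
    proof (rule arr_independent[OF _ _ a, of "\<lambda>a. f a b"])
      show "f a b \<in> carrier R" for a using f by (auto simp: free_module_carrier)
      show "(\<Oplus>a\<in>A. arr a \<otimes> f a b) = \<zero>"
        using free_comb_apply[of A f B b] f z by simp
    qed
    then show "arr a \<odot>\<^bsub>?F\<^esub> f a = \<zero>\<^bsub>?F\<^esub>" by simp
  next
    fix a x assume a: "a \<in> A" and x: "x \<in> carrier ?F" and e: "idm (src a) \<odot>\<^bsub>?F\<^esub> x = x" and z: "arr a \<odot>\<^bsub>?F\<^esub> x = \<zero>\<^bsub>?F\<^esub>"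
    note pa = perp_subset[OF a]
    have xc: "x b \<in> carrier R" for b using x by (auto simp: free_module_carrier)
    let ?h = "\<lambda>c b. if c \<in> perp a then strip c (x b) else \<zero>"
    have h: "?h c \<in> carrier ?F" for c
      using strip_free_closed[OF x, of c] pa by (cases "c \<in> perp a") (auto simp: free_module_carrier)
    have "x b = comb ?F (perp a) ?h b" for b
    proof -
      have eb: "idm (src a) \<otimes> x b = x b" "arr a \<otimes> x b = \<zero>" using fun_cong[OF e, of b] fun_cong[OF z, of b] by auto
      note an = arr_annihilator[OF a xc eb]
      have "x b = (\<Oplus>c\<in>A. arr c \<otimes> strip c (x b))" using decomposition_zero_coeff[OF xc] an by blast
      also have "\<dots> = (\<Oplus>c\<in>perp a. arr c \<otimes> ?h c b)"
        using an pa xc finite_A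
        by (intro add.finprod_mono_neutral_cong_right) (auto simp: subset_iff)
      also have "\<dots> = comb ?F (perp a) ?h b" by (rule free_comb_apply[OF h pa, symmetric])
      finally show ?thesis .
    qed
    then have "x = comb ?F (perp a) ?h" by (simp add: fun_eq_iff)
    then show "x \<in> arrow_span ?F (perp a) (carrier ?F)" using h unfolding arrow_span_def by blast
  qed
qed

lemma qdim_free_top:
  fixes B :: "'i set"
  assumes "finite B"
  shows "\<exists>d. qdim (kmod (free_module R B)) (carrier (free_module R B)) (arrow_span (free_module R B) A (carrier (free_module R B))) d"
proof -
  let ?F = "free_module R B"
  interpret F: left_module R ?F by (rule left_module_free[OF ring_axioms])
  have fc: "f b \<in> carrier R" if "f \<in> carrier ?F" for f b using that by (auto simp: free_module_carrier)
  have "coords (kmod ?F) (carrier ?F) (arrow_span ?F A (carrier ?F)) (B \<times> V) (\<lambda>f (b, v). coeff v (f b))"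
    unfolding coords_def
  proof (intro conjI ballI allI)
    show "arrow_span ?F A (carrier ?F) \<subseteq> carrier ?F"
      by (intro arrow_span_subset submod_carrier F.left_module_axioms) auto
    show "klinear (kmod ?F) (carrier ?F) (\<lambda>f. case s of (b, v) \<Rightarrow> coeff v (f b))" if "s \<in> B \<times> V" for s
      using that by (auto simp: klinear_def coeff_add coeff_iota fc)
  next
    fix f assume f: "f \<in> carrier ?F"
    show "f \<in> arrow_span ?F A (carrier ?F) \<longleftrightarrow> (\<forall>s\<in>B \<times> V. (case s of (b, v) \<Rightarrow> coeff v (f b)) = 0)"
    proof
      assume "f \<in> arrow_span ?F A (carrier ?F)"
      then obtain h where h: "f = comb ?F A h" "\<And>a. h a \<in> carrier ?F" by (auto simp: arrow_span_def)
      have "coeff v (f b) = 0" if "v \<in> V" for v b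
      proof -
        have "coeff v (f b) = (\<Sum>a\<in>A. coeff v (arr a \<otimes> h a b))"
          using free_comb_apply[of A h B b] h fc that finite_A by (simp add: coeff_finsum)
        also have "\<dots> = 0" using that h fc by (intro sum.neutral) (auto simp: coeff_arr)
        finally show ?thesis .
      qed
      then show "\<forall>s\<in>B \<times> V. (case s of (b, v) \<Rightarrow> coeff v (f b)) = 0" by auto
    next
      assume a: "\<forall>s\<in>B \<times> V. (case s of (b, v) \<Rightarrow> coeff v (f b)) = 0"
      let ?h = "\<lambda>a b. if a \<in> A then strip a (f b) else \<zero>"
      have h: "?h a \<in> carrier ?F" for a
        using strip_free_closed[OF f, of a] by (cases "a \<in> A") (auto simp: free_module_carrier)
      have "coeff v (f b) = 0" if "v \<in> V" for v b
      proof (cases "b \<in> B")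
        case True then show ?thesis using a that by auto
      next
        case False then show ?thesis using f that coeff_zero by (auto simp: free_module_carrier)
      qed
      then have "f b = (\<Oplus>a\<in>A. arr a \<otimes> strip a (f b))" for b using decomposition_zero_coeff[OF fc[OF f]] by blast
      moreover have "comb ?F A ?h b = (\<Oplus>a\<in>A. arr a \<otimes> strip a (f b))" for b
        unfolding free_comb_apply[of A ?h B b, OF h subset_refl]
        using fc[OF f] by (intro finsum_cong') auto
      ultimately have "f = comb ?F A ?h" by (simp add: fun_eq_iff)
      then show "f \<in> arrow_span ?F A (carrier ?F)" using h unfolding arrow_span_def by blast
    qed
  next
    fix g :: "'i \<times> 'v \<Rightarrow> 'k"
    let ?f = "\<lambda>b. if b \<in> B then \<Oplus>v\<in>V. \<iota> (g (b, v)) \<otimes> idm v else \<zero>"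
    have "finite {b. ?f b \<noteq> \<zero>}" by (rule finite_subset[OF _ assms]) auto
    then have f: "?f \<in> carrier ?F" by (auto simp: free_module_carrier intro!: finsum_closed)
    have "coeff w (?f b) = g (b, w)" if "b \<in> B" "w \<in> V" for b w
    proof -
      have "coeff w (?f b) = (\<Sum>v\<in>V. coeff w (\<iota> (g (b, v)) \<otimes> idm v))"
        using that finite_V by (simp add: coeff_finsum)
      also have "\<dots> = (\<Sum>v\<in>V. if v = w then g (b, v) else 0)"
        using that by (intro sum.cong) (auto simp: coeff_iota coeff_idm)
      finally show ?thesis using that finite_V by simp
    qed
    then show "\<exists>f\<in>carrier ?F. \<forall>s\<in>B \<times> V. (case s of (b, v) \<Rightarrow> coeff v (f b)) = g s"
      using f by (intro bexI[of _ ?f]) auto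
  qed
  then show ?thesis using coords_imp_qdim[of "kmod ?F" _ _ "B \<times> V"] assms finite_V by blast
qed

end

subsection \<open>The standard resolution\<close>

text \<open>
  The basis elements of a term of the resolution remember the elements of the kernel from which they
  were made.
\<close>

lemma syz_val_syz_gen:
  assumes "finite {b. z b \<noteq> \<zero>\<^bsub>R\<^esub>}"
  shows "syz_val R (syz_gen R z) = z"
proof -
  let ?S = "{(b, z b) | b. z b \<noteq> \<zero>\<^bsub>R\<^esub>}"
  have "?S = (\<lambda>b. (b, z b)) ` {b. z b \<noteq> \<zero>\<^bsub>R\<^esub>}" by auto
  then have "finite ?S" using assms by simp
  then have f: "fset (Abs_fset ?S) = ?S" by (intro Abs_fset_inverse) simp
  show ?thesis
  proof
    fix b
    show "syz_val R (syz_gen R z) b = z b"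
      by (cases "z b = \<zero>\<^bsub>R\<^esub>") (auto simp: syz_gen_def f)
  qed
qed

text \<open>
  The kernel of the map that leaves the \<open>n\<close>-th term of the resolution, so the \<open>(n + 1)\<close>-st syzygy.
\<close>

fun syz_kernel :: "('r, 'x) ring_scheme \<Rightarrow> ('r, 'm, 'y) module_scheme \<Rightarrow> nat \<Rightarrow> (('m, 'r) gen \<Rightarrow> 'r) set" where
  "syz_kernel R M 0 = {z \<in> carrier (res_module R M 0). res_aug R M z = \<zero>\<^bsub>M\<^esub>}"
| "syz_kernel R M (Suc n) = {z \<in> carrier (res_module R M (Suc n)). res_diff R z = (\<lambda>b. \<zero>\<^bsub>R\<^esub>)}"

lemma res_basis_Suc: "res_basis R M (Suc n) = syz_gen R ` syz_kernel R M n"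
  by (cases n) (auto simp: res_module_def)

lemma syz_kernel_subset: "syz_kernel R M n \<subseteq> carrier (res_module R M n)"
  by (cases n) auto

lemma syz_val_image: "syz_val R ` res_basis R M (Suc n) = syz_kernel R M n"
proof -
  have "syz_val R (syz_gen R z) = z" if "z \<in> syz_kernel R M n" for z
    using that syz_kernel_subset[of R M n] by (intro syz_val_syz_gen) (auto simp: res_module_def free_module_carrier subset_iff)
  then show ?thesis unfolding res_basis_Suc by (force simp: image_image)
qed

lemma left_module_res: "ring R \<Longrightarrow> left_module R (res_module R M n)"
  by (simp add: res_module_def left_module_free)

lemma res_aug_lmap:
  assumes M: "left_module R M"
  shows "lmap R (res_module R M 0) M (res_aug R M)" "res_aug R M ` carrier (res_module R M 0) = carrier M"
proof -
  interpret M: left_module R M by fact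
  have e: "res_aug R M = linear_extension R M elem_val"
    by (simp add: fun_eq_iff res_aug_def linear_extension_def)
  show "lmap R (res_module R M 0) M (res_aug R M)"
    unfolding e res_module_def by (rule lmap_linear_extension[OF M]) auto
  show "res_aug R M ` carrier (res_module R M 0) = carrier M"
    unfolding e res_module_def
    by (rule linear_extension_image[OF M]) (auto simp: submod_def M.lsmult_closed image_image)
qed

lemma res_diff_eq_linear_extension:
  assumes "ring R" and f: "f \<in> carrier (res_module R M (Suc n))"
  shows "res_diff R f = linear_extension R (res_module R M n) (syz_val R) f"
proof -
  interpret F: left_module R "res_module R M n" by (rule left_module_res[OF assms(1)])
  have v: "syz_val R s \<in> carrier (res_module R M n)" if "f s \<noteq> \<zero>\<^bsub>R\<^esub>" for s
  proof -
    have "s \<in> res_basis R M (Suc n)" using f that unfolding res_module_def free_module_carrier by blast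
    then show ?thesis using syz_val_image[of R M n] syz_kernel_subset[of R M n] by blast
  qed
  have fin: "finite {s. f s \<noteq> \<zero>\<^bsub>R\<^esub>}" "\<And>s. f s \<in> carrier R"
    using f by (auto simp: res_module_def free_module_carrier)
  show ?thesis
  proof
    fix b
    have "linear_extension R (res_module R M n) (syz_val R) f b
        = (\<Oplus>\<^bsub>R\<^esub>s\<in>{s. f s \<noteq> \<zero>\<^bsub>R\<^esub>}. (f s \<odot>\<^bsub>res_module R M n\<^esub> syz_val R s) b)"
      unfolding linear_extension_def res_module_def
      using F.lsmult_closed[OF fin(2) v]
      by (intro free_module_finsum_apply assms(1) fin(1)) (auto simp: res_module_def)
    then show "res_diff R f b = linear_extension R (res_module R M n) (syz_val R) f b"
      by (simp add: res_diff_def res_module_def)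
  qed
qed

context monomial_ring
begin

lemma submod_syz_kernel_0:
  assumes "left_module R M" shows "submod R (res_module R M 0) (syz_kernel R M 0)"
  using submod_kernel[OF left_module_res[OF ring_axioms] assms res_aug_lmap(1)[OF assms]] by simp

text \<open>
  Each kernel is a submodule because the preceding differential is linear, and this in turn makes the
  next differential map onto that kernel.
\<close>

lemma res_diff_lmap:
  assumes M: "left_module R M"
  shows "lmap R (res_module R M (Suc n)) (res_module R M n) (res_diff R)
    \<and> res_diff R ` carrier (res_module R M (Suc n)) = syz_kernel R M n
    \<and> submod R (res_module R M n) (syz_kernel R M n)"
proof -
  have step: "lmap R (res_module R M (Suc n)) (res_module R M n) (res_diff R)
    \<and> res_diff R ` carrier (res_module R M (Suc n)) = syz_kernel R M n"
    if sub: "submod R (res_module R M n) (syz_kernel R M n)" for n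
  proof -
    let ?L = "linear_extension R (res_module R M n) (syz_val R)"
    interpret F: left_module R "res_module R M (Suc n)" by (rule left_module_res[OF ring_axioms])
    have e: "res_diff R f = ?L f" if "f \<in> carrier (res_module R M (Suc n))" for f
      using res_diff_eq_linear_extension[OF ring_axioms that] .
    have "lmap R (res_module R M (Suc n)) (res_module R M n) ?L"
      unfolding res_module_def[of R M "Suc n"]
      using syz_val_image[of R M n] syz_kernel_subset[of R M n]
      by (intro lmap_linear_extension left_module_res ring_axioms) blast
    moreover have "?L ` carrier (res_module R M (Suc n)) = syz_kernel R M n"
      unfolding res_module_def[of R M "Suc n"]
      by (rule linear_extension_image[OF left_module_res[OF ring_axioms] sub syz_val_image])
    ultimately show ?thesis using e F.lsmult_closed unfolding lmap_def by (simp add: image_def)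
  qed
  have "submod R (res_module R M n) (syz_kernel R M n)"
  proof (induction n)
    case 0
    show ?case by (rule submod_syz_kernel_0[OF M])
  next
    case (Suc n)
    have z: "\<zero>\<^bsub>res_module R M n\<^esub> = (\<lambda>b. \<zero>)" by (simp add: res_module_def)
    show ?case
      using submod_kernel[OF left_module_res[OF ring_axioms] left_module_res[OF ring_axioms] conjunct1[OF step[OF Suc]]]
      by (simp add: z)
  qed
  then show ?thesis using step by blast
qed

end

context monomial_target
begin

text \<open>
  The module \<open>P\<close> stands for a finitely generated free module and \<open>G\<close> for one that covers the kernel of
  \<open>P \<rightarrow> M\<close>. The numbers \<open>w n c\<close> are the dimensions of the quotients attached to the syzygy \<open>K n\<close> and the
  set \<open>perp c\<close>. Ext in degree \<open>n + 1\<close> is dual to the quotient for \<open>K n\<close> and all arrows, and the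
  recurrence expresses that dimension by the numbers \<open>w (n - 1) c\<close> once \<open>n \<ge> 1\<close>; this is why the formula
  starts in degree two.
\<close>

theorem ext_dimensions:
  assumes M: "left_module R M"
    and P: "left_module R P" "arrow_free P" "lmap R P M p" "p ` carrier P = carrier M"
      "qdim (kmod P) (carrier P) (arrow_span P A (carrier P)) dP"
    and G: "left_module R G" "lmap R G P g" "g ` carrier G = {x \<in> carrier P. p x = \<zero>\<^bsub>M\<^esub>}"
      "qdim (kmod G) (carrier G) (arrow_span G A (carrier G)) dG"
  shows "\<exists>w. (\<forall>n. finite_dimensional (Ext \<iota> R n M N)) \<and>
    (\<forall>n. dimension (Ext \<iota> R (Suc (Suc n)) M N) = (\<Sum>c\<in>A. w n c)) \<and>
    (\<forall>n. \<forall>c\<in>A. w (Suc n) c = (\<Sum>b\<in>perp c. w n b))"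
proof -
  interpret M: left_module R M by fact
  define F where "F n = res_module R M n" for n
  define K where "K n = syz_kernel R M n" for n
  have F: "left_module R (F n)" "arrow_free (F n)" for n
    unfolding F_def using left_module_res[OF ring_axioms] arrow_free_free by (auto simp: res_module_def)
  have z: "\<zero>\<^bsub>F n\<^esub> = (\<lambda>b. \<zero>)" for n by (simp add: F_def res_module_def)
  have aug: "lmap R (F 0) M (res_aug R M)" "res_aug R M ` carrier (F 0) = carrier M"
    unfolding F_def using res_aug_lmap[OF M] by auto
  have diff: "lmap R (F (Suc n)) (F n) (res_diff R)" "res_diff R ` carrier (F (Suc n)) = K n" "submod R (F n) (K n)" for n
    unfolding F_def K_def using res_diff_lmap[OF M, of n] by auto
  have K0: "K 0 = {z \<in> carrier (F 0). res_aug R M z = \<zero>\<^bsub>M\<^esub>}" by (simp add: K_def F_def)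
  have KS: "K (Suc n) = {z \<in> carrier (F (Suc n)). res_diff R z = \<zero>\<^bsub>F n\<^esub>}" for n by (simp add: K_def F_def[symmetric] z)
  let ?q = "\<lambda>n B. qdim (kmod (F n)) (K n \<inter> arrow_span (F n) B (carrier (F n))) (arrow_span (F n) B (K n))"
  (* Finiteness is known for the kernel of P -> M and is carried over to the first syzygy of the
     standard resolution, since both are described by the relations in M. *)
  have "\<exists>d. ?q 0 B d" if B: "B \<subseteq> A" for B
  proof -
    let ?K = "{x \<in> carrier P. p x = \<zero>\<^bsub>M\<^esub>}"
    have Ks: "submod R P ?K" by (rule submod_kernel[OF P(1) M P(3)])
    have "\<exists>d. qdim (kmod P) (?K \<inter> arrow_span P B (carrier P)) (arrow_span P B ?K) d"
    proof (rule qdim_image[OF G(1) P(1) G(2) G(4)])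
      show "ksub (kmod P) (?K \<inter> arrow_span P B (carrier P))"
        using submod_ksub[OF Ks] ksub_arrow_span[OF P(1) submod_carrier[OF P(1)] B] by (auto simp: ksub_def)
      show "?K \<inter> arrow_span P B (carrier P) \<subseteq> g ` carrier G" unfolding G(3) by blast
      show "ksub (kmod P) (arrow_span P B ?K)" by (rule ksub_arrow_span[OF P(1) Ks B])
      show "arrow_span P B ?K \<subseteq> ?K \<inter> arrow_span P B (carrier P)"
        using arrow_span_subset[OF P(1) Ks B] arrow_span_mono[OF P(1), of ?K "carrier P" B] by blast
      show "arrow_span P A (g ` carrier G) \<inter> (?K \<inter> arrow_span P B (carrier P)) \<subseteq> arrow_span P B ?K"
        unfolding G(3) using arrow_span_inter[OF P(1,2) Ks B] by blast
    qed
    then show ?thesis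
      using syzygy_relations[OF P(1,2) M submod_carrier[OF M] P(3,4) B refl]
        syzygy_relations[OF F M submod_carrier[OF M] aug B K0] by blast
  qed
  then obtain u0 where u0: "\<And>B. B \<subseteq> A \<Longrightarrow> ?q 0 B (u0 B)" by metis
  (* The recurrence defines the numbers; that they are the dimensions is then an induction. *)
  define u where "u = rec_nat u0 (\<lambda>n u B. \<Sum>c\<in>B. u (perp c))"
  have uS: "u (Suc n) B = (\<Sum>c\<in>B. u n (perp c))" for n B by (simp add: u_def)
  have u: "?q n B (u n B)" if "B \<subseteq> A" for n B
    using that
  proof (induction n arbitrary: B)
    case 0
    then show ?case using u0 by (simp add: u_def)
  next
    case (Suc n)
    have "?q n (perp c) (u n (perp c))" if "c \<in> B" for c
      using Suc perp_subset that by blast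
    then have "qdim (fun_space (F n)) (relations (F n) B (K n)) (trivial_relations (F n) B (K n)) (u (Suc n) B)"
      unfolding uS by (rule relations_in_arrow_free[OF F diff(3) Suc.prems])
    then show ?case
      using syzygy_relations[OF F F(1) diff(3) diff(1,2) Suc.prems KS] by blast
  qed
  have ker_iff: "(\<forall>x\<in>carrier (F (Suc n)). f (res_diff R x) = \<zero>\<^bsub>N\<^esub>) \<longleftrightarrow> (\<forall>y\<in>K n. f y = \<zero>\<^bsub>N\<^esub>)" for n and f :: "_ \<Rightarrow> 'n"
    unfolding diff(2)[symmetric] by blast
  have ext0: "finite_dimensional (Ext \<iota> R 0 M N)"
  proof -
    have "\<exists>d. qdim (kmod M) (carrier M) (arrow_span M A (carrier M)) d"
    proof (rule qdim_image[OF P(1) M P(3) P(5)])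
      show "ksub (kmod M) (carrier M)" by (rule submod_ksub[OF submod_carrier[OF M]])
      show "ksub (kmod M) (arrow_span M A (carrier M))" by (rule ksub_arrow_span[OF M submod_carrier[OF M] subset_refl])
      show "arrow_span M A (carrier M) \<subseteq> carrier M" by (rule arrow_span_subset[OF M submod_carrier[OF M] subset_refl])
    qed (auto simp: P(4))
    then obtain d where d: "qdim (kmod M) (carrier M) (arrow_span M A (carrier M)) d" by blast
    show ?thesis unfolding Ext_def F_def[symmetric]
    proof (rule cohomology_dimension(1)[OF F(1) M submod_carrier[OF M] aug _ submod_ksub[OF submod_carrier[OF M]] subset_refl _ _ d])
      show Z: "ext_cocycles R M N 0 = {f \<in> lmod_hom R (F 0) N. \<forall>y\<in>carrier (F 0). res_aug R M y = \<zero>\<^bsub>M\<^esub> \<longrightarrow> f y = \<zero>\<^bsub>N\<^esub>}"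
        unfolding ext_cocycles_def F_def[symmetric] ker_iff K0 by blast
      have zero: "(\<lambda>x\<in>carrier (F 0). \<zero>\<^bsub>N\<^esub>) \<in> lmod_hom R (F 0) N"
        using abelian_monoid.zero_closed[OF abelian_group.axioms(1)[OF kspace.axioms(1)[OF kspace_hom_space[OF F(1)]]], of 0]
        by (simp add: hom_space_def)
      show "ext_coboundaries R M N 0 \<subseteq> ext_cocycles R M N 0"
        unfolding Z using zero by (simp add: F_def)
      fix f assume f: "f \<in> ext_cocycles R M N 0"
      show "f \<in> ext_coboundaries R M N 0 \<longleftrightarrow> (\<forall>y\<in>carrier (F 0). res_aug R M y \<in> carrier M \<longrightarrow> \<sigma> (f y) = 0)"
      proof
        assume "f \<in> ext_coboundaries R M N 0"
        then show "\<forall>y\<in>carrier (F 0). res_aug R M y \<in> carrier M \<longrightarrow> \<sigma> (f y) = 0"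
          by (auto simp: F_def sigma_zero)
      next
        assume a: "\<forall>y\<in>carrier (F 0). res_aug R M y \<in> carrier M \<longrightarrow> \<sigma> (f y) = 0"
        have "f = (\<lambda>x\<in>carrier (F 0). \<zero>\<^bsub>N\<^esub>)"
          using f a lmapD(1)[OF aug(1)] unfolding Z by (intro hom_eqI[OF _ zero F(1)]) (auto simp: sigma_zero)
        then show "f \<in> ext_coboundaries R M N 0" by (simp add: F_def)
      qed
    qed
  qed
  have extS: "finite_dimensional (Ext \<iota> R (Suc n) M N) \<and> dimension (Ext \<iota> R (Suc n) M N) = u n A" for n
  proof -
    let ?p = "res_diff R"
    let ?U = "K n \<inter> arrow_span (F n) A (carrier (F n))"
    have Z: "ext_cocycles R M N (Suc n) = {f \<in> lmod_hom R (F (Suc n)) N. \<forall>y\<in>carrier (F (Suc n)). ?p y = \<zero>\<^bsub>F n\<^esub> \<longrightarrow> f y = \<zero>\<^bsub>N\<^esub>}"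
      unfolding ext_cocycles_def F_def[symmetric] ker_iff KS by blast
    have Bd: "ext_coboundaries R M N (Suc n) = (\<lambda>g. \<lambda>x\<in>carrier (F (Suc n)). g (?p x)) ` lmod_hom R (F n) N"
      by (simp add: F_def)
    have U: "ksub (kmod (F n)) ?U"
      using submod_ksub[OF diff(3), of n] ksub_arrow_span[OF F(1) submod_carrier[OF F(1)] subset_refl, of n] by (auto simp: ksub_def)
    have sub: "ext_coboundaries R M N (Suc n) \<subseteq> ext_cocycles R M N (Suc n)"
    proof
      fix f assume "f \<in> ext_coboundaries R M N (Suc n)"
      then obtain g where g: "g \<in> lmod_hom R (F n) N" "f = (\<lambda>x\<in>carrier (F (Suc n)). g (?p x))" unfolding Bd by auto
      have gl: "lmap R (F n) N g" using g by (simp add: lmod_hom_iff)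
      interpret Fn: left_module R "F n" by (rule F(1))
      interpret FS: left_module R "F (Suc n)" by (rule F(1))
      interpret N: left_module R N by (rule N)
      have g0: "g \<zero>\<^bsub>F n\<^esub> = \<zero>\<^bsub>N\<^esub>"
        using additive_zero[OF Fn.abelian_group_axioms N.abelian_group_axioms, of g] lmapD[OF gl] by blast
      have "lmap R (F (Suc n)) N f"
        unfolding lmap_def g(2) using lmapD[OF gl] lmapD[OF diff(1)[of n]] FS.lsmult_closed by simp
      then have "f \<in> lmod_hom R (F (Suc n)) N" by (simp add: lmod_hom_iff g(2))
      then show "f \<in> ext_cocycles R M N (Suc n)" unfolding Z using g0 by (simp add: g(2))
    qed
    have iff: "f \<in> ext_coboundaries R M N (Suc n) \<longleftrightarrow> (\<forall>y\<in>carrier (F (Suc n)). ?p y \<in> ?U \<longrightarrow> \<sigma> (f y) = 0)"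
      if "f \<in> ext_cocycles R M N (Suc n)" for f
      unfolding Bd using that unfolding Z by (intro coboundary_iff[OF F(1) F(1) diff(3) diff(1,2)]) auto
    note cd = cohomology_dimension[OF F(1) F(1) diff(3) diff(1,2) Z U _ sub iff u[OF subset_refl]]
    show ?thesis using cd unfolding Ext_def F_def[symmetric] by blast
  qed
  have "finite_dimensional (Ext \<iota> R n M N)" for n
    using ext0 extS by (cases n) auto
  then show ?thesis using extS uS by (intro exI[of _ "\<lambda>n c. u n (perp c)"]) auto
qed

end

section \<open>The path algebra\<close>

lemma poly_mapping_sum_induct [consumes 1, case_names zero add]:
  fixes x :: "'p \<Rightarrow>\<^sub>0 'k::comm_monoid_add"
  assumes "Poly_Mapping.keys x \<subseteq> S" "P 0"
    and "\<And>y p c. \<lbrakk>Poly_Mapping.keys y \<subseteq> S; P y; p \<in> S\<rbrakk> \<Longrightarrow> P (Poly_Mapping.single p c + y)"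
  shows "P x"
proof -
  have x: "x = (\<Sum>p\<in>Poly_Mapping.keys x. Poly_Mapping.single p (Poly_Mapping.lookup x p))"
    by (rule poly_mapping_eqI) (auto simp: lookup_sum lookup_single when_def in_keys_iff)
  have "P (\<Sum>p\<in>T. Poly_Mapping.single p (f p)) \<and> Poly_Mapping.keys (\<Sum>p\<in>T. Poly_Mapping.single p (f p)) \<subseteq> S"
    if "finite T" "T \<subseteq> S" for T f
    using that
  proof (induction T rule: finite_induct)
    case (insert p T)
    then show ?case
      using assms(3) keys_add[of "Poly_Mapping.single p (f p)" "\<Sum>p\<in>T. Poly_Mapping.single p (f p)"]
      by (auto split: if_splits)
  qed (use assms(2) in auto)
  then show ?thesis using x assms(1) by (metis finite_keys)
qed

lemma path_mult_superset:
  assumes "finite S" "Poly_Mapping.keys x \<subseteq> S" "finite T" "Poly_Mapping.keys y \<subseteq> T"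
  shows "path_mult Q x y = (\<Sum>p\<in>S. \<Sum>q\<in>T. if path_target Q q = fst p
     then Poly_Mapping.single (fst q, snd q @ snd p) (Poly_Mapping.lookup x p * Poly_Mapping.lookup y q) else 0)"
proof -
  have "path_mult Q x y = (\<Sum>p\<in>Poly_Mapping.keys x. \<Sum>q\<in>T. if path_target Q q = fst p
     then Poly_Mapping.single (fst q, snd q @ snd p) (Poly_Mapping.lookup x p * Poly_Mapping.lookup y q) else 0)"
    unfolding path_mult_def using assms
    by (intro sum.cong refl sum.mono_neutral_left) (auto simp: in_keys_iff)
  also have "\<dots> = (\<Sum>p\<in>S. \<Sum>q\<in>T. if path_target Q q = fst p
     then Poly_Mapping.single (fst q, snd q @ snd p) (Poly_Mapping.lookup x p * Poly_Mapping.lookup y q) else 0)"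
    using assms by (intro sum.mono_neutral_left) (auto simp: in_keys_iff intro!: sum.neutral)
  finally show ?thesis .
qed

lemma path_mult_add_left: "path_mult Q (x + x') y = path_mult Q x y + path_mult Q x' y"
proof -
  let ?S = "Poly_Mapping.keys x \<union> Poly_Mapping.keys x'"
  have S: "finite ?S" "Poly_Mapping.keys x \<subseteq> ?S" "Poly_Mapping.keys x' \<subseteq> ?S" "Poly_Mapping.keys (x + x') \<subseteq> ?S"
    using keys_add[of x x'] by auto
  show ?thesis
    unfolding path_mult_superset[OF S(1,2) finite_keys subset_refl] path_mult_superset[OF S(1,3) finite_keys subset_refl]
      path_mult_superset[OF S(1,4) finite_keys subset_refl] sum.distrib[symmetric]
    by (intro sum.cong refl) (auto simp: lookup_add algebra_simps single_add)
qed

lemma path_mult_add_right: "path_mult Q x (y + y') = path_mult Q x y + path_mult Q x y'"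
proof -
  let ?S = "Poly_Mapping.keys y \<union> Poly_Mapping.keys y'"
  have S: "finite ?S" "Poly_Mapping.keys y \<subseteq> ?S" "Poly_Mapping.keys y' \<subseteq> ?S" "Poly_Mapping.keys (y + y') \<subseteq> ?S"
    using keys_add[of y y'] by auto
  show ?thesis
    unfolding path_mult_superset[OF finite_keys subset_refl S(1,2)] path_mult_superset[OF finite_keys subset_refl S(1,3)]
      path_mult_superset[OF finite_keys subset_refl S(1,4)] sum.distrib[symmetric]
    by (intro sum.cong refl) (auto simp: lookup_add algebra_simps single_add)
qed

lemma path_mult_zero [simp]: "path_mult Q 0 y = 0" "path_mult Q x 0 = 0"
  by (auto simp: path_mult_def)

lemma path_mult_sum_left: "path_mult Q (sum f S) y = (\<Sum>i\<in>S. path_mult Q (f i) y)"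
  by (induction S rule: infinite_finite_induct) (auto simp: path_mult_add_left)

lemma path_mult_sum_right: "path_mult Q x (sum f S) = (\<Sum>i\<in>S. path_mult Q x (f i))"
  by (induction S rule: infinite_finite_induct) (auto simp: path_mult_add_right)

lemma path_mult_single:
  "path_mult Q (Poly_Mapping.single p c) (Poly_Mapping.single q d) =
    (if path_target Q q = fst p then Poly_Mapping.single (fst q, snd q @ snd p) (c * d) else 0)"
  by (subst path_mult_superset[of "{p}" _ "{q}"]) auto

lemma lookup_single_mult:
  "Poly_Mapping.lookup (path_mult Q (Poly_Mapping.single p c) y) r =
    (\<Sum>q\<in>Poly_Mapping.keys y. if path_target Q q = fst p \<and> (fst q, snd q @ snd p) = r then c * Poly_Mapping.lookup y q else 0)"
  by (subst path_mult_superset[of "{p}" _ "Poly_Mapping.keys y"])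
    (auto simp: lookup_sum lookup_single when_def intro!: sum.cong)

lemma keys_path_mult:
  assumes "r \<in> Poly_Mapping.keys (path_mult Q x y)"
  obtains p q where "p \<in> Poly_Mapping.keys x" "q \<in> Poly_Mapping.keys y" "path_target Q q = fst p" "r = (fst q, snd q @ snd p)"
proof -
  let ?f = "\<lambda>p q. if path_target Q q = fst p
     then Poly_Mapping.single (fst q, snd q @ snd p) (Poly_Mapping.lookup x p * Poly_Mapping.lookup y q) else 0"
  have "r \<in> Poly_Mapping.keys (\<Sum>p\<in>Poly_Mapping.keys x. \<Sum>q\<in>Poly_Mapping.keys y. ?f p q)"
    using assms by (simp only: path_mult_def)
  from subsetD[OF keys_sum this] obtain p where p: "p \<in> Poly_Mapping.keys x" "r \<in> Poly_Mapping.keys (\<Sum>q\<in>Poly_Mapping.keys y. ?f p q)"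
    by auto
  from subsetD[OF keys_sum p(2)] obtain q where "q \<in> Poly_Mapping.keys y" "r \<in> Poly_Mapping.keys (?f p q)"
    by auto
  then show ?thesis using p that by (auto split: if_splits)
qed

text \<open>
  The set \<open>\<rho>\<close> of forbidden paths is kept as a parameter, since the ideal alone does not display the
  basis of paths of the quotient.
\<close>

locale quadratic_relations = fin_digraph Q for Q :: "('v, 'a) pre_digraph" +
  fixes \<rho> :: "('v, 'a) qpath set"
  assumes rho: "\<rho> \<subseteq> {p \<in> paths Q. path_length p = 2}"
begin

lemma target_append: "path_target Q (u, l @ m) = path_target Q (path_target Q (u, l), m)"
  by (simp add: path_target_def awlast_append)

lemma target_Nil [simp]: "path_target Q (u, []) = u"
  by (simp add: path_target_def)

lemma target_single [simp]: "path_target Q (u, [a]) = head Q a"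
  by (simp add: path_target_def)

lemma paths_iff: "(u, l) \<in> paths Q \<longleftrightarrow> awalk u l (path_target Q (u, l))"
  by (auto simp: paths_def path_target_def)

lemma paths_append: "(u, l @ m) \<in> paths Q \<longleftrightarrow> (u, l) \<in> paths Q \<and> (path_target Q (u, l), m) \<in> paths Q"
  unfolding paths_iff target_append by (auto simp: path_target_def)

lemma paths_Nil [simp]: "(u, []) \<in> paths Q \<longleftrightarrow> u \<in> verts Q"
  by (simp add: paths_iff awalk_Nil_iff)

lemma paths_single [simp]: "(u, [a]) \<in> paths Q \<longleftrightarrow> a \<in> arcs Q \<and> u = tail Q a"
  by (auto simp: paths_iff awalk_Cons_iff awalk_Nil_iff)

lemma target_in_verts: "p \<in> paths Q \<Longrightarrow> path_target Q p \<in> verts Q"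
  by (cases p) (auto simp: paths_iff awalk_def intro: awlast_in_verts simp: path_target_def dest: awalk_last_in_verts)

lemma path_mult_assoc: "path_mult Q (path_mult Q x y) z = path_mult Q x (path_mult Q y z)"
proof -
  have 1: "path_mult Q (path_mult Q (Poly_Mapping.single p c) (Poly_Mapping.single q d)) (Poly_Mapping.single r e)
      = path_mult Q (Poly_Mapping.single p c) (path_mult Q (Poly_Mapping.single q d) (Poly_Mapping.single r e))" for p q r c d e
    using target_append[of "fst r" "snd r" "snd q"] by (auto simp: path_mult_single mult.assoc)
  have 2: "path_mult Q (path_mult Q (Poly_Mapping.single p c) (Poly_Mapping.single q d)) z
      = path_mult Q (Poly_Mapping.single p c) (path_mult Q (Poly_Mapping.single q d) z)" for p q c d
    by (rule poly_mapping_sum_induct[of z UNIV]) (auto simp: path_mult_add_right 1)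
  have 3: "path_mult Q (path_mult Q (Poly_Mapping.single p c) y) z
      = path_mult Q (Poly_Mapping.single p c) (path_mult Q y z)" for p c
    by (rule poly_mapping_sum_induct[of y UNIV]) (auto simp: path_mult_add_right path_mult_add_left 2)
  show ?thesis
    by (rule poly_mapping_sum_induct[of x UNIV]) (auto simp: path_mult_add_left 3)
qed

lemma path_mult_closed:
  assumes "Poly_Mapping.keys x \<subseteq> paths Q" "Poly_Mapping.keys y \<subseteq> paths Q"
  shows "Poly_Mapping.keys (path_mult Q x y) \<subseteq> paths Q"
proof
  fix r assume "r \<in> Poly_Mapping.keys (path_mult Q x y)"
  then obtain p q where "p \<in> Poly_Mapping.keys x" "q \<in> Poly_Mapping.keys y" "path_target Q q = fst p" "r = (fst q, snd q @ snd p)"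
    by (rule keys_path_mult)
  then show "r \<in> paths Q" using subsetD[OF assms(1), of p] subsetD[OF assms(2), of q] by (simp add: paths_append)
qed

lemma lookup_path_scalar: "Poly_Mapping.lookup (path_scalar Q c) p = (if snd p = [] \<and> fst p \<in> verts Q then c else 0)"
proof -
  have "Poly_Mapping.lookup (path_scalar Q c) p = (\<Sum>v\<in>verts Q. if (v, []) = p then c else 0)"
    by (simp add: path_scalar_def lookup_sum lookup_single when_def)
  also have "\<dots> = (\<Sum>v\<in>verts Q. if v = fst p then (if snd p = [] then c else 0) else 0)"
    by (intro sum.cong) (cases p; auto)+
  finally show ?thesis by simp
qed

lemma path_scalar_closed: "Poly_Mapping.keys (path_scalar Q c) \<subseteq> paths Q"
  by (auto simp: in_keys_iff lookup_path_scalar split: if_splits)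

lemma path_scalar_mult_single:
  assumes "p \<in> paths Q"
  shows "path_mult Q (path_scalar Q c) (Poly_Mapping.single p d) = Poly_Mapping.single p (c * d)"
    "path_mult Q (Poly_Mapping.single p d) (path_scalar Q c) = Poly_Mapping.single p (c * d)"
proof -
  have f: "fst p \<in> verts Q" using assms by (cases p) (auto simp: paths_iff awalk_def)
  have "path_mult Q (path_scalar Q c) (Poly_Mapping.single p d) = (\<Sum>v\<in>verts Q. if path_target Q p = v then Poly_Mapping.single p (c * d) else 0)"
    by (simp add: path_scalar_def path_mult_sum_left path_mult_single)
  then show "path_mult Q (path_scalar Q c) (Poly_Mapping.single p d) = Poly_Mapping.single p (c * d)"
    using target_in_verts[OF assms] by simp
  have "path_mult Q (Poly_Mapping.single p d) (path_scalar Q c) = (\<Sum>v\<in>verts Q. if v = fst p then Poly_Mapping.single p (c * d) else 0)"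
    unfolding path_scalar_def path_mult_sum_right path_mult_single
    by (intro sum.cong) (cases p; auto simp: mult.commute)+
  then show "path_mult Q (Poly_Mapping.single p d) (path_scalar Q c) = Poly_Mapping.single p (c * d)"
    using f by simp
qed

lemma lookup_path_scalar_mult:
  assumes "Poly_Mapping.keys x \<subseteq> paths Q"
  shows "Poly_Mapping.lookup (path_mult Q (path_scalar Q c) x) p = c * Poly_Mapping.lookup x p"
  using assms by (induction rule: poly_mapping_sum_induct)
    (auto simp: path_mult_add_right path_scalar_mult_single lookup_add lookup_single when_def algebra_simps)

lemma path_scalar_central:
  assumes "Poly_Mapping.keys x \<subseteq> paths Q"
  shows "path_mult Q (path_scalar Q c) x = path_mult Q x (path_scalar Q c)"
  using assms by (induction rule: poly_mapping_sum_induct)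
    (auto simp: path_mult_add_right path_mult_add_left path_scalar_mult_single)

abbreviation PA :: "(('v, 'a) qpath \<Rightarrow>\<^sub>0 'k::field) ring" where
  "PA \<equiv> path_algebra Q"

lemma PA_simps [simp]:
  "x \<in> carrier PA \<longleftrightarrow> Poly_Mapping.keys x \<subseteq> paths Q" "x \<otimes>\<^bsub>PA\<^esub> y = path_mult Q x y" "\<one>\<^bsub>PA\<^esub> = path_scalar Q 1"
  "\<zero>\<^bsub>PA\<^esub> = 0" "x \<oplus>\<^bsub>PA\<^esub> y = x + y"
  by (auto simp: path_algebra_def)

lemma keys_add_subset: "Poly_Mapping.keys x \<subseteq> S \<Longrightarrow> Poly_Mapping.keys y \<subseteq> S \<Longrightarrow> Poly_Mapping.keys (x + y) \<subseteq> S"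
  using keys_add[of x y] by auto

lemma ring_PA: "ring (PA :: (('v, 'a) qpath \<Rightarrow>\<^sub>0 'k::field) ring)"
proof (intro ringI abelian_groupI monoidI)
  fix x :: "('v, 'a) qpath \<Rightarrow>\<^sub>0 'k" assume x: "x \<in> carrier PA"
  show "\<one>\<^bsub>PA\<^esub> \<otimes>\<^bsub>PA\<^esub> x = x"
    using x by (intro poly_mapping_eqI) (simp add: lookup_path_scalar_mult)
  then show "x \<otimes>\<^bsub>PA\<^esub> \<one>\<^bsub>PA\<^esub> = x" using x path_scalar_central[of x 1] by simp
  show "\<exists>y\<in>carrier PA. y \<oplus>\<^bsub>PA\<^esub> x = \<zero>\<^bsub>PA\<^esub>"
    using x by (intro bexI[of _ "- x"]) auto
qed (simp_all add: path_mult_assoc path_mult_add_left path_mult_add_right ac_simps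
    path_mult_closed path_scalar_closed keys_add_subset)

sublocale PA: ring "PA :: (('v, 'a) qpath \<Rightarrow>\<^sub>0 'k::field) ring" by (rule ring_PA)

lemma PA_minus: "x \<in> carrier PA \<Longrightarrow> y \<in> carrier PA \<Longrightarrow> x \<ominus>\<^bsub>PA\<^esub> y = x - y"
proof -
  assume a: "x \<in> carrier PA" "y \<in> carrier PA"
  then have "\<ominus>\<^bsub>PA\<^esub> y = - y" by (intro PA.minus_equality) auto
  then show ?thesis by (simp add: a_minus_def)
qed

section \<open>The quotient by quadratic relations\<close>

text \<open>
  In traversal order: \<open>a\<close> first, then \<open>b\<close>. In the algebra this is the product \<open>b a\<close>.
\<close>

definition blocked :: "'a \<Rightarrow> 'a \<Rightarrow> bool" where
  "blocked a b \<longleftrightarrow> (tail Q a, [a, b]) \<in> \<rho>"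

abbreviation admissible :: "'a list \<Rightarrow> bool" where
  "admissible l \<equiv> successively (\<lambda>a b. \<not> blocked a b) l"

lemma blockedD: "blocked a b \<Longrightarrow> a \<in> arcs Q \<and> b \<in> arcs Q \<and> head Q a = tail Q b"
  using rho unfolding blocked_def by (auto simp: paths_iff awalk_Cons_iff awalk_Nil_iff)

lemma rho_blocked: "p \<in> \<rho> \<Longrightarrow> \<exists>a b. p = (tail Q a, [a, b]) \<and> blocked a b"
proof -
  assume p: "p \<in> \<rho>"
  then have "p \<in> paths Q" "length (snd p) = 2" using rho by auto
  then obtain u a b where ab: "p = (u, [a, b])" by (cases p) (auto simp: length_Suc_conv numeral_2_eq_2)
  then have "u = tail Q a" using \<open>p \<in> paths Q\<close> by (auto simp: paths_iff awalk_Cons_iff)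
  then show ?thesis using ab p by (auto simp: blocked_def)
qed

lemma admissible_snoc: "admissible (l @ [a]) \<longleftrightarrow> admissible l \<and> (l \<noteq> [] \<longrightarrow> \<not> blocked (last l) a)"
  by (auto simp: successively_append_iff)

lemma not_admissible_split: "\<not> admissible l \<Longrightarrow> \<exists>l1 a b l2. l = l1 @ [a, b] @ l2 \<and> blocked a b"
proof (induction l rule: rev_induct)
  case (snoc x l)
  show ?case
  proof (cases "admissible l")
    case True
    then have "l \<noteq> []" "blocked (last l) x" using snoc.prems by (auto simp: admissible_snoc)
    then have "l @ [x] = butlast l @ [last l, x] @ []" by simp
    then show ?thesis using \<open>blocked (last l) x\<close> by blast
  next
    case False
    then obtain l1 a b l2 where "l = l1 @ [a, b] @ l2" "blocked a b" using snoc.IH by blast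
    then show ?thesis by (intro exI[of _ l1] exI[of _ a] exI[of _ b] exI[of _ "l2 @ [x]"]) simp
  qed
qed auto

definition relation_ideal :: "(('v, 'a) qpath \<Rightarrow>\<^sub>0 'k::field) set" where
  "relation_ideal = Idl\<^bsub>PA\<^esub> ((\<lambda>p. Poly_Mapping.single p 1) ` \<rho>)"

lemma generators_closed: "(\<lambda>p. Poly_Mapping.single p (1::'k::field)) ` \<rho> \<subseteq> carrier PA"
  using rho by auto

lemma ideal_relation_ideal: "ideal (relation_ideal :: (('v, 'a) qpath \<Rightarrow>\<^sub>0 'k::field) set) PA"
  unfolding relation_ideal_def by (rule PA.genideal_ideal[OF generators_closed])

text \<open>
  A monomial ideal is spanned by the paths that it contains: the paths with a factor in \<open>\<rho>\<close> span an ideal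
  that contains \<open>\<rho>\<close>, and each of them is a product of an element of \<open>\<rho>\<close> with two further paths.
\<close>

lemma relation_ideal_eq: "relation_ideal = {x :: ('v, 'a) qpath \<Rightarrow>\<^sub>0 'k::field. Poly_Mapping.keys x \<subseteq> {p \<in> paths Q. \<not> admissible (snd p)}}" (is "_ = ?Z")
proof
  interpret I: ideal "relation_ideal :: (('v, 'a) qpath \<Rightarrow>\<^sub>0 'k::field) set" PA by (rule ideal_relation_ideal)
  have sub: "subgroup ?Z (add_monoid PA)"
  proof (rule PA.add.subgroupI)
    show "?Z \<noteq> {}" by (auto intro!: exI[of _ 0])
    fix x y :: "('v, 'a) qpath \<Rightarrow>\<^sub>0 'k" assume x: "x \<in> ?Z"
    then have "x \<in> carrier PA" by auto
    then have "\<ominus>\<^bsub>PA\<^esub> x = - x" using PA_minus[of 0 x] by (simp add: a_minus_def)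
    then show "\<ominus>\<^bsub>PA\<^esub> x \<in> ?Z" using x by simp
    assume "y \<in> ?Z"
    then show "x \<oplus>\<^bsub>PA\<^esub> y \<in> ?Z" using x keys_add_subset[of x _ y] by simp
  qed auto
  have "ideal ?Z PA"
  proof (rule idealI[OF ring_PA sub])
    fix a x :: "('v, 'a) qpath \<Rightarrow>\<^sub>0 'k" assume x: "a \<in> ?Z" "x \<in> carrier PA"
    then have a: "Poly_Mapping.keys a \<subseteq> paths Q" by auto
    show "x \<otimes>\<^bsub>PA\<^esub> a \<in> ?Z"
    proof (simp, intro subsetI)
      fix r assume r: "r \<in> Poly_Mapping.keys (path_mult Q x a)"
      then obtain p q where "p \<in> Poly_Mapping.keys x" "q \<in> Poly_Mapping.keys a" "path_target Q q = fst p" "r = (fst q, snd q @ snd p)"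
        by (rule keys_path_mult)
      then show "r \<in> {p \<in> paths Q. \<not> admissible (snd p)}"
      proof -
        assume *: "q \<in> Poly_Mapping.keys a" "r = (fst q, snd q @ snd p)"
        have "\<not> admissible (snd q)" using subsetD[OF _ *(1), of "{p \<in> paths Q. \<not> admissible (snd p)}"] x(1) by simp
        moreover have "r \<in> paths Q" using subsetD[OF path_mult_closed r] a x(2) by simp
        ultimately show ?thesis using *(2) by (auto simp: successively_append_iff)
      qed
    qed
    show "a \<otimes>\<^bsub>PA\<^esub> x \<in> ?Z"
    proof (simp, intro subsetI)
      fix r assume r: "r \<in> Poly_Mapping.keys (path_mult Q a x)"
      then obtain p q where "p \<in> Poly_Mapping.keys a" "q \<in> Poly_Mapping.keys x" "path_target Q q = fst p" "r = (fst q, snd q @ snd p)"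
        by (rule keys_path_mult)
      then show "r \<in> {p \<in> paths Q. \<not> admissible (snd p)}"
      proof -
        assume *: "p \<in> Poly_Mapping.keys a" "r = (fst q, snd q @ snd p)"
        have "\<not> admissible (snd p)" using subsetD[OF _ *(1), of "{p \<in> paths Q. \<not> admissible (snd p)}"] x(1) by simp
        moreover have "r \<in> paths Q" using subsetD[OF path_mult_closed r] a x(2) by simp
        ultimately show ?thesis using *(2) by (auto simp: successively_append_iff)
      qed
    qed
  qed
  moreover have "(\<lambda>p. Poly_Mapping.single p (1::'k)) ` \<rho> \<subseteq> ?Z"
  proof
    fix y assume "y \<in> (\<lambda>p. Poly_Mapping.single p (1::'k)) ` \<rho>"
    then obtain p where p: "p \<in> \<rho>" "y = Poly_Mapping.single p 1" by auto
    obtain a b where "p = (tail Q a, [a, b])" "blocked a b" using rho_blocked[OF p(1)] by blast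
    then show "y \<in> ?Z" using p rho by auto
  qed
  ultimately show "relation_ideal \<subseteq> ?Z" unfolding relation_ideal_def by (rule PA.genideal_minimal)
  show "?Z \<subseteq> relation_ideal"
  proof
    fix x assume "x \<in> ?Z"
    then have "Poly_Mapping.keys x \<subseteq> {p \<in> paths Q. \<not> admissible (snd p)}" by simp
    then show "x \<in> relation_ideal"
    proof (induction rule: poly_mapping_sum_induct)
      case zero
      show ?case using I.zero_closed by simp
    next
      case (add y p c)
      then obtain l1 a b l2 where l: "snd p = l1 @ [a, b] @ l2" "blocked a b" using not_admissible_split by blast
      obtain u where p: "p = (u, l1 @ [a, b] @ l2)" using l by (cases p) auto
      have pp: "(u, l1) \<in> paths Q" "(path_target Q (u, l1), [a, b]) \<in> paths Q" "(path_target Q (u, l1 @ [a, b]), l2) \<in> paths Q"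
        using add(2) unfolding p mem_Collect_eq paths_append[of u l1] paths_append[of _ "[a, b]"] target_append by blast+
      have t: "path_target Q (u, l1) = tail Q a" using pp(2) by (auto simp: paths_iff awalk_Cons_iff)
      have "Poly_Mapping.single (tail Q a, [a, b]) (1::'k) \<in> relation_ideal"
        using PA.genideal_self[OF generators_closed] l(2) unfolding relation_ideal_def blocked_def by blast
      then have "path_mult Q (Poly_Mapping.single (path_target Q (u, l1 @ [a, b]), l2) 1)
          (path_mult Q (Poly_Mapping.single (tail Q a, [a, b]) 1) (Poly_Mapping.single (u, l1) c)) \<in> relation_ideal"
        using I.I_l_closed[OF I.I_r_closed] pp by (metis (no_types, lifting) PA_simps(1,2) keys_single empty_subsetI insert_subset)
      then have "Poly_Mapping.single p c \<in> relation_ideal" using t by (simp add: path_mult_single p target_append)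
      then show ?case using I.a_closed[OF _ add(3)] by simp
    qed
  qed
qed

abbreviation RA :: "('v, 'a, 'k::field) quot_elem ring" where
  "RA \<equiv> quiver_algebra Q relation_ideal"

definition residue :: "(('v, 'a) qpath \<Rightarrow>\<^sub>0 'k::field) \<Rightarrow> ('v, 'a, 'k) quot_elem" where
  "residue x = relation_ideal +>\<^bsub>PA\<^esub> x"

lemma ring_RA: "ring (RA :: ('v, 'a, 'k::field) quot_elem ring)"
  by (rule ideal.quotient_is_ring[OF ideal_relation_ideal])

sublocale RA: ring "RA :: ('v, 'a, 'k::field) quot_elem ring" by (rule ring_RA)

lemma residue_closed [simp]: "Poly_Mapping.keys x \<subseteq> paths Q \<Longrightarrow> residue x \<in> carrier RA"
  using ring_hom_closed[OF ideal.rcos_ring_hom[OF ideal_relation_ideal], of x] by (simp add: residue_def)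

lemma residue_surj: "r \<in> carrier RA \<Longrightarrow> \<exists>x. Poly_Mapping.keys x \<subseteq> paths Q \<and> r = residue x"
proof -
  assume "r \<in> carrier RA"
  then have "r \<in> (\<Union>x\<in>carrier PA. {relation_ideal +>\<^bsub>PA\<^esub> x})" by (simp add: FactRing_def A_RCOSETS_def')
  then obtain x where "x \<in> carrier PA" "r = relation_ideal +>\<^bsub>PA\<^esub> x" by blast
  then show ?thesis by (intro exI[of _ x]) (simp add: residue_def)
qed

lemma residue_add: "Poly_Mapping.keys x \<subseteq> paths Q \<Longrightarrow> Poly_Mapping.keys y \<subseteq> paths Q \<Longrightarrow> residue x \<oplus>\<^bsub>RA\<^esub> residue y = residue (x + y)"
  using ring_hom_add[OF ideal.rcos_ring_hom[OF ideal_relation_ideal], of x y] by (simp add: residue_def)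

lemma residue_mult: "Poly_Mapping.keys x \<subseteq> paths Q \<Longrightarrow> Poly_Mapping.keys y \<subseteq> paths Q \<Longrightarrow> residue x \<otimes>\<^bsub>RA\<^esub> residue y = residue (path_mult Q x y)"
  using ring_hom_mult[OF ideal.rcos_ring_hom[OF ideal_relation_ideal], of x y] by (simp add: residue_def)

lemma residue_one: "\<one>\<^bsub>RA\<^esub> = residue (path_scalar Q 1)"
  by (simp add: FactRing_def residue_def)

lemma residue_eq_iff:
  "Poly_Mapping.keys x \<subseteq> paths Q \<Longrightarrow> Poly_Mapping.keys y \<subseteq> paths Q \<Longrightarrow> residue x = residue y \<longleftrightarrow> x - y \<in> relation_ideal"
  using PA.quotient_eq_iff_same_a_r_cos[OF ideal_relation_ideal, of x y] PA_minus[of x y] by (simp add: residue_def)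

text \<open>
  Admissible paths form a basis of the quotient, and this is the coefficient at one of them. At other
  paths it is defined to be zero, which makes the formulas below hold for all \<open>p\<close>.
\<close>

definition path_coeff :: "('v, 'a) qpath \<Rightarrow> ('v, 'a, 'k::field) quot_elem \<Rightarrow> 'k" where
  "path_coeff p r = (if admissible (snd p) then Poly_Mapping.lookup (SOME x. Poly_Mapping.keys x \<subseteq> paths Q \<and> residue x = r) p else 0)"

lemma path_coeff_residue:
  assumes "Poly_Mapping.keys x \<subseteq> paths Q"
  shows "path_coeff p (residue x) = (if admissible (snd p) then Poly_Mapping.lookup x p else 0)"
proof -
  let ?y = "SOME y. Poly_Mapping.keys y \<subseteq> paths Q \<and> residue y = residue x"
  have y: "Poly_Mapping.keys ?y \<subseteq> paths Q" "residue ?y = residue x"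
    using someI[of "\<lambda>y. Poly_Mapping.keys y \<subseteq> paths Q \<and> residue y = residue x" x] assms by auto
  then have "?y - x \<in> relation_ideal" using residue_eq_iff[OF y(1) assms] by simp
  then have "Poly_Mapping.keys (?y - x) \<subseteq> {p \<in> paths Q. \<not> admissible (snd p)}" by (simp add: relation_ideal_eq)
  then have "admissible (snd p) \<Longrightarrow> Poly_Mapping.lookup (?y - x) p = 0" by (auto simp: in_keys_iff)
  then show ?thesis by (simp add: path_coeff_def lookup_minus)
qed

lemma path_coeff_eqI:
  assumes "r \<in> carrier RA" "s \<in> carrier RA" "\<And>u l. path_coeff (u, l) r = path_coeff (u, l) s"
  shows "r = s"
proof -
  obtain x y where x: "Poly_Mapping.keys x \<subseteq> paths Q" "r = residue x" and y: "Poly_Mapping.keys y \<subseteq> paths Q" "s = residue y"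
    using residue_surj assms(1,2) by metis
  have "Poly_Mapping.keys (x - y) \<subseteq> {p \<in> paths Q. \<not> admissible (snd p)}"
  proof
    fix p assume p: "p \<in> Poly_Mapping.keys (x - y)"
    then have "p \<in> paths Q" using x y keys_diff[of x y] by auto
    moreover have "\<not> admissible (snd p)"
      using p assms(3)[of "fst p" "snd p"] path_coeff_residue[OF x(1), of p] path_coeff_residue[OF y(1), of p] x(2) y(2)
      by (auto simp: in_keys_iff lookup_minus)
    ultimately show "p \<in> {p \<in> paths Q. \<not> admissible (snd p)}" by simp
  qed
  then have "x - y \<in> relation_ideal" by (simp add: relation_ideal_eq)
  then show ?thesis using residue_eq_iff x y by blast
qed

lemma path_coeff_add:
  assumes "r \<in> carrier RA" "s \<in> carrier RA"
  shows "path_coeff p (r \<oplus>\<^bsub>RA\<^esub> s) = path_coeff p r + path_coeff p s"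
proof -
  obtain x y where x: "Poly_Mapping.keys x \<subseteq> paths Q" "r = residue x" and y: "Poly_Mapping.keys y \<subseteq> paths Q" "s = residue y"
    using residue_surj assms by metis
  show ?thesis unfolding x(2) y(2) residue_add[OF x(1) y(1)]
    using x(1) y(1) keys_add_subset[OF x(1) y(1)] by (simp add: path_coeff_residue lookup_add)
qed

lemma path_coeff_zero [simp]: "path_coeff p \<zero>\<^bsub>RA\<^esub> = 0"
  using path_coeff_add[of "\<zero>\<^bsub>RA\<^esub>" "\<zero>\<^bsub>RA\<^esub>" p] by (metis RA.r_zero RA.zero_closed add_cancel_right_right)

lemma path_coeff_finsum:
  assumes "finite S" "\<And>i. i \<in> S \<Longrightarrow> f i \<in> carrier RA"
  shows "path_coeff p (\<Oplus>\<^bsub>RA\<^esub>i\<in>S. f i) = (\<Sum>i\<in>S. path_coeff p (f i))"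
  using assms
proof (induction S rule: finite_induct)
  case (insert x S)
  then have "f \<in> S \<rightarrow> carrier RA" by auto
  then show ?case using insert by (simp add: RA.finsum_insert path_coeff_add)
qed simp

lemma path_coeff_not_admissible: "\<not> admissible l \<Longrightarrow> path_coeff (u, l) r = 0"
  by (simp add: path_coeff_def)

lemma path_coeff_not_path: "r \<in> carrier RA \<Longrightarrow> p \<notin> paths Q \<Longrightarrow> path_coeff p r = 0"
proof -
  assume r: "r \<in> carrier RA" and p: "p \<notin> paths Q"
  obtain x where x: "Poly_Mapping.keys x \<subseteq> paths Q" "r = residue x" using residue_surj[OF r] by blast
  then have "Poly_Mapping.lookup x p = 0" using p by (metis in_keys_iff subsetD)
  then show ?thesis using x by (simp add: path_coeff_residue)
qed

definition arrow :: "'a \<Rightarrow> ('v, 'a, 'k::field) quot_elem" where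
  "arrow a = residue (Poly_Mapping.single (tail Q a, [a]) 1)"

lemma idem_residue: "idem Q relation_ideal v = residue (Poly_Mapping.single (v, []) 1)"
  by (simp add: idem_def residue_def)

lemma scalar_residue: "scalar Q relation_ideal c = residue (path_scalar Q c)"
  by (simp add: scalar_def residue_def)

lemma arrow_closed [simp]: "a \<in> arcs Q \<Longrightarrow> arrow a \<in> carrier RA"
  by (simp add: arrow_def)

lemma idem_closed [simp]: "v \<in> verts Q \<Longrightarrow> idem Q relation_ideal v \<in> carrier RA"
  by (simp add: idem_residue)

lemma scalar_closed [simp]: "scalar Q relation_ideal c \<in> carrier RA"
  by (simp add: scalar_residue path_scalar_closed)

lemma path_coeff_arrow_mult:
  fixes r :: "('v, 'a, 'k::field) quot_elem"
  assumes "a \<in> arcs Q" "r \<in> carrier RA"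
  shows "path_coeff (u, []) (arrow a \<otimes>\<^bsub>RA\<^esub> r) = 0"
    and "path_coeff (u, l @ [b]) (arrow a \<otimes>\<^bsub>RA\<^esub> r) =
      (if b = a \<and> path_target Q (u, l) = tail Q a \<and> admissible (l @ [b]) then path_coeff (u, l) r else 0)"
proof -
  obtain x where x: "Poly_Mapping.keys x \<subseteq> paths Q" "r = residue x" using residue_surj assms(2) by metis
  have k: "Poly_Mapping.keys (Poly_Mapping.single (tail Q a, [a]) (1::'k)) \<subseteq> paths Q" using assms(1) by simp
  have m: "arrow a \<otimes>\<^bsub>RA\<^esub> r = residue (path_mult Q (Poly_Mapping.single (tail Q a, [a]) 1) x)"
    unfolding arrow_def x(2) by (rule residue_mult[OF k x(1)])
  note c = path_coeff_residue[OF path_mult_closed[OF k x(1)]]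
  show "path_coeff (u, []) (arrow a \<otimes>\<^bsub>RA\<^esub> r) = 0"
    by (simp add: m c lookup_single_mult)
  have "Poly_Mapping.lookup (path_mult Q (Poly_Mapping.single (tail Q a, [a]) 1) x) (u, l @ [b]) =
    (\<Sum>q\<in>Poly_Mapping.keys x. if q = (u, l) then (if b = a \<and> path_target Q (u, l) = tail Q a then Poly_Mapping.lookup x (u, l) else 0) else 0)"
    unfolding lookup_single_mult
  proof (rule sum.cong[OF refl])
    fix q
    show "(if path_target Q q = fst (tail Q a, [a]) \<and> (fst q, snd q @ snd (tail Q a, [a])) = (u, l @ [b]) then 1 * Poly_Mapping.lookup x q else 0)
      = (if q = (u, l) then (if b = a \<and> path_target Q (u, l) = tail Q a then Poly_Mapping.lookup x (u, l) else 0) else 0)"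
      by (cases q) auto
  qed
  also have "\<dots> = (if b = a \<and> path_target Q (u, l) = tail Q a then Poly_Mapping.lookup x (u, l) else 0)"
    by (simp add: in_keys_iff)
  finally have L: "Poly_Mapping.lookup (path_mult Q (Poly_Mapping.single (tail Q a, [a]) 1) x) (u, l @ [b]) =
    (if b = a \<and> path_target Q (u, l) = tail Q a then Poly_Mapping.lookup x (u, l) else 0)" .
  show "path_coeff (u, l @ [b]) (arrow a \<otimes>\<^bsub>RA\<^esub> r) =
      (if b = a \<and> path_target Q (u, l) = tail Q a \<and> admissible (l @ [b]) then path_coeff (u, l) r else 0)"
    unfolding m c L unfolding x(2) path_coeff_residue[OF x(1)] by (auto simp: admissible_snoc)
qed

lemma path_coeff_idem_mult:
  fixes r :: "('v, 'a, 'k::field) quot_elem"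
  assumes "v \<in> verts Q" "r \<in> carrier RA"
  shows "path_coeff p (idem Q relation_ideal v \<otimes>\<^bsub>RA\<^esub> r) = (if path_target Q p = v then path_coeff p r else 0)"
proof -
  obtain x where x: "Poly_Mapping.keys x \<subseteq> paths Q" "r = residue x" using residue_surj assms(2) by metis
  have k: "Poly_Mapping.keys (Poly_Mapping.single (v, []) (1::'k)) \<subseteq> paths Q" using assms(1) by simp
  have m: "idem Q relation_ideal v \<otimes>\<^bsub>RA\<^esub> r = residue (path_mult Q (Poly_Mapping.single (v, []) 1) x)"
    unfolding idem_residue x(2) by (rule residue_mult[OF k x(1)])
  have "Poly_Mapping.lookup (path_mult Q (Poly_Mapping.single (v, []) 1) x) p =
    (\<Sum>q\<in>Poly_Mapping.keys x. if q = p then (if path_target Q p = v then Poly_Mapping.lookup x p else 0) else 0)"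
    unfolding lookup_single_mult by (intro sum.cong refl) auto
  also have "\<dots> = (if path_target Q p = v then Poly_Mapping.lookup x p else 0)"
    by (simp add: in_keys_iff)
  finally show ?thesis
    unfolding m path_coeff_residue[OF path_mult_closed[OF k x(1)]] unfolding x(2) path_coeff_residue[OF x(1)] by simp
qed

lemma path_coeff_scalar_mult:
  assumes "r \<in> carrier RA"
  shows "path_coeff p (scalar Q relation_ideal c \<otimes>\<^bsub>RA\<^esub> r) = c * path_coeff p r"
proof -
  obtain x where x: "Poly_Mapping.keys x \<subseteq> paths Q" "r = residue x" using residue_surj assms by metis
  have m: "scalar Q relation_ideal c \<otimes>\<^bsub>RA\<^esub> r = residue (path_mult Q (path_scalar Q c) x)"
    unfolding scalar_residue x(2) by (rule residue_mult[OF path_scalar_closed x(1)])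
  show ?thesis unfolding m unfolding x(2)
    using x(1) by (simp add: path_coeff_residue path_mult_closed path_scalar_closed lookup_path_scalar_mult)
qed

lemma path_coeff_idem: "v \<in> verts Q \<Longrightarrow> path_coeff p (idem Q relation_ideal v) = (if p = (v, []) then 1 else 0)"
  unfolding idem_residue by (subst path_coeff_residue) (auto simp: lookup_single when_def)

lemma path_coeff_arrow: "a \<in> arcs Q \<Longrightarrow> path_coeff p (arrow a) = (if p = (tail Q a, [a]) then 1 else 0)"
  unfolding arrow_def by (subst path_coeff_residue) (auto simp: lookup_single when_def)

lemma path_coeff_scalar: "path_coeff p (scalar Q relation_ideal c) = (if snd p = [] \<and> fst p \<in> verts Q then c else 0)"
  unfolding scalar_residue by (subst path_coeff_residue) (auto simp: lookup_path_scalar path_scalar_closed)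

text \<open>
  The part of \<open>r\<close> spanned by the paths that end with the arrow \<open>a\<close>, with that arrow removed. The sum is
  over the admissible paths that occur in \<open>r\<close>, so that it depends only on the residue class and vanishes
  for \<open>r = 0\<close>.
\<close>

definition drop_last :: "'a \<Rightarrow> ('v, 'a, 'k::field) quot_elem \<Rightarrow> ('v, 'a, 'k) quot_elem" where
  "drop_last a r = residue (\<Sum>q\<in>{q. path_coeff q r \<noteq> 0 \<and> snd q \<noteq> [] \<and> last (snd q) = a}.
     Poly_Mapping.single (fst q, butlast (snd q)) (path_coeff q r))"

lemma drop_last:
  assumes r: "r \<in> carrier RA"
  shows "drop_last a r \<in> carrier RA" "path_coeff (u, l) (drop_last a r) = path_coeff (u, l @ [a]) r"
proof -
  obtain x where x: "Poly_Mapping.keys x \<subseteq> paths Q" "r = residue x" using residue_surj r by metis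
  let ?S = "{q. path_coeff q r \<noteq> 0 \<and> snd q \<noteq> [] \<and> last (snd q) = a}"
  let ?y = "\<Sum>q\<in>?S. Poly_Mapping.single (fst q, butlast (snd q)) (path_coeff q r)"
  have "?S \<subseteq> Poly_Mapping.keys x" unfolding x(2) by (auto simp: path_coeff_residue[OF x(1)] in_keys_iff split: if_splits)
  then have fin: "finite ?S" using finite_subset finite_keys by blast
  have sp: "(fst q, butlast (snd q)) \<in> paths Q" if "q \<in> ?S" for q
  proof -
    have "q \<in> paths Q" using that path_coeff_not_path[OF r, of q] by auto
    moreover have "snd q \<noteq> []" using that by auto
    then have "q = (fst q, butlast (snd q) @ [last (snd q)])" by (simp add: prod_eq_iff)
    ultimately show ?thesis using paths_append by metis
  qed
  have "Poly_Mapping.keys ?y \<subseteq> (\<Union>q\<in>?S. Poly_Mapping.keys (Poly_Mapping.single (fst q, butlast (snd q)) (path_coeff q r)))"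
    by (rule keys_sum)
  also have "\<dots> \<subseteq> paths Q" using sp by (auto split: if_splits)
  finally have y: "Poly_Mapping.keys ?y \<subseteq> paths Q" .
  show "drop_last a r \<in> carrier RA" unfolding drop_last_def using y by simp
  have "Poly_Mapping.lookup ?y (u, l) = (\<Sum>q\<in>?S. if q = (u, l @ [a]) then path_coeff (u, l @ [a]) r else 0)"
    unfolding lookup_sum
  proof (intro sum.cong refl)
    fix q assume q: "q \<in> ?S"
    then have "q = (fst q, butlast (snd q) @ [a])" by (metis (mono_tags, lifting) append_butlast_last_id mem_Collect_eq prod.collapse)
    then have "(fst q, butlast (snd q)) = (u, l) \<longleftrightarrow> q = (u, l @ [a])" by (metis butlast_snoc fst_conv snd_conv)
    then show "Poly_Mapping.lookup (Poly_Mapping.single (fst q, butlast (snd q)) (path_coeff q r)) (u, l) = (if q = (u, l @ [a]) then path_coeff (u, l @ [a]) r else 0)"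
      by (auto simp: lookup_single when_def)
  qed
  also have "\<dots> = path_coeff (u, l @ [a]) r" using fin by auto
  finally show "path_coeff (u, l) (drop_last a r) = path_coeff (u, l @ [a]) r"
    unfolding drop_last_def path_coeff_residue[OF y] by (auto simp: admissible_snoc path_coeff_not_admissible)
qed

lemma drop_last_zero: "drop_last a \<zero>\<^bsub>RA\<^esub> = \<zero>\<^bsub>RA\<^esub>"
  using drop_last[of "\<zero>\<^bsub>RA\<^esub>"] by (intro path_coeff_eqI) simp_all

text \<open>
  A path can only be reached from its last arrow, hence the different terms do not interfere.
\<close>

lemma arrow_expansion:
  assumes "\<And>a. a \<in> arcs Q \<Longrightarrow> f a \<in> carrier RA"
  shows "path_coeff (u, []) (\<Oplus>\<^bsub>RA\<^esub>a\<in>arcs Q. arrow a \<otimes>\<^bsub>RA\<^esub> f a) = 0"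
    and "path_coeff (u, l @ [b]) (\<Oplus>\<^bsub>RA\<^esub>a\<in>arcs Q. arrow a \<otimes>\<^bsub>RA\<^esub> f a) = (if b \<in> arcs Q then path_coeff (u, l @ [b]) (arrow b \<otimes>\<^bsub>RA\<^esub> f b) else 0)"
proof -
  have cl: "arrow a \<otimes>\<^bsub>RA\<^esub> f a \<in> carrier RA" if "a \<in> arcs Q" for a using that assms by simp
  show "path_coeff (u, []) (\<Oplus>\<^bsub>RA\<^esub>a\<in>arcs Q. arrow a \<otimes>\<^bsub>RA\<^esub> f a) = 0"
    using path_coeff_finsum[OF finite_arcs cl] assms by (simp add: path_coeff_arrow_mult(1))
  have "path_coeff (u, l @ [b]) (\<Oplus>\<^bsub>RA\<^esub>a\<in>arcs Q. arrow a \<otimes>\<^bsub>RA\<^esub> f a) = (\<Sum>a\<in>arcs Q. path_coeff (u, l @ [b]) (arrow a \<otimes>\<^bsub>RA\<^esub> f a))"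
    by (rule path_coeff_finsum[OF finite_arcs cl])
  also have "\<dots> = (\<Sum>a\<in>arcs Q. if a = b then path_coeff (u, l @ [b]) (arrow b \<otimes>\<^bsub>RA\<^esub> f b) else 0)"
    using assms by (intro sum.cong refl) (auto simp: path_coeff_arrow_mult(2))
  finally show "path_coeff (u, l @ [b]) (\<Oplus>\<^bsub>RA\<^esub>a\<in>arcs Q. arrow a \<otimes>\<^bsub>RA\<^esub> f a) = (if b \<in> arcs Q then path_coeff (u, l @ [b]) (arrow b \<otimes>\<^bsub>RA\<^esub> f b) else 0)"
    by simp
qed

lemma path_coeff_eqI_paths:
  assumes "r \<in> carrier RA" "s \<in> carrier RA" "\<And>u. path_coeff (u, []) r = path_coeff (u, []) s"
    "\<And>u l b. admissible (l @ [b]) \<Longrightarrow> (u, l @ [b]) \<in> paths Q \<Longrightarrow> path_coeff (u, l @ [b]) r = path_coeff (u, l @ [b]) s"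
  shows "r = s"
proof (rule path_coeff_eqI[OF assms(1,2)])
  fix u l
  show "path_coeff (u, l) r = path_coeff (u, l) s"
  proof (cases l rule: rev_cases)
    case (snoc l' b)
    then show ?thesis using assms
      by (cases "admissible l"; cases "(u, l) \<in> paths Q") (simp_all add: path_coeff_not_admissible path_coeff_not_path)
  qed (use assms(3) in simp)
qed

text \<open>
  All properties are checked on coefficients. The one with content is the last: if \<open>a r = 0\<close> and a path \<open>p\<close>
  with \<open>t(p) = s(a)\<close> occurs in \<open>r\<close>, then \<open>p\<close> followed by \<open>a\<close> cannot be admissible, because its coefficient in
  \<open>a r\<close> is that of \<open>p\<close> in \<open>r\<close>; so \<open>p\<close> is nontrivial and its last arrow is blocked by \<open>a\<close>.
\<close>

lemma monomial_ring_quiver_algebra: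
  "monomial_ring (RA :: ('v, 'a, 'k::field) quot_elem ring) (scalar Q relation_ideal) (verts Q) (arcs Q) (idem Q relation_ideal) arrow (tail Q)
     (\<lambda>a. {b. blocked b a}) (\<lambda>v r. path_coeff (v, []) r) drop_last"
proof (intro monomial_ring.intro monomial_ring_axioms.intro ring_RA)
  have path_tail: "path_target Q (u, l) = tail Q b \<and> b \<in> arcs Q" if "(u, l @ [b]) \<in> paths Q" for u l b
    using that by (simp add: paths_append)
  show "scalar Q relation_ideal (c + d) = scalar Q relation_ideal c \<oplus>\<^bsub>RA\<^esub> scalar Q relation_ideal d" for c d :: 'k
    by (intro path_coeff_eqI) (auto simp: path_coeff_add path_coeff_scalar)
  show "scalar Q relation_ideal (c * d) = scalar Q relation_ideal c \<otimes>\<^bsub>RA\<^esub> scalar Q relation_ideal d" for c d :: 'k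
    by (intro path_coeff_eqI) (auto simp: path_coeff_scalar_mult path_coeff_scalar)
  show "scalar Q relation_ideal 1 = \<one>\<^bsub>RA\<^esub>" by (simp add: residue_one scalar_residue)
  show "scalar Q relation_ideal c \<otimes>\<^bsub>RA\<^esub> r = r \<otimes>\<^bsub>RA\<^esub> scalar Q relation_ideal c" if r: "r \<in> carrier RA" for r and c :: 'k
  proof -
    obtain x where x: "Poly_Mapping.keys x \<subseteq> paths Q" "r = residue x" using residue_surj r by metis
    show ?thesis unfolding scalar_residue x(2)
      using x(1) by (simp add: residue_mult path_scalar_closed path_scalar_central)
  qed
  show "tail Q a \<in> verts Q" if "a \<in> arcs Q" for a using that by simp
  show "{b. blocked b a} \<subseteq> arcs Q" for a using blockedD by blast
  show "(\<Oplus>\<^bsub>RA\<^esub>v\<in>verts Q. idem Q relation_ideal v) = (\<one>\<^bsub>RA\<^esub> :: ('v, 'a, 'k) quot_elem)"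
    unfolding residue_one scalar_residue[symmetric]
  proof (rule path_coeff_eqI)
    fix u l
    have "path_coeff (u, l) (\<Oplus>\<^bsub>RA\<^esub>v\<in>verts Q. idem Q relation_ideal v) = (\<Sum>v\<in>verts Q. if v = u then (if l = [] then 1 else 0 :: 'k) else 0)"
      by (subst path_coeff_finsum) (auto simp: path_coeff_idem intro!: sum.cong)
    then show "path_coeff (u, l) (\<Oplus>\<^bsub>RA\<^esub>v\<in>verts Q. idem Q relation_ideal v) = path_coeff (u, l) (scalar Q relation_ideal (1::'k))"
      by (simp add: path_coeff_scalar)
  qed (auto intro!: RA.finsum_closed)
  show "idem Q relation_ideal v \<otimes>\<^bsub>RA\<^esub> idem Q relation_ideal w = (if v = w then idem Q relation_ideal v else (\<zero>\<^bsub>RA\<^esub> :: ('v, 'a, 'k) quot_elem))"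
    if "v \<in> verts Q" "w \<in> verts Q" for v w
    using that by (intro path_coeff_eqI) (auto simp: path_coeff_idem_mult path_coeff_idem)
  show "arrow a \<otimes>\<^bsub>RA\<^esub> idem Q relation_ideal (tail Q a) = (arrow a :: ('v, 'a, 'k) quot_elem)" if "a \<in> arcs Q" for a
    using that by (intro path_coeff_eqI_paths) (auto simp: path_coeff_arrow_mult path_coeff_arrow path_coeff_idem)
  show "arrow a \<otimes>\<^bsub>RA\<^esub> arrow b = (\<zero>\<^bsub>RA\<^esub> :: ('v, 'a, 'k) quot_elem)" if "a \<in> arcs Q" "b \<in> {b. blocked b a}" for a b
    using that blockedD[of b a] by (intro path_coeff_eqI_paths) (auto simp: path_coeff_arrow_mult path_coeff_arrow admissible_snoc)
  show "idem Q relation_ideal (tail Q a) \<otimes>\<^bsub>RA\<^esub> arrow b = (arrow b :: ('v, 'a, 'k) quot_elem)" if "a \<in> arcs Q" "b \<in> {b. blocked b a}" for a b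
    using that blockedD[of b a] by (intro path_coeff_eqI) (auto simp: path_coeff_idem_mult path_coeff_arrow)
  show "path_coeff (w, []) (idem Q relation_ideal v \<otimes>\<^bsub>RA\<^esub> r) = (if v = w then path_coeff (v, []) r else 0)"
    if "v \<in> verts Q" "w \<in> verts Q" "r \<in> carrier RA" for v w and r :: "('v, 'a, 'k) quot_elem"
    using that by (auto simp: path_coeff_idem_mult)
  show "r = (\<Oplus>\<^bsub>RA\<^esub>v\<in>verts Q. scalar Q relation_ideal (path_coeff (v, []) r) \<otimes>\<^bsub>RA\<^esub> idem Q relation_ideal v) \<oplus>\<^bsub>RA\<^esub> (\<Oplus>\<^bsub>RA\<^esub>a\<in>arcs Q. arrow a \<otimes>\<^bsub>RA\<^esub> drop_last a r)"
    if r: "r \<in> carrier RA" for r :: "('v, 'a, 'k) quot_elem"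
  proof -
    let ?A = "\<Oplus>\<^bsub>RA\<^esub>v\<in>verts Q. scalar Q relation_ideal (path_coeff (v, []) r) \<otimes>\<^bsub>RA\<^esub> idem Q relation_ideal v"
    let ?B = "\<Oplus>\<^bsub>RA\<^esub>a\<in>arcs Q. arrow a \<otimes>\<^bsub>RA\<^esub> drop_last a r"
    have cl: "?A \<in> carrier RA" "?B \<in> carrier RA" using r drop_last(1)[OF r] by (auto intro!: RA.finsum_closed)
    have A: "path_coeff (u, l) ?A = (if l = [] then path_coeff (u, []) r else 0)" for u l
    proof -
      have "path_coeff (u, l) ?A = (\<Sum>v\<in>verts Q. if v = u then (if l = [] then path_coeff (u, []) r else 0) else 0)"
      proof -
        have "path_coeff (u, l) ?A = (\<Sum>v\<in>verts Q. path_coeff (u, l) (scalar Q relation_ideal (path_coeff (v, []) r) \<otimes>\<^bsub>RA\<^esub> idem Q relation_ideal v))"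
          by (rule path_coeff_finsum) auto
        also have "\<dots> = (\<Sum>v\<in>verts Q. if v = u then (if l = [] then path_coeff (u, []) r else 0) else 0)"
          by (rule sum.cong[OF refl]) (simp add: path_coeff_scalar_mult path_coeff_idem)
        finally show ?thesis .
      qed
      then show ?thesis using path_coeff_not_path[OF r, of "(u, [])"] by auto
    qed
    show ?thesis
    proof (rule path_coeff_eqI_paths[OF r])
      show "path_coeff (u, []) r = path_coeff (u, []) (?A \<oplus>\<^bsub>RA\<^esub> ?B)" for u
        using cl A arrow_expansion(1)[of "\<lambda>a. drop_last a r"] drop_last(1)[OF r] by (simp add: path_coeff_add)
      show "path_coeff (u, l @ [b]) r = path_coeff (u, l @ [b]) (?A \<oplus>\<^bsub>RA\<^esub> ?B)" if "admissible (l @ [b])" "(u, l @ [b]) \<in> paths Q" for u l b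
        using cl A arrow_expansion(2)[where f = "\<lambda>a. drop_last a r" and u = u and l = l and b = b] drop_last[OF r] that path_tail[of u l b]
        by (simp add: path_coeff_add path_coeff_arrow_mult)
    qed (use cl in auto)
  qed
  show "arrow a \<otimes>\<^bsub>RA\<^esub> f a = \<zero>\<^bsub>RA\<^esub>"
    if f: "\<And>a. a \<in> arcs Q \<Longrightarrow> f a \<in> carrier RA" "(\<Oplus>\<^bsub>RA\<^esub>a\<in>arcs Q. arrow a \<otimes>\<^bsub>RA\<^esub> f a) = \<zero>\<^bsub>RA\<^esub>" "a \<in> arcs Q"
    for f and a :: 'a
  proof (rule path_coeff_eqI_paths)
    show "path_coeff (u, l @ [b]) (arrow a \<otimes>\<^bsub>RA\<^esub> f a) = path_coeff (u, l @ [b]) \<zero>\<^bsub>RA\<^esub>" for u l b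
      using arrow_expansion(2)[where f = f and u = u and l = l and b = b] f by (cases "b = a") (auto simp: path_coeff_arrow_mult)
  qed (use f in \<open>auto simp: path_coeff_arrow_mult\<close>)
  show "(\<forall>v\<in>verts Q. path_coeff (v, []) r = 0) \<and> (\<forall>b\<in>arcs Q - {b. blocked b a}. arrow b \<otimes>\<^bsub>RA\<^esub> drop_last b r = \<zero>\<^bsub>RA\<^esub>)"
    if a: "a \<in> arcs Q" and r: "r \<in> carrier RA" and e: "idem Q relation_ideal (tail Q a) \<otimes>\<^bsub>RA\<^esub> r = r" and z: "arrow a \<otimes>\<^bsub>RA\<^esub> r = \<zero>\<^bsub>RA\<^esub>"
    for a and r :: "('v, 'a, 'k) quot_elem"
  proof -
    (* Paths ending elsewhere do not occur in r, and paths that can be prolonged by a would show up in a r. *)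
    have out: "path_coeff p r = 0" if "path_target Q p \<noteq> tail Q a" for p
      using path_coeff_idem_mult[of "tail Q a" r p] a r e that by simp
    have inn: "path_coeff (u, l) r = 0" if "path_target Q (u, l) = tail Q a" "admissible (l @ [a])" for u l
      using path_coeff_arrow_mult(2)[OF a r, of u l a] z that by simp
    have all: "path_coeff (u, l) r = 0" if "l \<noteq> [] \<Longrightarrow> \<not> blocked (last l) a" for u l
      using out[of "(u, l)"] inn[of u l] that path_coeff_not_admissible[of l u r] by (auto simp: admissible_snoc)
    have "arrow b \<otimes>\<^bsub>RA\<^esub> drop_last b r = \<zero>\<^bsub>RA\<^esub>" if b: "b \<in> arcs Q" "\<not> blocked b a" for b
      using b drop_last[OF r] all by (intro path_coeff_eqI_paths) (auto simp: path_coeff_arrow_mult)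
    then show ?thesis using all by auto
  qed
qed (auto simp: path_coeff_add path_coeff_scalar_mult path_coeff_idem path_coeff_arrow_mult drop_last drop_last_zero)

interpretation MR: monomial_ring "RA :: ('v, 'a, 'k::field) quot_elem ring" "scalar Q relation_ideal" "verts Q" "arcs Q" "idem Q relation_ideal" arrow "tail Q"
  "\<lambda>a. {b. blocked b a}" "\<lambda>v r. path_coeff (v, []) r" drop_last
  by (rule monomial_ring_quiver_algebra)

section \<open>The semisimple module\<close>

text \<open>
  Positive degree is thereby expressed by coefficients of trivial paths.
\<close>

lemma alg_positive_eq: "alg_positive Q relation_ideal = {r \<in> carrier (RA :: ('v, 'a, 'k::field) quot_elem ring). \<forall>v\<in>verts Q. path_coeff (v, []) r = 0}"
proof (rule Set.set_eqI, rule iffI)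
  fix r :: "('v, 'a, 'k) quot_elem" assume "r \<in> alg_positive Q relation_ideal"
  then obtain x where x: "r = residue x" "Poly_Mapping.keys x \<subseteq> paths Q" "\<forall>p\<in>Poly_Mapping.keys x. path_length p \<ge> 1"
    by (auto simp: alg_positive_def residue_def)
  then have "(v, []) \<notin> Poly_Mapping.keys x" for v by fastforce
  then have "Poly_Mapping.lookup x (v, []) = 0" for v by (simp add: in_keys_iff)
  then show "r \<in> {r \<in> carrier RA. \<forall>v\<in>verts Q. path_coeff (v, []) r = 0}" using x by (simp add: path_coeff_residue)
next
  fix r :: "('v, 'a, 'k) quot_elem" assume r: "r \<in> {r \<in> carrier RA. \<forall>v\<in>verts Q. path_coeff (v, []) r = 0}"
  then obtain x where x: "Poly_Mapping.keys x \<subseteq> paths Q" "r = residue x" using residue_surj by blast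
  have "path_length p \<ge> 1" if "p \<in> Poly_Mapping.keys x" for p
  proof (rule ccontr)
    assume "\<not> path_length p \<ge> 1"
    then obtain v where v: "p = (v, [])" by (cases p) (auto simp: Suc_le_eq)
    then have "v \<in> verts Q" using x that by auto
    then have "Poly_Mapping.lookup x p = 0" using r x v path_coeff_residue[OF x(1), of p] by auto
    then show False using that by (simp add: in_keys_iff)
  qed
  then show "r \<in> alg_positive Q relation_ideal" unfolding alg_positive_def using x by (auto simp: residue_def)
qed

abbreviation reg :: "(('v, 'a, 'k::field) quot_elem, ('v, 'a, 'k) quot_elem) module" where
  "reg \<equiv> regular_module RA"

lemma reg_simps [simp]:
  "carrier reg = carrier RA" "x \<oplus>\<^bsub>reg\<^esub> y = x \<oplus>\<^bsub>RA\<^esub> y" "\<zero>\<^bsub>reg\<^esub> = \<zero>\<^bsub>RA\<^esub>" "x \<odot>\<^bsub>reg\<^esub> y = x \<otimes>\<^bsub>RA\<^esub> y"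
  by (auto simp: regular_module_def)

lemma submod_alg_positive: "submod RA reg (alg_positive Q relation_ideal :: ('v, 'a, 'k::field) quot_elem set)"
  unfolding submod_def
proof (intro conjI ballI)
  show "alg_positive Q relation_ideal \<subseteq> carrier reg" "\<zero>\<^bsub>reg\<^esub> \<in> alg_positive Q relation_ideal" by (auto simp: alg_positive_eq)
  fix x :: "('v, 'a, 'k) quot_elem" assume x: "x \<in> alg_positive Q relation_ideal"
  show "x \<oplus>\<^bsub>reg\<^esub> y \<in> alg_positive Q relation_ideal" if "y \<in> alg_positive Q relation_ideal" for y
    using x that by (auto simp: alg_positive_eq path_coeff_add)
  show "r \<odot>\<^bsub>reg\<^esub> x \<in> alg_positive Q relation_ideal" if r: "r \<in> carrier RA" for r
  proof -
    obtain z where z: "x = residue z" "Poly_Mapping.keys z \<subseteq> paths Q" "\<forall>p\<in>Poly_Mapping.keys z. path_length p \<ge> 1"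
      using x by (auto simp: alg_positive_def residue_def)
    obtain y where y: "Poly_Mapping.keys y \<subseteq> paths Q" "r = residue y" using residue_surj[OF r] by blast
    have "path_length p \<ge> 1" if "p \<in> Poly_Mapping.keys (path_mult Q y z)" for p
      using that z(3) by (elim keys_path_mult) fastforce
    then have "path_mult Q y z \<in> {x \<in> carrier PA. \<forall>p\<in>Poly_Mapping.keys x. path_length p \<ge> 1}"
      using path_mult_closed[OF y(1) z(2)] by simp
    then have "residue (path_mult Q y z) \<in> alg_positive Q relation_ideal" unfolding alg_positive_def residue_def by (rule imageI)
    then show ?thesis by (simp add: y(2) z(1) residue_mult[OF y(1) z(2)])
  qed
qed

definition top_class :: "('v, 'a, 'k::field) quot_elem \<Rightarrow> ('v, 'a, 'k) quot_elem set" where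
  "top_class r = alg_positive Q relation_ideal +>\<^bsub>reg\<^esub> r"

lemma top_module_rules:
  fixes r s :: "('v, 'a, 'k::field) quot_elem"
  shows "carrier (top_module Q relation_ideal) = top_class ` carrier (RA :: ('v, 'a, 'k) quot_elem ring)"
  "\<lbrakk>r \<in> carrier RA; s \<in> carrier RA\<rbrakk> \<Longrightarrow> top_class r \<oplus>\<^bsub>top_module Q relation_ideal\<^esub> top_class s = top_class (r \<oplus>\<^bsub>RA\<^esub> s)"
  "\<lbrakk>r \<in> carrier RA; s \<in> carrier RA\<rbrakk> \<Longrightarrow> r \<odot>\<^bsub>top_module Q relation_ideal\<^esub> top_class s = top_class (r \<otimes>\<^bsub>RA\<^esub> s)"
  "\<zero>\<^bsub>top_module Q relation_ideal\<^esub> = top_class (\<zero>\<^bsub>RA\<^esub> :: ('v, 'a, 'k) quot_elem)"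
  "\<lbrakk>r \<in> carrier RA; s \<in> carrier RA\<rbrakk> \<Longrightarrow> top_class r = top_class s \<longleftrightarrow> (\<forall>v\<in>verts Q. path_coeff (v, []) r = path_coeff (v, []) s)"
proof -
  interpret reg: left_module RA "reg :: (('v, 'a, 'k) quot_elem, ('v, 'a, 'k) quot_elem) module"
    by (rule left_module_regular[OF ring_RA])
  note rules = quot_module_rules[OF reg.abelian_group_axioms MR.submod_subgroup[OF reg.left_module_axioms submod_alg_positive]]
  show "carrier (top_module Q relation_ideal) = top_class ` carrier (RA :: ('v, 'a, 'k) quot_elem ring)"
    using rules(1) by (simp add: top_module_def top_class_def[abs_def])
  show "\<zero>\<^bsub>top_module Q relation_ideal\<^esub> = top_class (\<zero>\<^bsub>RA\<^esub> :: ('v, 'a, 'k) quot_elem)"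
    using rules(2) by (simp add: top_module_def top_class_def)
  assume r: "r \<in> carrier RA" and s: "s \<in> carrier RA"
  show "top_class r \<oplus>\<^bsub>top_module Q relation_ideal\<^esub> top_class s = top_class (r \<oplus>\<^bsub>RA\<^esub> s)"
    using rules(3)[of r s] r s by (simp add: top_module_def top_class_def)
  show "r \<odot>\<^bsub>top_module Q relation_ideal\<^esub> top_class s = top_class (r \<otimes>\<^bsub>RA\<^esub> s)"
    using rules(5)[of r s] r s submodD(4)[OF submod_alg_positive r] by (simp add: top_module_def top_class_def RA.r_distr)
  have d: "r \<ominus>\<^bsub>reg\<^esub> s \<in> carrier RA" "(r \<ominus>\<^bsub>reg\<^esub> s) \<oplus>\<^bsub>RA\<^esub> s = r"
    using reg.M.minus_closed[of r s] r s reg.M.a_assoc[of r "\<ominus>\<^bsub>reg\<^esub> s" s] reg.M.l_neg[of s] reg.M.a_inv_closed[of s]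
    by (simp_all add: a_minus_def)
  have "path_coeff p (r \<ominus>\<^bsub>reg\<^esub> s) = path_coeff p r - path_coeff p s" for p
    using path_coeff_add[OF d(1) s, of p] d(2) by simp
  then show "top_class r = top_class s \<longleftrightarrow> (\<forall>v\<in>verts Q. path_coeff (v, []) r = path_coeff (v, []) s)"
    using rules(4)[of r s] r s d(1) by (simp add: top_class_def alg_positive_eq)
qed

text \<open>
  The sum of all coordinates on \<open>\<Lambda>\<^sub>0\<close>, the functional that makes it self-dual.
\<close>

definition top_functional :: "('v, 'a, 'k::field) quot_elem set \<Rightarrow> 'k" where
  "top_functional X = (\<Sum>v\<in>verts Q. path_coeff (v, []) (SOME r. r \<in> carrier RA \<and> X = top_class r))"

lemma top_functional: "r \<in> carrier RA \<Longrightarrow> top_functional (top_class r) = (\<Sum>v\<in>verts Q. path_coeff (v, []) r)"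
proof -
  assume r: "r \<in> carrier RA"
  let ?s = "SOME s. s \<in> carrier RA \<and> top_class r = top_class s"
  have "?s \<in> carrier RA" "top_class r = top_class ?s"
    using someI[of "\<lambda>s. s \<in> carrier RA \<and> top_class r = top_class s" r] r by auto
  then have "\<forall>v\<in>verts Q. path_coeff (v, []) r = path_coeff (v, []) ?s" using top_module_rules(5)[OF r] by blast
  then show ?thesis unfolding top_functional_def by simp
qed

lemma monomial_target_top_module:
  "monomial_target (RA :: ('v, 'a, 'k::field) quot_elem ring) (scalar Q relation_ideal) (verts Q) (arcs Q) (idem Q relation_ideal) arrow (tail Q)
     (\<lambda>a. {b. blocked b a}) (\<lambda>v r. path_coeff (v, []) r) drop_last (top_module Q relation_ideal) top_functional (\<lambda>v. top_class (idem Q relation_ideal v))"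
proof (intro monomial_target.intro monomial_target_axioms.intro monomial_ring_quiver_algebra)
  note rules = top_module_rules
  show "left_module RA (top_module Q relation_ideal :: (('v, 'a, 'k) quot_elem, ('v, 'a, 'k) quot_elem set) module)"
    unfolding top_module_def by (rule MR.left_module_quotient[OF left_module_regular[OF ring_RA] submod_alg_positive])
  show "klinear (MR.kmod (top_module Q relation_ideal :: (('v, 'a, 'k) quot_elem, ('v, 'a, 'k) quot_elem set) module)) (carrier (top_module Q relation_ideal)) top_functional"
    unfolding klinear_def
    by (auto simp: rules top_functional path_coeff_add path_coeff_scalar_mult sum.distrib sum_distrib_left)
  show "top_class (idem Q relation_ideal v) \<in> carrier (top_module Q relation_ideal :: (('v, 'a, 'k) quot_elem, ('v, 'a, 'k) quot_elem set) module)"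
    if "v \<in> verts Q" for v using that by (simp add: rules(1))
  show "arrow a \<odot>\<^bsub>top_module Q relation_ideal\<^esub> x = \<zero>\<^bsub>top_module Q relation_ideal\<^esub>" if "a \<in> arcs Q" "x \<in> carrier (top_module Q relation_ideal)"
    for a and x :: "('v, 'a, 'k) quot_elem set"
  proof -
    obtain r where r: "r \<in> carrier RA" "x = top_class r" using \<open>x \<in> carrier (top_module Q relation_ideal)\<close> by (auto simp: rules(1))
    then show ?thesis using \<open>a \<in> arcs Q\<close> by (simp add: rules(3,4,5) path_coeff_arrow_mult)
  qed
  show "idem Q relation_ideal v \<odot>\<^bsub>top_module Q relation_ideal\<^esub> top_class (idem Q relation_ideal w) = (if v = w then top_class (idem Q relation_ideal w) else (\<zero>\<^bsub>top_module Q relation_ideal\<^esub> :: ('v, 'a, 'k) quot_elem set))"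
    if "v \<in> verts Q" "w \<in> verts Q" for v w
    using that by (simp add: rules MR.idm_idm)
  show "top_functional (top_class (idem Q relation_ideal v)) = (1::'k)" if "v \<in> verts Q" for v
    using that by (simp add: top_functional path_coeff_idem)
  show "x = \<zero>\<^bsub>top_module Q relation_ideal\<^esub>" if x: "x \<in> carrier (top_module Q relation_ideal)"
    and z: "\<And>v. v \<in> verts Q \<Longrightarrow> top_functional (idem Q relation_ideal v \<odot>\<^bsub>top_module Q relation_ideal\<^esub> x) = 0" for x :: "('v, 'a, 'k) quot_elem set"
  proof -
    obtain r where r: "r \<in> carrier RA" "x = top_class r" using x by (auto simp: rules(1))
    have "path_coeff (v, []) r = 0" if v: "v \<in> verts Q" for v
    proof -
      have "0 = (\<Sum>w\<in>verts Q. path_coeff (w, []) (idem Q relation_ideal v \<otimes>\<^bsub>RA\<^esub> r))"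
        using z[OF v] r v by (simp add: rules top_functional)
      also have "\<dots> = (\<Sum>w\<in>verts Q. if w = v then path_coeff (v, []) r else 0)"
        using v r by (intro sum.cong refl) (simp add: path_coeff_idem_mult)
      finally show ?thesis using v by simp
    qed
    then show ?thesis using r by (simp add: rules(4,5))
  qed
qed

section \<open>Finite presentations by free modules\<close>

lemma proj_sum_simps:
  "carrier (proj_sum Q relation_ideal xs) = (\<Pi>\<^sub>E j\<in>{..<length xs}. (\<lambda>a. a \<otimes>\<^bsub>RA\<^esub> idem Q relation_ideal (fst (xs ! j))) ` carrier (RA :: ('v, 'a, 'k::field) quot_elem ring))"
  "f \<oplus>\<^bsub>proj_sum Q relation_ideal xs\<^esub> g = (\<lambda>j\<in>{..<length xs}. f j \<oplus>\<^bsub>RA\<^esub> (g j :: ('v, 'a, 'k) quot_elem))"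
  "r \<odot>\<^bsub>proj_sum Q relation_ideal xs\<^esub> f = (\<lambda>j\<in>{..<length xs}. r \<otimes>\<^bsub>RA\<^esub> (f j :: ('v, 'a, 'k) quot_elem))"
proof -
  have "carrier (proj_sum Q relation_ideal xs) = (\<Pi>\<^sub>E j\<in>{..<length xs}. carrier (map (\<lambda>(v, i). shift i (vertex_proj Q relation_ideal v)) xs ! j :: (('v, 'a, 'k) quot_elem, ('v, 'a, 'k) quot_elem) graded_module))"
    by (simp add: proj_sum_def graded_sum_def)
  also have "\<dots> = (\<Pi>\<^sub>E j\<in>{..<length xs}. (\<lambda>a. a \<otimes>\<^bsub>RA\<^esub> idem Q relation_ideal (fst (xs ! j))) ` carrier (RA :: ('v, 'a, 'k) quot_elem ring))"
    by (rule PiE_cong) (simp add: shift_def vertex_proj_def case_prod_beta)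
  finally show "carrier (proj_sum Q relation_ideal xs) = (\<Pi>\<^sub>E j\<in>{..<length xs}. (\<lambda>a. a \<otimes>\<^bsub>RA\<^esub> idem Q relation_ideal (fst (xs ! j))) ` carrier (RA :: ('v, 'a, 'k) quot_elem ring))" .
  show "f \<oplus>\<^bsub>proj_sum Q relation_ideal xs\<^esub> g = (\<lambda>j\<in>{..<length xs}. f j \<oplus>\<^bsub>RA\<^esub> (g j :: ('v, 'a, 'k) quot_elem))"
    unfolding proj_sum_def graded_sum_def by (simp add: shift_def vertex_proj_def case_prod_beta cong: restrict_cong)
  show "r \<odot>\<^bsub>proj_sum Q relation_ideal xs\<^esub> f = (\<lambda>j\<in>{..<length xs}. r \<otimes>\<^bsub>RA\<^esub> (f j :: ('v, 'a, 'k) quot_elem))"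
    unfolding proj_sum_def graded_sum_def by (simp add: shift_def vertex_proj_def case_prod_beta cong: restrict_cong)
qed

text \<open>
  The projection of a free module onto the sum of the \<open>\<Lambda> e\<^sub>x\<close>. It turns a finite presentation by these
  projective modules into one by free modules, for which the two properties of \<open>arrow_free\<close> are at hand.
\<close>

definition free_to_proj :: "('v \<times> int) list \<Rightarrow> (nat \<Rightarrow> ('v, 'a, 'k::field) quot_elem) \<Rightarrow> nat \<Rightarrow> ('v, 'a, 'k) quot_elem" where
  "free_to_proj xs h = (\<lambda>j\<in>{..<length xs}. h j \<otimes>\<^bsub>RA\<^esub> idem Q relation_ideal (fst (xs ! j)))"

abbreviation free :: "nat \<Rightarrow> (('v, 'a, 'k::field) quot_elem, nat \<Rightarrow> ('v, 'a, 'k) quot_elem) module" where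
  "free n \<equiv> free_module RA {..<n}"

lemma free_carrier: "h \<in> carrier (free n) \<longleftrightarrow> (\<forall>j<n. h j \<in> carrier RA) \<and> (\<forall>j\<ge>n. h j = \<zero>\<^bsub>RA\<^esub>)"
proof
  assume h: "(\<forall>j<n. h j \<in> carrier RA) \<and> (\<forall>j\<ge>n. h j = \<zero>\<^bsub>RA\<^esub>)"
  then have "{j. h j \<noteq> \<zero>\<^bsub>RA\<^esub>} \<subseteq> {..<n}" by (auto simp: not_le[symmetric])
  then have "finite {j. h j \<noteq> \<zero>\<^bsub>RA\<^esub>}" by (rule finite_subset) simp
  moreover have "h j \<in> carrier RA" for j using h by (cases "j < n") auto
  ultimately show "h \<in> carrier (free n)" using h by (auto simp: free_module_carrier)
qed (auto simp: free_module_carrier)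

context
  fixes xs :: "('v \<times> int) list"
  assumes xs: "fst ` set xs \<subseteq> verts Q"
begin

lemma vertex_in: "j < length xs \<Longrightarrow> fst (xs ! j) \<in> verts Q"
  using xs nth_mem by blast

lemma idem_right:
  assumes "x \<in> carrier (proj_sum Q relation_ideal xs)" "j < length xs"
  shows "x j \<in> carrier RA" "x j \<otimes>\<^bsub>RA\<^esub> idem Q relation_ideal (fst (xs ! j)) = x j"
proof -
  note v = vertex_in[OF assms(2)]
  have "x j \<in> (\<lambda>a. a \<otimes>\<^bsub>RA\<^esub> idem Q relation_ideal (fst (xs ! j))) ` carrier RA"
    using assms by (auto simp: proj_sum_simps(1) PiE_iff)
  then obtain a where a: "a \<in> carrier RA" "x j = a \<otimes>\<^bsub>RA\<^esub> idem Q relation_ideal (fst (xs ! j))" by auto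
  show "x j \<in> carrier RA" using a v by simp
  show "x j \<otimes>\<^bsub>RA\<^esub> idem Q relation_ideal (fst (xs ! j)) = x j"
    using a v by (simp add: RA.m_assoc MR.idm_idm)
qed

lemma lmap_free_to_proj: "lmap RA (free (length xs)) (proj_sum Q relation_ideal xs) (free_to_proj xs)"
  unfolding lmap_def
  by (auto simp: free_to_proj_def proj_sum_simps free_carrier vertex_in RA.l_distr RA.m_assoc intro!: restrict_ext)

lemma free_to_proj_restrict:
  assumes "x \<in> carrier (proj_sum Q relation_ideal xs)"
  shows "(\<lambda>j. if j < length xs then x j else \<zero>\<^bsub>RA\<^esub>) \<in> carrier (free (length xs))"
    "free_to_proj xs (\<lambda>j. if j < length xs then x j else \<zero>\<^bsub>RA\<^esub>) = x"
proof -
  show "(\<lambda>j. if j < length xs then x j else \<zero>\<^bsub>RA\<^esub>) \<in> carrier (free (length xs))"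
    using idem_right(1)[OF assms] by (simp add: free_carrier)
  have "x \<in> extensional {..<length xs}" using assms by (simp add: proj_sum_simps(1) PiE_iff)
  then show "free_to_proj xs (\<lambda>j. if j < length xs then x j else \<zero>\<^bsub>RA\<^esub>) = x"
    using idem_right(2)[OF assms] by (intro extensionalityI[of _ "{..<length xs}"]) (auto simp: free_to_proj_def)
qed

end

lemma lmap_comp: "lmap R L M f \<Longrightarrow> lmap R M N g \<Longrightarrow> lmap R L N (\<lambda>x. g (f x))"
  by (simp add: lmap_def)

text \<open>
  Let \<open>f\<close> be the given map onto \<open>M\<close> and \<open>e\<^sub>j\<close> the idempotents that belong to its source. The kernel of the
  composition with the projection consists of the \<open>h\<close> for which the projection of \<open>h\<close> lies in the kernel
  of \<open>f\<close>. It is generated by the kernel of \<open>f\<close> and the elements with \<open>j\<close>-th coordinate \<open>1 - e\<^sub>j\<close>.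
\<close>

lemma finitely_presented_by_free:
  fixes M :: "(('v, 'a, 'k::field) quot_elem, 'm) graded_module"
  assumes "finitely_presented Q relation_ideal M"
  obtains n m p g where "lmap RA (free n) M p" "p ` carrier (free n) = carrier M"
    "lmap RA (free m) (free n) g" "g ` carrier (free m) = {x \<in> carrier (free n). p x = \<zero>\<^bsub>M\<^esub>}"
proof -
  obtain xs ys f g where xs: "fst ` set xs \<subseteq> verts Q" and ys: "fst ` set ys \<subseteq> verts Q"
    and f: "f \<in> graded_hom RA (proj_sum Q relation_ideal xs) M"
    and g: "g \<in> graded_hom RA (proj_sum Q relation_ideal ys) (proj_sum Q relation_ideal xs)"
    and f_onto: "f ` carrier (proj_sum Q relation_ideal xs) = carrier M"
    and g_ker: "g ` carrier (proj_sum Q relation_ideal ys) = {x \<in> carrier (proj_sum Q relation_ideal xs). f x = \<zero>\<^bsub>M\<^esub>}"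
    using assms unfolding finitely_presented_def by (elim exE conjE bexE) (rule that; assumption)
  let ?n = "length xs" and ?m = "length ys"
  have fl: "lmap RA (proj_sum Q relation_ideal xs) M f" and gl: "lmap RA (proj_sum Q relation_ideal ys) (proj_sum Q relation_ideal xs) g"
    using f g by (auto simp: graded_hom_def lmod_hom_iff)
  define p where "p h = f (free_to_proj xs h)" for h
  have p: "lmap RA (free ?n) M p" unfolding p_def by (rule lmap_comp[OF lmap_free_to_proj[OF xs] fl])
  have proj_onto: "free_to_proj zs ` carrier (free (length zs)) = carrier (proj_sum Q relation_ideal zs)" if "fst ` set zs \<subseteq> verts Q" for zs
    using lmapD(1)[OF lmap_free_to_proj[OF that]] free_to_proj_restrict[OF that] by (force simp: image_iff)
  have p_onto: "p ` carrier (free ?n) = carrier M"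
    unfolding p_def f_onto[symmetric] proj_onto[OF xs, symmetric] by (simp add: image_image)
  let ?e = "\<lambda>j. idem Q relation_ideal (fst (xs ! j)) :: ('v, 'a, 'k) quot_elem"
  have e: "?e j \<in> carrier RA" "?e j \<otimes>\<^bsub>RA\<^esub> ?e j = ?e j" if "j < ?n" for j
    using vertex_in[OF xs that] by (simp_all add: MR.idm_idm)
  have e1: "\<one>\<^bsub>RA\<^esub> \<ominus>\<^bsub>RA\<^esub> ?e j \<in> carrier RA" "(\<one>\<^bsub>RA\<^esub> \<ominus>\<^bsub>RA\<^esub> ?e j) \<otimes>\<^bsub>RA\<^esub> ?e j = \<zero>\<^bsub>RA\<^esub>" if "j < ?n" for j
  proof -
    show "\<one>\<^bsub>RA\<^esub> \<ominus>\<^bsub>RA\<^esub> ?e j \<in> carrier RA" using e[OF that] by simp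
    have "(\<one>\<^bsub>RA\<^esub> \<ominus>\<^bsub>RA\<^esub> ?e j) \<otimes>\<^bsub>RA\<^esub> ?e j = \<one>\<^bsub>RA\<^esub> \<otimes>\<^bsub>RA\<^esub> ?e j \<oplus>\<^bsub>RA\<^esub> (\<ominus>\<^bsub>RA\<^esub> ?e j) \<otimes>\<^bsub>RA\<^esub> ?e j"
      unfolding RA.minus_eq using e[OF that] by (intro RA.l_distr) auto
    also have "\<dots> = ?e j \<oplus>\<^bsub>RA\<^esub> \<ominus>\<^bsub>RA\<^esub> ?e j"
      using e[OF that] RA.l_minus[OF e(1)[OF that] e(1)[OF that]] by simp
    also have "\<dots> = \<zero>\<^bsub>RA\<^esub>" by (rule RA.r_neg[OF e(1)[OF that]])
    finally show "(\<one>\<^bsub>RA\<^esub> \<ominus>\<^bsub>RA\<^esub> ?e j) \<otimes>\<^bsub>RA\<^esub> ?e j = \<zero>\<^bsub>RA\<^esub>" .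
  qed
  (* The first length ys coordinates of k parametrise the kernel of f, the others the multiples of 1 - e_j. *)
  define G where "G k = (\<lambda>j. if j < ?n then g (free_to_proj ys k) j \<oplus>\<^bsub>RA\<^esub> k (?m + j) \<otimes>\<^bsub>RA\<^esub> (\<one>\<^bsub>RA\<^esub> \<ominus>\<^bsub>RA\<^esub> ?e j) else \<zero>\<^bsub>RA\<^esub>)" for k
  have restr: "free_to_proj ys k \<in> carrier (proj_sum Q relation_ideal ys)" if "k \<in> carrier (free (?m + ?n))" for k
    using that vertex_in[OF ys] by (auto simp: free_to_proj_def proj_sum_simps free_carrier)
  have gj: "g (free_to_proj ys k) \<in> carrier (proj_sum Q relation_ideal xs)" "\<And>j. j < ?n \<Longrightarrow> g (free_to_proj ys k) j \<in> carrier RA"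
    if "k \<in> carrier (free (?m + ?n))" for k
    using lmapD(1)[OF gl restr[OF that]] idem_right(1)[OF xs] by auto
  have kj: "k j \<in> carrier RA" if "k \<in> carrier (free (?m + ?n))" for k j
    using that by (auto simp: free_module_carrier)
  have G: "lmap RA (free (?m + ?n)) (free ?n) G"
    unfolding lmap_def
  proof (intro conjI ballI)
    fix k :: "nat \<Rightarrow> ('v, 'a, 'k) quot_elem" assume k: "k \<in> carrier (free (?m + ?n))"
    show "G k \<in> carrier (free ?n)" using gj[OF k] kj[OF k] e1 by (auto simp: free_carrier G_def)
    have "free_to_proj ys (\<lambda>j. r \<otimes>\<^bsub>RA\<^esub> k j) = r \<odot>\<^bsub>proj_sum Q relation_ideal ys\<^esub> free_to_proj ys k" if "r \<in> carrier RA" for r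
      using that kj[OF k] vertex_in[OF ys] by (auto simp: free_to_proj_def proj_sum_simps RA.m_assoc intro!: restrict_ext)
    then have "g (free_to_proj ys (\<lambda>j. r \<otimes>\<^bsub>RA\<^esub> k j)) j = r \<otimes>\<^bsub>RA\<^esub> g (free_to_proj ys k) j"
      if "r \<in> carrier RA" "j < ?n" for r j
      using that lmapD(3)[OF gl that(1) restr[OF k]] by (simp add: proj_sum_simps(3))
    then show "G (r \<odot>\<^bsub>free (?m + ?n)\<^esub> k) = r \<odot>\<^bsub>free ?n\<^esub> G k" if "r \<in> carrier RA" for r
      using that gj[OF k] kj[OF k] e1
      by (simp add: G_def fun_eq_iff RA.r_distr RA.m_assoc)
    fix k' :: "nat \<Rightarrow> ('v, 'a, 'k) quot_elem" assume k': "k' \<in> carrier (free (?m + ?n))"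
    have "free_to_proj ys (\<lambda>j. k j \<oplus>\<^bsub>RA\<^esub> k' j) = free_to_proj ys k \<oplus>\<^bsub>proj_sum Q relation_ideal ys\<^esub> free_to_proj ys k'"
      using kj[OF k] kj[OF k'] vertex_in[OF ys] by (auto simp: free_to_proj_def proj_sum_simps RA.l_distr intro!: restrict_ext)
    then have "g (free_to_proj ys (\<lambda>j. k j \<oplus>\<^bsub>RA\<^esub> k' j)) j = g (free_to_proj ys k) j \<oplus>\<^bsub>RA\<^esub> g (free_to_proj ys k') j"
      if "j < ?n" for j
      using that lmapD(2)[OF gl restr[OF k] restr[OF k']] by (simp add: proj_sum_simps(2))
    then show "G (k \<oplus>\<^bsub>free (?m + ?n)\<^esub> k') = G k \<oplus>\<^bsub>free ?n\<^esub> G k'"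
      using gj[OF k] gj[OF k'] kj[OF k] kj[OF k'] e1
      by (simp add: G_def fun_eq_iff RA.l_distr RA.a_ac)
  qed
  have "G ` carrier (free (?m + ?n)) = {x \<in> carrier (free ?n). p x = \<zero>\<^bsub>M\<^esub>}"
  proof
    show "G ` carrier (free (?m + ?n)) \<subseteq> {x \<in> carrier (free ?n). p x = \<zero>\<^bsub>M\<^esub>}"
    proof
      fix x assume "x \<in> G ` carrier (free (?m + ?n))"
      then obtain k where k: "k \<in> carrier (free (?m + ?n))" "x = G k" by auto
      note gk = gj[OF k(1)]
      have "free_to_proj xs x j = g (free_to_proj ys k) j" if j: "j < ?n" for j
        using j gk kj[OF k(1)] e[OF j] e1[OF j] idem_right(2)[OF xs gk(1) j]
        by (simp add: free_to_proj_def k(2) G_def RA.l_distr RA.m_assoc)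
      moreover have "g (free_to_proj ys k) \<in> extensional {..<?n}" using gk(1) by (simp add: proj_sum_simps(1) PiE_iff)
      ultimately have "free_to_proj xs x = g (free_to_proj ys k)"
        by (intro extensionalityI[of _ "{..<?n}"]) (auto simp: free_to_proj_def)
      then have "p x = \<zero>\<^bsub>M\<^esub>" using g_ker restr[OF k(1)] by (auto simp: p_def)
      then show "x \<in> {x \<in> carrier (free ?n). p x = \<zero>\<^bsub>M\<^esub>}" using lmapD(1)[OF G k(1)] k(2) by simp
    qed
    show "{x \<in> carrier (free ?n). p x = \<zero>\<^bsub>M\<^esub>} \<subseteq> G ` carrier (free (?m + ?n))"
    proof
      fix h assume h: "h \<in> {x \<in> carrier (free ?n). p x = \<zero>\<^bsub>M\<^esub>}"
      then have hc: "h \<in> carrier (free ?n)" by simp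
      have hj: "h j \<in> carrier RA" for j using hc by (auto simp: free_module_carrier)
      have "free_to_proj xs h \<in> g ` carrier (proj_sum Q relation_ideal ys)"
        unfolding g_ker using h lmapD(1)[OF lmap_free_to_proj[OF xs]] by (auto simp: p_def)
      then obtain z where z: "z \<in> carrier (proj_sum Q relation_ideal ys)" "free_to_proj xs h = g z" by auto
      define k where "k = (\<lambda>i. if i < ?m then z i else if i < ?m + ?n then h (i - ?m) else \<zero>\<^bsub>RA\<^esub>)"
      have k: "k \<in> carrier (free (?m + ?n))"
        using idem_right(1)[OF ys z(1)] hj by (auto simp: free_carrier k_def)
      have "free_to_proj ys k = free_to_proj ys (\<lambda>j. if j < ?m then z j else \<zero>\<^bsub>RA\<^esub>)"
        by (auto simp: free_to_proj_def k_def intro!: restrict_ext)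
      then have kz: "free_to_proj ys k = z" using free_to_proj_restrict(2)[OF ys z(1)] by simp
      have "G k j = h j" for j
      proof (cases "j < ?n")
        case True
        have "G k j = h j \<otimes>\<^bsub>RA\<^esub> ?e j \<oplus>\<^bsub>RA\<^esub> h j \<otimes>\<^bsub>RA\<^esub> (\<one>\<^bsub>RA\<^esub> \<ominus>\<^bsub>RA\<^esub> ?e j)"
        proof -
          have "g (free_to_proj ys k) j = h j \<otimes>\<^bsub>RA\<^esub> ?e j"
            unfolding kz z(2)[symmetric] using True by (simp add: free_to_proj_def)
          moreover have "k (?m + j) = h j" using True by (simp add: k_def)
          ultimately show ?thesis using True by (simp add: G_def)
        qed
        also have "\<dots> = h j \<otimes>\<^bsub>RA\<^esub> (?e j \<oplus>\<^bsub>RA\<^esub> (\<one>\<^bsub>RA\<^esub> \<ominus>\<^bsub>RA\<^esub> ?e j))"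
          using True hj e e1 by (simp add: RA.r_distr)
        also have "?e j \<oplus>\<^bsub>RA\<^esub> (\<one>\<^bsub>RA\<^esub> \<ominus>\<^bsub>RA\<^esub> ?e j) = \<one>\<^bsub>RA\<^esub>"
          using e(1)[OF True] by (simp add: RA.minus_eq RA.a_lcomm RA.r_neg)
        finally show ?thesis using hj by simp
      next
        case False
        then show ?thesis using hc by (simp add: G_def free_carrier)
      qed
      then have "G k = h" by (simp add: fun_eq_iff)
      then show "h \<in> G ` carrier (free (?m + ?n))" using k by blast
    qed
  qed
  then show ?thesis by (rule that[OF p p_onto G])
qed

lemma ext_dimensions_quiver:
  fixes M :: "(('v, 'a, 'k::field) quot_elem, 'm) graded_module"
  assumes M: "left_module RA M" and fp: "finitely_presented Q relation_ideal M"
  shows "\<exists>w. (\<forall>n. finite_dimensional (Ext (scalar Q relation_ideal) RA n M (top_module Q relation_ideal))) \<and>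
    (\<forall>n. dimension (Ext (scalar Q relation_ideal) RA (Suc (Suc n)) M (top_module Q relation_ideal)) = (\<Sum>c\<in>arcs Q. w n c)) \<and>
    (\<forall>n. \<forall>c\<in>arcs Q. w (Suc n) c = (\<Sum>b\<in>{b. blocked b c}. w n b))"
proof -
  interpret MT: monomial_target "RA :: ('v, 'a, 'k::field) quot_elem ring" "scalar Q relation_ideal" "verts Q" "arcs Q" "idem Q relation_ideal" arrow "tail Q"
    "\<lambda>a. {b. blocked b a}" "\<lambda>v r. path_coeff (v, []) r" drop_last "top_module Q relation_ideal" top_functional "\<lambda>v. top_class (idem Q relation_ideal v)"
    by (rule monomial_target_top_module)
  obtain n m p g where pg: "lmap RA (free n) M p" "p ` carrier (free n) = carrier M"
    "lmap RA (free m) (free n) g" "g ` carrier (free m) = {x \<in> carrier (free n). p x = \<zero>\<^bsub>M\<^esub>}"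
    by (rule finitely_presented_by_free[OF fp])
  let ?F = "\<lambda>n. free n :: (('v, 'a, 'k) quot_elem, nat \<Rightarrow> ('v, 'a, 'k) quot_elem) module"
  have "\<exists>d. qdim (MR.kmod (?F n)) (carrier (?F n)) (MR.arrow_span (?F n) (arcs Q) (carrier (?F n))) d" for n
    by (rule MR.qdim_free_top) simp
  then obtain d d' where d: "qdim (MR.kmod (?F n)) (carrier (?F n)) (MR.arrow_span (?F n) (arcs Q) (carrier (?F n))) d"
    and d': "qdim (MR.kmod (?F m)) (carrier (?F m)) (MR.arrow_span (?F m) (arcs Q) (carrier (?F m))) d'"
    by blast
  show ?thesis
    by (rule MT.ext_dimensions[OF M left_module_free[OF ring_RA] MR.arrow_free_free pg(1,2) d left_module_free[OF ring_RA] pg(3,4) d'])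
qed

end

section \<open>Rationality\<close>

text \<open>
  The vectors \<open>W 0, \<dots>, W (card A)\<close> are more than the dimension of the space of functions on \<open>A\<close>.
\<close>

lemma linear_dependence_of_sequence:
  fixes W :: "nat \<Rightarrow> 'a \<Rightarrow> 'f::field"
  assumes "finite A" "\<And>i a. a \<notin> A \<Longrightarrow> W i a = 0"
  shows "\<exists>q. (\<exists>i\<le>card A. q i \<noteq> 0) \<and> (\<forall>a. (\<Sum>i\<le>card A. q i * W i a) = 0)"
proof (cases "inj_on W {..card A}")
  case False
  then obtain i j where ij: "i \<le> card A" "j \<le> card A" "i \<noteq> j" "W i = W j" by (auto simp: inj_on_def)
  let ?q = "\<lambda>k. (if k = i then 1 else 0) - (if k = j then 1 else 0) :: 'f"
  have "(\<Sum>k\<le>card A. ?q k * W k a) = W i a - W j a" for a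
    using ij by (simp add: left_diff_distrib sum_subtractf if_distrib[of "\<lambda>x. x * _"] cong: if_cong)
  then show ?thesis using ij by (intro exI[of _ ?q]) auto
next
  case True
  interpret vector_space "fscale :: 'f \<Rightarrow> ('a \<Rightarrow> 'f) \<Rightarrow> _" by (rule vector_space_fscale)
  have "W ` {..card A} \<subseteq> span (unit_vector ` A)"
    using supported_in_span[OF assms(1)] assms(2) by blast
  moreover have "card (unit_vector ` A :: ('a \<Rightarrow> 'f) set) \<le> card A" using card_image_le[OF assms(1)] by blast
  moreover have "card (W ` {..card A}) = Suc (card A)" using card_image[OF True] by simp
  ultimately have "dependent (W ` {..card A})"
    using independent_span_bound[of "unit_vector ` A" "W ` {..card A}"] assms(1) by fastforce
  then obtain u where u: "\<exists>v\<in>W ` {..card A}. u v \<noteq> 0" "(\<Sum>v\<in>W ` {..card A}. fscale (u v) v) = 0"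
    using dependent_finite[of "W ` {..card A}"] by auto
  have "(\<Sum>i\<le>card A. u (W i) * W i a) = 0" for a
    using fun_cong[OF u(2), of a] by (simp add: sum_function_apply sum.reindex[OF True])
  then show ?thesis using u(1) by (intro exI[of _ "\<lambda>i. u (W i)"]) auto
qed

text \<open>
  The denominator is the reversed characteristic polynomial.
\<close>

lemma rational_fps_of_recurrence:
  fixes t :: "nat \<Rightarrow> 'f::field"
  assumes q: "i \<le> N" "q i \<noteq> 0" and rec: "\<And>n. n \<ge> n0 \<Longrightarrow> (\<Sum>i\<le>N. q i * t (n + i)) = 0"
  shows "rational_fps (Abs_fps t)"
proof -
  define D where "D = (\<Sum>i\<le>N. monom (q i) (N - i))"
  have D: "coeff D j = (if j \<le> N then q (N - j) else 0)" for j
  proof -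
    have "coeff D j = (\<Sum>i\<le>N. if i = N - j \<and> j \<le> N then q i else 0)"
      unfolding D_def coeff_sum coeff_monom by (intro sum.cong refl) auto
    then show ?thesis by (cases "j \<le> N") auto
  qed
  have "D \<noteq> 0" using D[of "N - i"] q by auto
  define F where "F = fps_of_poly D * Abs_fps t"
  have high: "fps_nth F m = 0" if "m \<ge> N + n0" for m
  proof -
    have "fps_nth F m = (\<Sum>j\<le>m. coeff D j * t (m - j))"
      by (simp add: F_def fps_mult_nth atLeast0AtMost)
    also have "\<dots> = (\<Sum>j\<le>N. q (N - j) * t (m - j))"
      using that by (intro sum.mono_neutral_cong_right) (auto simp: D)
    also have "\<dots> = (\<Sum>i\<le>N. q i * t (m - N + i))"
      using that by (intro sum.reindex_bij_witness[of _ "\<lambda>i. N - i" "\<lambda>i. N - i"]) auto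
    also have "\<dots> = 0" using rec[of "m - N"] that by simp
    finally show ?thesis .
  qed
  have "F = fps_of_poly (\<Sum>m<N + n0. monom (fps_nth F m) m)"
  proof (rule fps_ext)
    fix k
    have "coeff (\<Sum>m<N + n0. monom (fps_nth F m) m) k = (\<Sum>m<N + n0. if m = k then fps_nth F k else 0)"
      unfolding coeff_sum coeff_monom by (intro sum.cong refl) auto
    then show "fps_nth F k = fps_nth (fps_of_poly (\<Sum>m<N + n0. monom (fps_nth F m) m)) k"
      using high[of k] by (cases "k < N + n0") auto
  qed
  then show ?thesis unfolding rational_fps_def F_def using \<open>D \<noteq> 0\<close> by blast
qed

text \<open>
  A linear dependence between the first \<open>w n\<close> is preserved by the recurrence and hence persists after any
  shift of the index, so that it becomes a scalar recurrence for \<open>t\<close>.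
\<close>

lemma rational_fps_of_transfer:
  fixes w :: "nat \<Rightarrow> 'a \<Rightarrow> nat" and t :: "nat \<Rightarrow> nat"
  assumes A: "finite A" and B: "\<And>c. c \<in> A \<Longrightarrow> B c \<subseteq> A"
    and w: "\<And>n c. c \<in> A \<Longrightarrow> w (Suc n) c = (\<Sum>b\<in>B c. w n b)"
    and t: "\<And>n. t (n + k) = (\<Sum>c\<in>A. w n c)"
  shows "rational_fps (Abs_fps (\<lambda>n. of_nat (t n) :: rat))"
proof -
  let ?W = "\<lambda>i a. if a \<in> A then of_nat (w i a) else (0 :: rat)"
  obtain q i where q: "i \<le> card A" "q i \<noteq> 0" "\<And>a. (\<Sum>i\<le>card A. q i * ?W i a) = 0"
    using linear_dependence_of_sequence[OF A, of ?W] by auto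
  have rec: "(\<Sum>i\<le>card A. q i * of_nat (w (n + i) c)) = 0" if "c \<in> A" for n c
    using that
  proof (induction n arbitrary: c)
    case 0
    then show ?case using q(3)[of c] by simp
  next
    case (Suc n)
    have "(\<Sum>i\<le>card A. q i * of_nat (w (Suc n + i) c)) = (\<Sum>i\<le>card A. \<Sum>b\<in>B c. q i * of_nat (w (n + i) b))"
      using w[OF Suc.prems] by (simp add: sum_distrib_left)
    also have "\<dots> = (\<Sum>b\<in>B c. \<Sum>i\<le>card A. q i * of_nat (w (n + i) b))" by (rule sum.swap)
    also have "\<dots> = 0" using Suc B by (intro sum.neutral) auto
    finally show ?case .
  qed
  show ?thesis
  proof (rule rational_fps_of_recurrence[where q = q and i = i and N = "card A" and ?n0.0 = k, OF q(1,2)])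
    fix n assume "n \<ge> k"
    then have "(\<Sum>i\<le>card A. q i * of_nat (t (n + i))) = (\<Sum>i\<le>card A. \<Sum>c\<in>A. q i * of_nat (w (n - k + i) c))"
      using t[of "n - k + _"] by (simp add: sum_distrib_left)
    also have "\<dots> = (\<Sum>c\<in>A. \<Sum>i\<le>card A. q i * of_nat (w (n - k + i) c))" by (rule sum.swap)
    also have "\<dots> = 0" using rec by (intro sum.neutral) auto
    finally show "(\<Sum>i\<le>card A. q i * of_nat (t (n + i))) = 0" .
  qed
qed

theorem corollary3p6:
  fixes Q :: "('v, 'a) pre_digraph"
    and I :: "(('v, 'a) qpath \<Rightarrow>\<^sub>0 'k::field) set"
    and M :: "(('v, 'a, 'k) quot_elem, 'm) graded_module"
  assumes "fin_digraph Q"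
    and "quadratic_monomial_ideal Q I"
    and "graded_left_module Q I M"
    and "finitely_presented Q I M"
  shows "(\<forall>n. finite_dimensional (Ext (scalar Q I) (quiver_algebra Q I) n M (top_module Q I)))
    \<and> rational_fps (poincare_series Q I M)"
proof -
  obtain \<rho> where \<rho>: "\<rho> \<subseteq> {p \<in> paths Q. path_length p = 2}" "I = Idl\<^bsub>path_algebra Q\<^esub> ((\<lambda>p. Poly_Mapping.single p 1) ` \<rho>)"
    using assms(2) unfolding quadratic_monomial_ideal_def by blast
  interpret quadratic_relations Q \<rho>
    by (intro quadratic_relations.intro quadratic_relations_axioms.intro assms(1) \<rho>(1))
  have I: "I = relation_ideal" by (simp add: \<rho>(2) relation_ideal_def)
  have M: "left_module RA M" using assms(3) unfolding graded_left_module_def I by blast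
  obtain w where w: "\<And>n. finite_dimensional (Ext (scalar Q relation_ideal) RA n M (top_module Q relation_ideal))"
    "\<And>n. dimension (Ext (scalar Q relation_ideal) RA (Suc (Suc n)) M (top_module Q relation_ideal)) = (\<Sum>c\<in>arcs Q. w n c)"
    "\<And>n c. c \<in> arcs Q \<Longrightarrow> w (Suc n) c = (\<Sum>b\<in>{b. blocked b c}. w n b)"
    using ext_dimensions_quiver[OF M assms(4)[unfolded I]] by metis
  have "rational_fps (poincare_series Q relation_ideal M)"
    unfolding poincare_series_def
    by (rule rational_fps_of_transfer[where A = "arcs Q" and B = "\<lambda>c. {b. blocked b c}" and w = w and k = 2
          and t = "\<lambda>n. dimension (Ext (scalar Q relation_ideal) RA n M (top_module Q relation_ideal))"])
      (use w(2,3) blockedD in \<open>auto simp: numeral_2_eq_2\<close>)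
  then show ?thesis using w(1) unfolding I by blast
qed

end
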